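(* Let $n\ge 1$ be an integer and let $\mathbf{C}^n$ be the defining representation of $\mathrm{GL}_n(\mathbf{C})$. For every non-negative integer $d$, as representations of $\mathrm{GL}_n(\mathbf{C})$, $$\wedge^d(\wedge^2\mathbf{C}^n)\cong\bigoplus_{\lambda\in\mathrm{TP}(2d)}W^n_\lambda,$$ $$\wedge^d(\mathrm{Sym}^2\mathbf{C}^n)\cong\bigoplus_{\lambda:\ \lambda'\in\mathrm{TP}(2d)}W^n_\lambda,$$ where $\mathrm{TP}(2d)$ is the set of threshold partitions of $2d$ and $\lambda'$ is the partition conjugate to $\lambda$.
   Context: A polynomial representation of $\mathrm{GL}_n(\mathbf{C})$ is a finite dimensional complex representation whose matrix entries are polynomials in the entries of the group element. For a polynomial representation $(\rho,W)$, its character is $\mathrm{ch}_W(x_1,\dots,x_n)=\mathrm{tr}(\rho(\mathrm{diag}(x_1,\dots,x_n)))$. A semistandard Young tableau of shape $\lambda$ in $n$ letters is a filling of the Young diagram of $\lambda$ (with $\lambda_i$ boxes in row $i$) by numbers in $\{1,\dots,n\}$, weakly increasing along rows and strictly increasing down columns; the Schur polynomial $s_\lambda(x_1,\dots,x_n)$ is the sum over all such tableaux of $x_1^{\mu_1}\cdots x_n^{\mu_n}$, where $\mu_i$ is the number of occurrences of $i$. For a partition $\lambda$ with at most $n$ nonzero parts, $W^n_\lambda$ denotes the irreducible polynomial representation of $\mathrm{GL}_n(\mathbf{C})$ (unique up to isomorphism) with character $s_\lambda(x_1,\dots,x_n)$. Convention: $W^n_\lambda=0$ if $\lambda$ has more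 than $n$ nonzero parts. The conjugate partition $\lambda'$ is given by $\lambda'_i=\#\{j\mid\lambda_j\ge i\}$. For a partition $\lambda$, the Durfee rank is the largest index $r$ such that $\lambda_r\ge r$ (and $0$ for the empty partition). For $i=1,\dots,r$ let $\alpha_i=\lambda_i-i$ and $\beta_i=\lambda'_i-i$; $(\alpha_1,\dots,\alpha_r\mid\beta_1,\dots,\beta_r)$ are the Frobenius coordinates of $\lambda$. The partition $\lambda$ is called a threshold partition if $\beta_i=\alpha_i+1$ for all $i=1,\dots,r$. $\mathrm{TP}(N)$ denotes the set of threshold partitions of $N$. *)

theory Defs
  imports
    "Jordan_Normal_Form.Matrix"
    "HOL-Library.Function_Algebras"
    "HOL-Library.FuncSet"
    "HOL-Library.Multiset"
begin

section \<open>Complex vector spaces and representations of the general linear group\<close>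

text \<open>
  All representation spaces are linear subspaces of function spaces \<^typ>\<open>'a \<Rightarrow> complex\<close> with
  pointwise operations.
\<close>

definition fscale :: "complex \<Rightarrow> ('a \<Rightarrow> complex) \<Rightarrow> 'a \<Rightarrow> complex" where
  "fscale c f = (\<lambda>x. c * f x)"

interpretation fs: vector_space fscale
  by unfold_locales (auto simp: fscale_def fun_eq_iff algebra_simps)

definition GL :: "nat \<Rightarrow> complex mat set" where
  "GL n = {g \<in> carrier_mat n n. invertible_mat g}"

record 'a rep =
  rep_space :: "('a \<Rightarrow> complex) set"
  rep_act :: "complex mat \<Rightarrow> ('a \<Rightarrow> complex) \<Rightarrow> 'a \<Rightarrow> complex"

definition linear_map_on ::
  "('a \<Rightarrow> complex) set \<Rightarrow> ('b \<Rightarrow> complex) set \<Rightarrow> (('a \<Rightarrow> complex) \<Rightarrow> 'b \<Rightarrow> complex) \<Rightarrow> bool" where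
  "linear_map_on V V' f \<longleftrightarrow>
     (\<forall>v\<in>V. f v \<in> V') \<and>
     (\<forall>u\<in>V. \<forall>v\<in>V. f (u + v) = f u + f v) \<and>
     (\<forall>c. \<forall>v\<in>V. f (fscale c v) = fscale c (f v))"

definition is_basis :: "('a \<Rightarrow> complex) set \<Rightarrow> ('a \<Rightarrow> complex) set \<Rightarrow> bool" where
  "is_basis V B \<longleftrightarrow> fs.independent B \<and> fs.span B = V"

definition matrix_entry ::
  "('a \<Rightarrow> complex) set \<Rightarrow> (('a \<Rightarrow> complex) \<Rightarrow> 'a \<Rightarrow> complex) \<Rightarrow>
   ('a \<Rightarrow> complex) \<Rightarrow> ('a \<Rightarrow> complex) \<Rightarrow> complex" where
  "matrix_entry B f b c = fs.representation B (f c) b"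

definition trace_on :: "('a \<Rightarrow> complex) set \<Rightarrow> (('a \<Rightarrow> complex) \<Rightarrow> 'a \<Rightarrow> complex) \<Rightarrow> complex" where
  "trace_on V f = (let B = (SOME B. is_basis V B) in \<Sum>b\<in>B. matrix_entry B f b b)"

definition is_rep :: "nat \<Rightarrow> 'a rep \<Rightarrow> bool" where
  "is_rep n R \<longleftrightarrow>
     (\<exists>B. finite B \<and> is_basis (rep_space R) B) \<and>
     (\<forall>g\<in>GL n. linear_map_on (rep_space R) (rep_space R) (rep_act R g)) \<and>
     (\<forall>v\<in>rep_space R. rep_act R (1\<^sub>m n) v = v) \<and>
     (\<forall>g\<in>GL n. \<forall>h\<in>GL n. \<forall>v\<in>rep_space R.
        rep_act R (g * h) v = rep_act R g (rep_act R h v))"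

inductive polynomial_in_entries :: "nat \<Rightarrow> (complex mat \<Rightarrow> complex) \<Rightarrow> bool" for n where
  const: "polynomial_in_entries n (\<lambda>g. c)"
| entry: "i < n \<Longrightarrow> j < n \<Longrightarrow> polynomial_in_entries n (\<lambda>g. g $$ (i, j))"
| add: "polynomial_in_entries n p \<Longrightarrow> polynomial_in_entries n q \<Longrightarrow>
    polynomial_in_entries n (\<lambda>g. p g + q g)"
| mult: "polynomial_in_entries n p \<Longrightarrow> polynomial_in_entries n q \<Longrightarrow>
    polynomial_in_entries n (\<lambda>g. p g * q g)"

definition is_polynomial_rep :: "nat \<Rightarrow> 'a rep \<Rightarrow> bool" where
  "is_polynomial_rep n R \<longleftrightarrow> is_rep n R \<and>
     (\<exists>B. is_basis (rep_space R) B \<and>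
       (\<forall>b\<in>B. \<forall>c\<in>B. \<exists>p. polynomial_in_entries n p \<and>
          (\<forall>g\<in>GL n. matrix_entry B (rep_act R g) b c = p g)))"

definition is_irreducible :: "nat \<Rightarrow> 'a rep \<Rightarrow> bool" where
  "is_irreducible n R \<longleftrightarrow> rep_space R \<noteq> {0} \<and>
     (\<forall>U. fs.subspace U \<and> U \<subseteq> rep_space R \<and> (\<forall>g\<in>GL n. rep_act R g ` U \<subseteq> U) \<longrightarrow>
        U = {0} \<or> U = rep_space R)"

text \<open>Variables are numbered \<open>x 1, \<dots>, x n\<close>, whereas matrix indices start at \<open>0\<close>.\<close>

definition character :: "nat \<Rightarrow> 'a rep \<Rightarrow> (nat \<Rightarrow> complex) \<Rightarrow> complex" where
  "character n R x = trace_on (rep_space R) (rep_act R (mat_diag n (\<lambda>i. x (Suc i))))"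

definition rep_iso :: "nat \<Rightarrow> 'a rep \<Rightarrow> 'b rep \<Rightarrow> bool" where
  "rep_iso n R S \<longleftrightarrow> (\<exists>\<phi>.
     linear_map_on (rep_space R) (rep_space S) \<phi> \<and>
     bij_betw \<phi> (rep_space R) (rep_space S) \<and>
     (\<forall>g\<in>GL n. \<forall>v\<in>rep_space R. \<phi> (rep_act R g v) = rep_act S g (\<phi> v)))"

definition defining_rep :: "nat \<Rightarrow> nat rep" where
  "defining_rep n =
     \<lparr>rep_space = {v. \<forall>i\<ge>n. v i = 0},
      rep_act = (\<lambda>g v i. if i < n then \<Sum>j<n. g $$ (i, j) * v j else 0)\<rparr>"

text \<open>
  The direct sum of \<open>R k\<close> over \<open>k \<in> I\<close>, for a finite index set \<open>I\<close>: an element \<open>f\<close> has the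
  component \<open>\<lambda>a. f (k, a)\<close> in \<open>R k\<close>.
\<close>

definition direct_sum_rep :: "'k set \<Rightarrow> ('k \<Rightarrow> 'a rep) \<Rightarrow> ('k \<times> 'a) rep" where
  "direct_sum_rep I R =
     \<lparr>rep_space = {f. (\<forall>k\<in>I. (\<lambda>a. f (k, a)) \<in> rep_space (R k)) \<and> (\<forall>k a. k \<notin> I \<longrightarrow> f (k, a) = 0)},
      rep_act = (\<lambda>g f (k, a). if k \<in> I then rep_act (R k) g (\<lambda>a'. f (k, a')) a else 0)\<rparr>"


section \<open>Exterior and symmetric powers\<close>

text \<open>A \<open>k\<close>-linear form on \<open>V\<close> takes its arguments as a list of length \<open>k\<close>; its values on
  other lists are irrelevant.\<close>

definition vectors :: "'v set \<Rightarrow> nat \<Rightarrow> 'v list set" where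
  "vectors V k = {vs. length vs = k \<and> set vs \<subseteq> V}"

definition multilinear_form ::
  "('a \<Rightarrow> complex) set \<Rightarrow> nat \<Rightarrow> (('a \<Rightarrow> complex) list \<Rightarrow> complex) \<Rightarrow> bool" where
  "multilinear_form V k \<omega> \<longleftrightarrow>
     (\<forall>vs\<in>vectors V k. \<forall>i<k.
        (\<forall>u\<in>V. \<forall>v\<in>V. \<omega> (vs[i := u + v]) = \<omega> (vs[i := u]) + \<omega> (vs[i := v])) \<and>
        (\<forall>c. \<forall>u\<in>V. \<omega> (vs[i := fscale c u]) = c * \<omega> (vs[i := u])))"

definition alternating_forms ::
  "('a \<Rightarrow> complex) set \<Rightarrow> nat \<Rightarrow> (('a \<Rightarrow> complex) list \<Rightarrow> complex) set" where
  "alternating_forms V k =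
     {\<omega>. multilinear_form V k \<omega> \<and> (\<forall>vs\<in>vectors V k. \<not> distinct vs \<longrightarrow> \<omega> vs = 0)}"

definition symmetric_forms ::
  "('a \<Rightarrow> complex) set \<Rightarrow> nat \<Rightarrow> (('a \<Rightarrow> complex) list \<Rightarrow> complex) set" where
  "symmetric_forms V k =
     {\<omega>. multilinear_form V k \<omega> \<and>
       (\<forall>vs\<in>vectors V k. \<forall>ws\<in>vectors V k. mset vs = mset ws \<longrightarrow> \<omega> vs = \<omega> ws)}"

text \<open>
  For \<open>\<Omega>\<close> the alternating (symmetric) \<open>k\<close>-linear forms on \<open>V\<close>, the product
  \<open>v\<^sub>1 \<and> \<dots> \<and> v\<^sub>k\<close> (resp. \<open>v\<^sub>1 \<cdots> v\<^sub>k\<close>) is realised as the evaluation functional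
  \<open>\<omega> \<mapsto> \<omega>(v\<^sub>1, \<dots>, v\<^sub>k)\<close> on \<open>\<Omega>\<close>, and the exterior (symmetric) power is the span of these products.
  It is the universal one: the products generate it, they are alternating (symmetric) and
  multilinear in \<open>v\<^sub>1, \<dots>, v\<^sub>k\<close>, and every \<open>\<omega> \<in> \<Omega>\<close> factors through them via the linear functional
  \<open>f \<mapsto> f \<omega>\<close>. Precomposition with \<open>g\<close> on the forms sends the product of the \<open>v\<^sub>i\<close> to the product of
  the \<open>g v\<^sub>i\<close>.
\<close>

definition form_product :: "('v list \<Rightarrow> complex) set \<Rightarrow> 'v list \<Rightarrow> ('v list \<Rightarrow> complex) \<Rightarrow> complex" where
  "form_product \<Omega> vs = (\<lambda>\<omega>. if \<omega> \<in> \<Omega> then \<omega> vs else 0)"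

definition power_rep ::
  "(('a \<Rightarrow> complex) list \<Rightarrow> complex) set \<Rightarrow> nat \<Rightarrow> 'a rep \<Rightarrow> (('a \<Rightarrow> complex) list \<Rightarrow> complex) rep" where
  "power_rep \<Omega> k R =
     \<lparr>rep_space = fs.span (form_product \<Omega> ` vectors (rep_space R) k),
      rep_act = (\<lambda>g f \<omega>. if \<omega> \<in> \<Omega> then f (\<lambda>vs. \<omega> (map (rep_act R g) vs)) else 0)\<rparr>"

definition exterior_power :: "nat \<Rightarrow> 'a rep \<Rightarrow> (('a \<Rightarrow> complex) list \<Rightarrow> complex) rep" where
  "exterior_power k R = power_rep (alternating_forms (rep_space R) k) k R"

definition symmetric_power :: "nat \<Rightarrow> 'a rep \<Rightarrow> (('a \<Rightarrow> complex) list \<Rightarrow> complex) rep" where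
  "symmetric_power k R = power_rep (symmetric_forms (rep_space R) k) k R"


section \<open>Partitions and Schur polynomials\<close>

text \<open>A partition is the weakly decreasing list of its nonzero parts.\<close>

definition is_partition :: "nat list \<Rightarrow> bool" where
  "is_partition \<nu> \<longleftrightarrow> sorted_wrt (\<ge>) \<nu> \<and> 0 \<notin> set \<nu>"

definition part :: "nat list \<Rightarrow> nat \<Rightarrow> nat" where
  "part \<nu> i = (if 1 \<le> i \<and> i \<le> length \<nu> then \<nu> ! (i - 1) else 0)"

text \<open>The nonzero parts of the conjugate are those with index \<open>1, \<dots>, \<nu>\<^sub>1\<close>.\<close>

definition conjugate_partition :: "nat list \<Rightarrow> nat list" where
  "conjugate_partition \<nu> = map (\<lambda>i. card {j. 1 \<le> j \<and> j \<le> length \<nu> \<and> i \<le> part \<nu> j}) [1..<Suc (part \<nu> 1)]"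

text \<open>The index \<open>r = 0\<close> always qualifies, which gives rank \<open>0\<close> to the empty partition.\<close>

definition durfee_rank :: "nat list \<Rightarrow> nat" where
  "durfee_rank \<nu> = Max {r. r \<le> length \<nu> \<and> r \<le> part \<nu> r}"

definition frobenius_alpha :: "nat list \<Rightarrow> nat \<Rightarrow> int" where
  "frobenius_alpha \<nu> i = int (part \<nu> i) - int i"

definition frobenius_beta :: "nat list \<Rightarrow> nat \<Rightarrow> int" where
  "frobenius_beta \<nu> i = int (part (conjugate_partition \<nu>) i) - int i"

definition is_threshold :: "nat list \<Rightarrow> bool" where
  "is_threshold \<nu> \<longleftrightarrow> (\<forall>i\<in>{1..durfee_rank \<nu>}. frobenius_beta \<nu> i = frobenius_alpha \<nu> i + 1)"

definition TP :: "nat \<Rightarrow> nat list set" where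
  "TP N = {\<nu>. is_partition \<nu> \<and> sum_list \<nu> = N \<and> is_threshold \<nu>}"

definition young_diagram :: "nat list \<Rightarrow> (nat \<times> nat) set" where
  "young_diagram \<nu> = {(i, j). 1 \<le> i \<and> i \<le> length \<nu> \<and> 1 \<le> j \<and> j \<le> part \<nu> i}"

definition SSYT :: "nat \<Rightarrow> nat list \<Rightarrow> (nat \<times> nat \<Rightarrow> nat) set" where
  "SSYT n \<nu> = {T \<in> young_diagram \<nu> \<rightarrow>\<^sub>E {1..n}.
     (\<forall>i j j'. (i, j) \<in> young_diagram \<nu> \<and> (i, j') \<in> young_diagram \<nu> \<and> j < j' \<longrightarrow>
        T (i, j) \<le> T (i, j')) \<and>
     (\<forall>i i' j. (i, j) \<in> young_diagram \<nu> \<and> (i', j) \<in> young_diagram \<nu> \<and> i < i' \<longrightarrow>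
        T (i, j) < T (i', j))}"

definition schur_poly :: "nat \<Rightarrow> nat list \<Rightarrow> (nat \<Rightarrow> complex) \<Rightarrow> complex" where
  "schur_poly n \<nu> x =
     (\<Sum>T\<in>SSYT n \<nu>. \<Prod>i=1..n. x i ^ card {c \<in> young_diagram \<nu>. T c = i})"

text \<open>
  \<open>is_schur_rep n \<nu> R\<close> says that \<open>R\<close> is a model of the representation \<open>W\<^sup>n\<^sub>\<nu>\<close>, which is only
  determined up to isomorphism. Characters are compared on invertible diagonal matrices.
\<close>

definition is_schur_rep :: "nat \<Rightarrow> nat list \<Rightarrow> 'a rep \<Rightarrow> bool" where
  "is_schur_rep n \<nu> R \<longleftrightarrow>
     (if length \<nu> \<le> n then
        is_polynomial_rep n R \<and> is_irreducible n R \<and>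
        (\<forall>x. (\<forall>i\<in>{1..n}. x i \<noteq> 0) \<longrightarrow> character n R x = schur_poly n \<nu> x)
      else rep_space R = {0} \<and> is_rep n R)"

end

theory Submission
  imports Defs "Jordan_Normal_Form.Schur_Decomposition"
begin

text \<open>
  Both sides are compared through their characters. The exterior power carries a positive definite
  Hermitian form for which \<open>g\<close> and its conjugate transpose are adjoint, so it is completely reducible.
  For completely reducible representations, equality of traces gives an isomorphism: if the
  irreducible representation \<open>W\<close> did not embed into \<open>V\<close>, then, annihilators of irreducible
  representations being prime ideals of the group algebra, some element would kill \<open>V\<close> and all other
  summands but act on \<open>W\<close> with eigenvalue \<open>1\<close>, and one of its powers would have nonzero trace on \<open>W\<close>
  alone. Traces of polynomial representations are determined on the torus by triangularising \<open>g\<close> and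
  contracting its triangular form to the diagonal.

  The character identity is multiplied by the Vandermonde determinant. With \<open>y\<^sub>i = t x\<^sub>i - 1 / x\<^sub>i\<close> one has
  \<open>(x\<^sub>i - x\<^sub>j) (1 + t x\<^sub>i x\<^sub>j) = x\<^sub>i x\<^sub>j (y\<^sub>i - y\<^sub>j)\<close>, so the left hand side becomes a Vandermonde
  determinant in the \<open>y\<^sub>i\<close>. Its rows may be replaced by binomials in \<open>x\<close>; expanding them adds or omits
  one principal hook per row, which produces exactly the threshold partitions (or their conjugates).
\<close>

section \<open>Bases, dual bases and traces\<close>

text \<open>Each \<open>W \<nu>\<close> is given only as an irreducible representation with a
  prescribed character, so the isomorphism has to be extracted from traces alone. This stays
  manageable because the decomposition is multiplicity free: the nonzero summands have pairwise
  distinct characters, one embedding per summand is enough, and the trace at the identity gives the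
  count of dimensions that makes the sum of the embeddings bijective. On the side of symmetric
  functions, \<open>t\<close> marks the exterior degree. A parameter \<open>s\<close> treats both
  squares together: 0 for the exterior, 2 for the symmetric one. It is the shift in \<beta>_i + s =
  \<alpha>_i + 1, and a hook with leg \<open>m\<close> has arm \<open>m + s - 1\<close>. The
  binomials come from writing y = a + b with a = t x and b = - 1 / x: a Vandermonde determinant in y
  may be computed with any monic polynomials of the right degrees, and a^m + b^m, or the quotient
  (a^(m+1) - b^(m+1)) / (a - b), becomes a binomial after clearing denominators and, in the second
  case, absorbing 1 + t x^2.\<close>

lemma sum_fun_apply: "(\<Sum>i\<in>I. f i) x = (\<Sum>i\<in>I. f i x)"
  by (induction I rule: infinite_finite_induct) auto

text \<open>The index set is arbitrary because basis vectors will be labelled by numbers, pairs,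
  sets and dependent pairs alike. The coordinates have to be linear on \<open>V\<close> only:
  functions such as \<open>fs.representation\<close> are not linear on the whole function
  type.\<close>

definition dual_basis ::
  "('a \<Rightarrow> complex) set \<Rightarrow> 'i set \<Rightarrow> ('i \<Rightarrow> 'a \<Rightarrow> complex) \<Rightarrow> ('i \<Rightarrow> ('a \<Rightarrow> complex) \<Rightarrow> complex) \<Rightarrow> bool" where
  "dual_basis V I e \<kappa> \<longleftrightarrow> finite I \<and> fs.subspace V \<and> (\<forall>i\<in>I. e i \<in> V) \<and>
     (\<forall>i\<in>I. \<forall>u\<in>V. \<forall>v\<in>V. \<kappa> i (u + v) = \<kappa> i u + \<kappa> i v) \<and>
     (\<forall>i\<in>I. \<forall>c. \<forall>v\<in>V. \<kappa> i (fscale c v) = c * \<kappa> i v) \<and>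
     (\<forall>i\<in>I. \<forall>j\<in>I. \<kappa> i (e j) = (if i = j then 1 else 0)) \<and>
     (\<forall>v\<in>V. (\<Sum>i\<in>I. fscale (\<kappa> i v) (e i)) = v)"

lemma dual_basisD:
  assumes "dual_basis V I e \<kappa>"
  shows "finite I" "fs.subspace V" "\<And>i. i \<in> I \<Longrightarrow> e i \<in> V"
    "\<And>i u v. i \<in> I \<Longrightarrow> u \<in> V \<Longrightarrow> v \<in> V \<Longrightarrow> \<kappa> i (u + v) = \<kappa> i u + \<kappa> i v"
    "\<And>i c v. i \<in> I \<Longrightarrow> v \<in> V \<Longrightarrow> \<kappa> i (fscale c v) = c * \<kappa> i v"
    "\<And>i j. i \<in> I \<Longrightarrow> j \<in> I \<Longrightarrow> \<kappa> i (e j) = (if i = j then 1 else 0)"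
    "\<And>v. v \<in> V \<Longrightarrow> (\<Sum>i\<in>I. fscale (\<kappa> i v) (e i)) = v"
  using assms unfolding dual_basis_def by auto

lemma linear_map_onD:
  assumes "linear_map_on V V' f"
  shows "\<And>v. v \<in> V \<Longrightarrow> f v \<in> V'" "\<And>u v. u \<in> V \<Longrightarrow> v \<in> V \<Longrightarrow> f (u + v) = f u + f v"
    "\<And>c v. v \<in> V \<Longrightarrow> f (fscale c v) = fscale c (f v)"
  using assms unfolding linear_map_on_def by auto

lemma linear_map_on_0:
  assumes "linear_map_on V V' f" "fs.subspace V"
  shows "f 0 = 0"
  using linear_map_onD(3)[OF assms(1) fs.subspace_0[OF assms(2)], of 0] by simp

lemma linear_map_on_sum:
  assumes f: "linear_map_on V V' f" and V: "fs.subspace V"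
  shows "(\<And>i. i \<in> I \<Longrightarrow> v i \<in> V) \<Longrightarrow> f (\<Sum>i\<in>I. v i) = (\<Sum>i\<in>I. f (v i))"
proof (induction I rule: infinite_finite_induct)
  case (insert i I)
  have "f (v i + (\<Sum>i\<in>I. v i)) = f (v i) + f (\<Sum>i\<in>I. v i)"
    by (rule linear_map_onD(2)[OF f]) (use insert.prems in \<open>auto intro: fs.subspace_sum[OF V]\<close>)
  also have "f (\<Sum>i\<in>I. v i) = (\<Sum>i\<in>I. f (v i))" by (rule insert.IH) (use insert.prems in auto)
  finally show ?case unfolding sum.insert[OF insert.hyps] .
qed (auto simp: linear_map_on_0[OF f V])

lemma linear_map_on_diff:
  assumes f: "linear_map_on V V' f" and V: "fs.subspace V" and u: "u \<in> V" and v: "v \<in> V"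
  shows "f (u - v) = f u - f v"
proof -
  have "f (u + fscale (-1) v) = f u + fscale (-1) (f v)"
    using linear_map_onD(2)[OF f u fs.subspace_scale[OF V v, of "-1"]] linear_map_onD(3)[OF f v, of "-1"] by simp
  then show ?thesis by (simp add: fs.scale_minus_left)
qed

lemma linear_map_image_subspace:
  assumes f: "linear_map_on V W f" and V: "fs.subspace V"
  shows "fs.subspace (f ` V)"
proof (rule fs.subspaceI)
  show "0 \<in> f ` V" using linear_map_on_0[OF f V] fs.subspace_0[OF V] by (metis image_eqI)
next
  fix x y assume "x \<in> f ` V" "y \<in> f ` V"
  then obtain u v where "u \<in> V" "v \<in> V" "x = f u" "y = f v" by auto
  then show "x + y \<in> f ` V" using linear_map_onD(2)[OF f] fs.subspace_add[OF V] by (metis image_eqI)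
next
  fix d x assume "x \<in> f ` V"
  then obtain u where "u \<in> V" "x = f u" by auto
  then show "fscale d x \<in> f ` V" using linear_map_onD(3)[OF f] fs.subspace_scale[OF V] by (metis image_eqI)
qed

lemma linear_bijection_inverse:
  assumes V: "fs.subspace V" and lin: "linear_map_on V W \<phi>" and bij: "bij_betw \<phi> V W"
  obtains \<psi> where "linear_map_on W V \<psi>" "bij_betw \<psi> W V"
    "\<And>w. w \<in> W \<Longrightarrow> \<phi> (\<psi> w) = w" "\<And>v. v \<in> V \<Longrightarrow> \<psi> (\<phi> v) = v"
proof -
  define \<psi> where "\<psi> = the_inv_into V \<phi>"
  have inj: "inj_on \<phi> V" and im: "\<phi> ` V = W" using bij by (auto simp: bij_betw_def)
  have \<psi>R: "\<psi> s \<in> V" if "s \<in> W" for s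
    using the_inv_into_into[OF inj, of s V] that im by (simp add: \<psi>_def)
  have \<phi>\<psi>: "\<phi> (\<psi> s) = s" if "s \<in> W" for s
    using f_the_inv_into_f[OF inj, of s] that im by (simp add: \<psi>_def)
  have \<psi>\<phi>: "\<psi> (\<phi> x) = x" if "x \<in> V" for x
    using the_inv_into_f_f[OF inj that] by (simp add: \<psi>_def)
  have "linear_map_on W V \<psi>"
    unfolding linear_map_on_def
  proof (intro conjI ballI allI)
    fix s t c assume s: "s \<in> W"
    show "\<psi> s \<in> V" by (rule \<psi>R[OF s])
    have "\<phi> (fscale c (\<psi> s)) = fscale c s"
      using linear_map_onD(3)[OF lin \<psi>R[OF s]] \<phi>\<psi>[OF s] by simp
    then show "\<psi> (fscale c s) = fscale c (\<psi> s)"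
      using \<psi>\<phi>[OF fs.subspace_scale[OF V \<psi>R[OF s]]] by metis
    assume t: "t \<in> W"
    have "\<phi> (\<psi> s + \<psi> t) = s + t"
      using linear_map_onD(2)[OF lin \<psi>R[OF s] \<psi>R[OF t]] \<phi>\<psi>[OF s] \<phi>\<psi>[OF t] by simp
    then show "\<psi> (s + t) = \<psi> s + \<psi> t"
      using \<psi>\<phi>[OF fs.subspace_add[OF V \<psi>R[OF s] \<psi>R[OF t]]] by metis
  qed
  moreover have "bij_betw \<psi> W V"
    unfolding \<psi>_def by (rule bij_betw_the_inv_into[OF bij])
  ultimately show ?thesis using \<phi>\<psi> \<psi>\<phi> by (rule that)
qed

lemma linear_map_on_compose:
  assumes "linear_map_on U V f" "linear_map_on V W g"
  shows "linear_map_on U W (\<lambda>v. g (f v))"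
  using assms unfolding linear_map_on_def by auto

lemma linear_map_on_power:
  assumes "linear_map_on V V f"
  shows "linear_map_on V V (f ^^ k)"
  using assms by (induction k) (auto simp: linear_map_on_def)

lemma dual_basis_functional_0:
  assumes "dual_basis V I e \<kappa>" "i \<in> I"
  shows "\<kappa> i 0 = 0"
  using dual_basisD(5)[OF assms(1,2) fs.subspace_0[OF dual_basisD(2)[OF assms(1)]], of 0] by simp

lemma dual_basis_functional_sum:
  assumes b: "dual_basis V I e \<kappa>" and i: "i \<in> I"
  shows "(\<And>j. j \<in> J \<Longrightarrow> v j \<in> V) \<Longrightarrow> \<kappa> i (\<Sum>j\<in>J. v j) = (\<Sum>j\<in>J. \<kappa> i (v j))"
proof (induction J rule: infinite_finite_induct)
  case (insert j J)
  have "\<kappa> i (v j + (\<Sum>j\<in>J. v j)) = \<kappa> i (v j) + \<kappa> i (\<Sum>j\<in>J. v j)"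
    by (rule dual_basisD(4)[OF b i]) (use insert.prems in \<open>auto intro: fs.subspace_sum[OF dual_basisD(2)[OF b]]\<close>)
  also have "\<kappa> i (\<Sum>j\<in>J. v j) = (\<Sum>j\<in>J. \<kappa> i (v j))" by (rule insert.IH) (use insert.prems in auto)
  finally show ?case unfolding sum.insert[OF insert.hyps] .
qed (auto simp: dual_basis_functional_0[OF b i])

lemma dual_basis_functional_lincomb:
  assumes b: "dual_basis V I e \<kappa>" and i: "i \<in> I" and v: "\<And>j. j \<in> J \<Longrightarrow> v j \<in> V"
  shows "\<kappa> i (\<Sum>j\<in>J. fscale (c j) (v j)) = (\<Sum>j\<in>J. c j * \<kappa> i (v j))"
  using v dual_basis_functional_sum[OF b i, of J "\<lambda>j. fscale (c j) (v j)"]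
  by (simp add: fs.subspace_scale[OF dual_basisD(2)[OF b]] dual_basisD(5)[OF b i])

lemma dual_basis_eqI:
  assumes b: "dual_basis V I e \<kappa>" and "u \<in> V" "v \<in> V" "\<And>i. i \<in> I \<Longrightarrow> \<kappa> i u = \<kappa> i v"
  shows "u = v"
proof -
  have "u = (\<Sum>i\<in>I. fscale (\<kappa> i u) (e i))" by (rule dual_basisD(7)[OF b assms(2), symmetric])
  also have "\<dots> = (\<Sum>i\<in>I. fscale (\<kappa> i v) (e i))" using assms(4) by (intro sum.cong) auto
  also have "\<dots> = v" by (rule dual_basisD(7)[OF b assms(3)])
  finally show ?thesis .
qed

lemma dual_basis_inj:
  assumes "dual_basis V I e \<kappa>"
  shows "inj_on e I"
proof (rule inj_onI)
  fix i j assume "i \<in> I" "j \<in> I" "e i = e j"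
  then show "i = j"
    using dual_basisD(6)[OF assms, of i i] dual_basisD(6)[OF assms, of i j] by (auto split: if_splits)
qed

lemma dual_basis_is_basis:
  assumes b: "dual_basis V I e \<kappa>"
  shows "is_basis V (e ` I)"
proof -
  note V = dual_basisD(2)[OF b]
  have inj: "inj_on e I" by (rule dual_basis_inj[OF b])
  have "fs.independent (e ` I)"
  proof (rule fs.independent_if_scalars_zero)
    show "finite (e ` I)" using dual_basisD(1)[OF b] by simp
    fix f x assume *: "(\<Sum>x\<in>e ` I. fscale (f x) x) = 0" and "x \<in> e ` I"
    then obtain i where i: "i \<in> I" "x = e i" by auto
    have "0 = \<kappa> i (\<Sum>j\<in>I. fscale (f (e j)) (e j))"
      using * dual_basis_functional_0[OF b i(1)] by (simp add: sum.reindex[OF inj])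
    also have "\<dots> = (\<Sum>j\<in>I. f (e j) * \<kappa> i (e j))"
      by (rule dual_basis_functional_lincomb[OF b i(1) dual_basisD(3)[OF b]])
    also have "\<dots> = (\<Sum>j\<in>I. if i = j then f (e j) else 0)"
      using dual_basisD(6)[OF b i(1)] by (intro sum.cong) auto
    also have "\<dots> = f x" using i dual_basisD(1)[OF b] by simp
    finally show "f x = 0" by simp
  qed
  moreover have "fs.span (e ` I) = V"
  proof
    show "fs.span (e ` I) \<subseteq> V"
      using dual_basisD(3)[OF b] V by (intro fs.span_minimal) auto
    show "V \<subseteq> fs.span (e ` I)"
    proof
      fix v assume "v \<in> V"
      then have "v = (\<Sum>i\<in>I. fscale (\<kappa> i v) (e i))" using dual_basisD(7)[OF b] by simp
      also have "\<dots> \<in> fs.span (e ` I)"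
        by (intro fs.span_sum fs.span_scale fs.span_base) auto
      finally show "v \<in> fs.span (e ` I)" .
    qed
  qed
  ultimately show ?thesis by (simp add: is_basis_def)
qed

lemma dual_basis_of_basis:
  assumes "is_basis V B" "finite B"
  shows "dual_basis V B (\<lambda>b. b) (\<lambda>b v. fs.representation B v b)"
proof -
  have ind: "fs.independent B" and sp: "fs.span B = V" using assms by (auto simp: is_basis_def)
  have "(\<Sum>i\<in>B. fscale (fs.representation B v i) i) = v" if "v \<in> V" for v
    using fs.sum_representation_eq[OF ind _ assms(2) subset_refl, of v] that sp by simp
  then show ?thesis
    unfolding dual_basis_def using ind sp assms fs.subspace_span[of B] fs.span_base[of _ B]
    by (auto simp: fs.representation_add fs.representation_scale fs.representation_basis)
qed

lemma dual_basis_reindex: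
  assumes b: "dual_basis V I e \<kappa>" and h: "bij_betw h J I"
  shows "dual_basis V J (e \<circ> h) (\<kappa> \<circ> h)"
proof -
  have 1: "h j \<in> I" if "j \<in> J" for j using h that by (auto simp: bij_betw_def)
  have 2: "h i = h j \<longleftrightarrow> i = j" if "i \<in> J" "j \<in> J" for i j
    using h that by (auto simp: bij_betw_def inj_on_def)
  have 3: "(\<Sum>j\<in>J. fscale (\<kappa> (h j) v) (e (h j))) = v" if "v \<in> V" for v
    using dual_basisD(7)[OF b that] sum.reindex_bij_betw[OF h, of "\<lambda>i. fscale (\<kappa> i v) (e i)"] by simp
  have 4: "finite J" using bij_betw_finite[OF h] dual_basisD(1)[OF b] by simp
  show ?thesis unfolding dual_basis_def using 1 2 3 4 dual_basisD[OF b] by auto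
qed

lemma dual_basis_nat:
  fixes V :: "('a \<Rightarrow> complex) set"
  assumes "is_basis V B" "finite B"
  obtains N :: nat and e :: "nat \<Rightarrow> 'a \<Rightarrow> complex" and \<kappa> :: "nat \<Rightarrow> ('a \<Rightarrow> complex) \<Rightarrow> complex"
  where "dual_basis V {..<N} e \<kappa>"
proof -
  obtain h where "bij_betw h {..<card B} B"
    using ex_bij_betw_nat_finite[OF assms(2)] by (auto simp: atLeast0LessThan)
  from dual_basis_reindex[OF dual_basis_of_basis[OF assms] this] that show ?thesis by blast
qed

lemma functional_of_image:
  assumes b: "dual_basis V I e \<kappa>" and c: "dual_basis W J e' \<kappa>'"
    and f: "linear_map_on V W f" and v: "v \<in> V" and j: "j \<in> J"
  shows "\<kappa>' j (f v) = (\<Sum>i\<in>I. \<kappa> i v * \<kappa>' j (f (e i)))"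
proof -
  have "f v = f (\<Sum>i\<in>I. fscale (\<kappa> i v) (e i))" using dual_basisD(7)[OF b v] by simp
  also have "\<dots> = (\<Sum>i\<in>I. f (fscale (\<kappa> i v) (e i)))"
    using dual_basisD(2,3)[OF b] by (intro linear_map_on_sum[OF f]) (auto intro: fs.subspace_scale)
  also have "\<dots> = (\<Sum>i\<in>I. fscale (\<kappa> i v) (f (e i)))"
    using dual_basisD(3)[OF b] linear_map_onD(3)[OF f] by (intro sum.cong) auto
  finally have "\<kappa>' j (f v) = \<kappa>' j (\<Sum>i\<in>I. fscale (\<kappa> i v) (f (e i)))" by (rule arg_cong)
  also have "\<dots> = (\<Sum>i\<in>I. \<kappa> i v * \<kappa>' j (f (e i)))"
    using linear_map_onD(1)[OF f] dual_basisD(3)[OF b] by (intro dual_basis_functional_lincomb[OF c j]) auto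
  finally show ?thesis .
qed

text \<open>Both sides are the same double sum of products of matrix entries. Allowing two different
  spaces lets one computation serve for independence of the basis, for conjugation, and for
  invariance under isomorphism.\<close>

lemma trace_dual_basis_comm:
  assumes b: "dual_basis V I e \<kappa>" and c: "dual_basis W J e' \<kappa>'"
    and f: "linear_map_on V W f" and g: "linear_map_on W V g"
  shows "(\<Sum>i\<in>I. \<kappa> i (g (f (e i)))) = (\<Sum>j\<in>J. \<kappa>' j (f (g (e' j))))"
proof -
  have "f (e i) \<in> W" if "i \<in> I" for i using linear_map_onD(1)[OF f] dual_basisD(3)[OF b that] .
  then have "(\<Sum>i\<in>I. \<kappa> i (g (f (e i)))) = (\<Sum>i\<in>I. \<Sum>j\<in>J. \<kappa>' j (f (e i)) * \<kappa> i (g (e' j)))"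
    using functional_of_image[OF c b g] by simp
  also have "\<dots> = (\<Sum>j\<in>J. \<Sum>i\<in>I. \<kappa> i (g (e' j)) * \<kappa>' j (f (e i)))"
    by (subst sum.swap) (simp add: mult.commute)
  also have "\<dots> = (\<Sum>j\<in>J. \<kappa>' j (f (g (e' j))))"
  proof -
    have "g (e' j) \<in> V" if "j \<in> J" for j using linear_map_onD(1)[OF g] dual_basisD(3)[OF c that] .
    then show ?thesis using functional_of_image[OF b c f] by simp
  qed
  finally show ?thesis .
qed

lemma linear_map_on_id: "linear_map_on V V (\<lambda>v. v)"
  by (simp add: linear_map_on_def)

lemma trace_dual_basis_eq:
  assumes b: "dual_basis V I e \<kappa>" and c: "dual_basis V J e' \<kappa>'" and f: "linear_map_on V V f"
  shows "(\<Sum>i\<in>I. \<kappa> i (f (e i))) = (\<Sum>j\<in>J. \<kappa>' j (f (e' j)))"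
  using trace_dual_basis_comm[OF b c f linear_map_on_id] by simp

lemma trace_on_dual_basis:
  assumes b: "dual_basis V I e \<kappa>" and f: "linear_map_on V V f"
  shows "trace_on V f = (\<Sum>i\<in>I. \<kappa> i (f (e i)))"
proof -
  define B where "B = (SOME B. is_basis V B)"
  have B: "is_basis V B" unfolding B_def
    by (rule someI, rule dual_basis_is_basis[OF b])
  have "finite B"
    using fs.independent_span_bound[of "e ` I" B] B dual_basis_is_basis[OF b] dual_basisD(1)[OF b]
      fs.span_superset[of B]
    by (auto simp: is_basis_def)
  from trace_dual_basis_eq[OF dual_basis_of_basis[OF B this] b f] show ?thesis
    by (simp add: trace_on_def matrix_entry_def flip: B_def)
qed

lemma trace_on_comm:
  assumes b: "dual_basis V I e \<kappa>" and f: "linear_map_on V V f" and g: "linear_map_on V V g"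
  shows "trace_on V (\<lambda>v. f (g v)) = trace_on V (\<lambda>v. g (f v))"
  using trace_dual_basis_comm[OF b b f g] trace_on_dual_basis[OF b] linear_map_on_compose[OF f g]
    linear_map_on_compose[OF g f] by simp

lemma trace_on_cong:
  assumes b: "dual_basis V I e \<kappa>" and f: "linear_map_on V V f" and g: "\<And>v. v \<in> V \<Longrightarrow> f v = g v"
  shows "trace_on V f = trace_on V g"
proof -
  note V = dual_basisD(2)[OF b]
  have "linear_map_on V V g"
    unfolding linear_map_on_def
  proof (intro conjI ballI allI)
    fix u v c assume u: "u \<in> V"
    show "g u \<in> V" using linear_map_onD(1)[OF f u] by (simp only: g[OF u])
    show "g (fscale c u) = fscale c (g u)"
      using linear_map_onD(3)[OF f u] by (simp only: g[OF u] g[OF fs.subspace_scale[OF V u]])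
    assume v: "v \<in> V"
    show "g (u + v) = g u + g v"
      using linear_map_onD(2)[OF f u v] by (simp only: g[OF u] g[OF v] g[OF fs.subspace_add[OF V u v]])
  qed
  then show ?thesis
    by (simp add: trace_on_dual_basis[OF b] f g dual_basisD(3)[OF b])
qed

lemma dual_basis_dim:
  assumes b: "dual_basis V I e \<kappa>"
  shows "fs.dim V = card I"
  using dual_basis_is_basis[OF b] card_image[OF dual_basis_inj[OF b]]
  by (metis fs.dim_span_eq_card_independent is_basis_def)

lemma trace_on_id:
  assumes b: "dual_basis V I e \<kappa>"
  shows "trace_on V (\<lambda>v. v) = of_nat (fs.dim V)"
  using trace_on_dual_basis[OF b linear_map_on_id] dual_basisD(6)[OF b] dual_basis_dim[OF b] by simp

section \<open>Traces of powers of a linear map\<close>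

definition mat_of ::
  "nat \<Rightarrow> (nat \<Rightarrow> 'a \<Rightarrow> complex) \<Rightarrow> (nat \<Rightarrow> ('a \<Rightarrow> complex) \<Rightarrow> complex) \<Rightarrow> (('a \<Rightarrow> complex) \<Rightarrow> 'a \<Rightarrow> complex) \<Rightarrow> complex mat" where
  "mat_of N e \<kappa> f = mat N N (\<lambda>(i, j). \<kappa> i (f (e j)))"

lemma mat_of_compose:
  assumes b: "dual_basis V {..<N} e \<kappa>" and f: "linear_map_on V V f" and g: "linear_map_on V V g"
  shows "mat_of N e \<kappa> (\<lambda>v. f (g v)) = mat_of N e \<kappa> f * mat_of N e \<kappa> g"
proof (rule eq_matI; simp add: mat_of_def scalar_prod_def)
  fix i j assume i: "i < N" and j: "j < N"
  have ge: "g (e j) \<in> V" using linear_map_onD(1)[OF g] dual_basisD(3)[OF b] j by auto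
  have "\<kappa> i (f (g (e j))) = (\<Sum>k<N. \<kappa> k (g (e j)) * \<kappa> i (f (e k)))"
    using functional_of_image[OF b b f ge] i by simp
  then show "\<kappa> i (f (g (e j))) = (\<Sum>k = 0..<N. \<kappa> i (f (e k)) * \<kappa> k (g (e j)))"
    by (simp add: atLeast0LessThan mult.commute)
qed

lemma mat_of_power:
  assumes b: "dual_basis V {..<N} e \<kappa>" and f: "linear_map_on V V f"
  shows "mat_of N e \<kappa> (f ^^ k) = mat_of N e \<kappa> f ^\<^sub>m k"
proof (induction k)
  case 0
  show ?case using dual_basisD(6)[OF b] by (intro eq_matI) (auto simp: mat_of_def)
next
  case (Suc k)
  have "mat_of N e \<kappa> (f ^^ Suc k) = mat_of N e \<kappa> (\<lambda>v. (f ^^ k) (f v))"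
    by (simp add: funpow_Suc_right comp_def del: funpow.simps)
  then show ?case using mat_of_compose[OF b linear_map_on_power[OF f] f, of k] Suc by (simp del: funpow.simps)
qed

definition mat_trace :: "complex mat \<Rightarrow> complex" where
  "mat_trace A = (\<Sum>i<dim_row A. A $$ (i, i))"

lemma mat_trace_comm:
  assumes "A \<in> carrier_mat m k" "B \<in> carrier_mat k m"
  shows "mat_trace (A * B) = mat_trace (B * A)"
proof -
  have "mat_trace (A * B) = (\<Sum>i<m. \<Sum>j<k. A $$ (i, j) * B $$ (j, i))"
    using assms by (auto simp: mat_trace_def scalar_prod_def atLeast0LessThan)
  also have "\<dots> = (\<Sum>j<k. \<Sum>i<m. B $$ (j, i) * A $$ (i, j))"
    by (subst sum.swap) (simp add: mult.commute)
  also have "\<dots> = mat_trace (B * A)"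
    using assms by (auto simp: mat_trace_def scalar_prod_def atLeast0LessThan)
  finally show ?thesis .
qed

lemma upper_triangular_pow_entries:
  assumes B: "(B :: complex mat) \<in> carrier_mat n n" and u: "upper_triangular B"
  shows "\<lbrakk>i < n; j \<le> i\<rbrakk> \<Longrightarrow> (B ^\<^sub>m k) $$ (i, j) = (if i = j then B $$ (i, i) ^ k else 0)"
proof (induction k arbitrary: i j)
  case 0
  then show ?case using B by auto
next
  case (Suc k)
  have Bk: "B ^\<^sub>m k \<in> carrier_mat n n" using B by simp
  have "(B ^\<^sub>m Suc k) $$ (i, j) = (\<Sum>l<n. (B ^\<^sub>m k) $$ (i, l) * B $$ (l, j))"
    using Suc.prems B Bk by (auto simp: scalar_prod_def atLeast0LessThan)
  also have "\<dots> = (\<Sum>l<n. if l = i then B $$ (i, i) ^ k * B $$ (i, j) else 0)"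
  proof (rule sum.cong[OF refl])
    fix l assume l: "l \<in> {..<n}"
    show "(B ^\<^sub>m k) $$ (i, l) * B $$ (l, j) = (if l = i then B $$ (i, i) ^ k * B $$ (i, j) else 0)"
    proof (cases "l \<le> i")
      case True
      then show ?thesis using Suc.IH[of i l] Suc.prems by auto
    next
      case False
      then have "B $$ (l, j) = 0" using upper_triangularD[OF u, of j l] Suc.prems l B by auto
      then show ?thesis using False by auto
    qed
  qed
  also have "\<dots> = B $$ (i, i) ^ k * B $$ (i, j)" using Suc.prems by simp
  also have "\<dots> = (if i = j then B $$ (i, i) ^ Suc k else 0)"
    using Suc.prems upper_triangularD[OF u, of j i] B by auto
  finally show ?case .
qed

text \<open>A polynomial without constant term, summed over the values \<open>f i\<close>, is a
  combination of power sums of positive degree and hence gives 0. One that vanishes at all values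
  except \<open>f i0\<close> would give a positive multiple of its value there.\<close>

lemma power_sums_zero_imp:
fixes f :: "nat \<Rightarrow> complex"
  assumes "\<And>k. k \<ge> 1 \<Longrightarrow> (\<Sum>i<n. f i ^ k) = 0" and "i0 < n"
  shows "f i0 = 0"
proof (rule ccontr)
  assume nz: "f i0 \<noteq> 0"
  define S where "S = f ` {..<n} - {f i0}"
  \<comment> \<open>The factor \<open>[:0, 1:]\<close> removes the constant term, because nothing is
    assumed about the power sum of degree 0.\<close>
  define p where "p = [:0, 1:] * (\<Prod>s\<in>S. [:- s, 1:])"
  have "(\<Sum>i<n. poly p (f i)) = (\<Sum>i<n. \<Sum>k\<le>degree p. coeff p k * f i ^ k)"
    by (simp add: poly_altdef)
  also have "\<dots> = (\<Sum>k\<le>degree p. coeff p k * (\<Sum>i<n. f i ^ k))"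
    by (subst sum.swap) (simp add: sum_distrib_left)
  also have "\<dots> = 0"
  proof (rule sum.neutral, safe)
    fix k
    show "coeff p k * (\<Sum>i<n. f i ^ k) = 0"
      using assms(1)[of k] by (cases "k = 0") (auto simp: p_def)
  qed
  finally have 0: "(\<Sum>i<n. poly p (f i)) = 0" .
  have 1: "poly p (f i) = (if f i = f i0 then poly p (f i0) else 0)" if "i < n" for i
  proof (cases "f i = f i0")
    case False
    then have "f i \<in> S" using that by (auto simp: S_def)
    moreover have "finite S" by (simp add: S_def)
    ultimately show ?thesis using False by (auto simp: p_def poly_prod)
  qed auto
  have "(\<Sum>i<n. poly p (f i)) = of_nat (card {i\<in>{..<n}. f i = f i0}) * poly p (f i0)"
    using 1 by (simp add: sum.If_cases Int_def conj_commute)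
  moreover have "{i\<in>{..<n}. f i = f i0} \<noteq> {}" using assms(2) by auto
  moreover have "poly p (f i0) \<noteq> 0"
    using nz by (simp add: p_def poly_prod S_def)
  ultimately show False using 0 by (auto simp: card_eq_0_iff)
qed

text \<open>In a Schur decomposition the traces of the powers are the power sums of the diagonal. If
  all of them vanished, every diagonal entry would be 0, but the eigenvalue 1 is one of
  them.\<close>

lemma mat_trace_power_nonzero:
  assumes A: "(A :: complex mat) \<in> carrier_mat n n" and ev: "eigenvalue A 1"
  shows "\<exists>k\<ge>1. mat_trace (A ^\<^sub>m k) \<noteq> 0"
proof (rule ccontr)
  assume "\<not> ?thesis"
  then have tr: "mat_trace (A ^\<^sub>m k) = 0" if "k \<ge> 1" for k using that by blast
  obtain es where es: "char_poly A = (\<Prod>e\<leftarrow>es. [:- e, 1:])" "length es = n"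
    using char_poly_factorized[OF A] by auto
  obtain B P Q where "schur_decomposition A es = (B, P, Q)" by (cases "schur_decomposition A es") auto
  from schur_decomposition[OF A es(1) this]
  have sim: "similar_mat_wit A B P Q" and u: "upper_triangular B" and d: "diag_mat B = es" by auto
  note s = similar_mat_witD2[OF A sim]
  have "poly (char_poly A) 1 = 0" using ev eigenvalue_root_char_poly[OF A] by simp
  then have "1 \<in> set es" unfolding es(1) by (auto simp: poly_prod_list prod_list_zero_iff)
  then obtain i where i: "i < n" "B $$ (i, i) = 1"
    using d[symmetric] s by (auto simp: diag_mat_def)
  have "(\<Sum>i<n. (B $$ (i, i)) ^ k) = 0" if "k \<ge> 1" for k
  proof -
    have Bk: "B ^\<^sub>m k \<in> carrier_mat n n" using s by simp
    have "0 = mat_trace (P * (B ^\<^sub>m k) * Q)"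
      using tr[OF that] similar_mat_wit_pow_id[OF sim, of k] by simp
    also have "\<dots> = mat_trace (Q * (P * (B ^\<^sub>m k)))"
      using s Bk by (intro mat_trace_comm[of _ n n]) auto
    also have "Q * (P * (B ^\<^sub>m k)) = B ^\<^sub>m k"
      using left_mult_one_mat[OF Bk] by (simp add: s(2) flip: assoc_mult_mat[OF s(7,6) Bk])
    also have "mat_trace (B ^\<^sub>m k) = (\<Sum>i<n. (B $$ (i, i)) ^ k)"
      using Bk s upper_triangular_pow_entries[OF s(5) u] by (auto simp: mat_trace_def)
    finally show ?thesis by simp
  qed
  from power_sums_zero_imp[OF this i(1)] i(2) show False by simp
qed

lemma trace_on_power_nonzero:
  fixes V :: "('a \<Rightarrow> complex) set"
  assumes B: "is_basis V B" "finite B" and f: "linear_map_on V V f"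
    and u: "u \<in> V" "u \<noteq> 0" "f u = u"
  shows "\<exists>k\<ge>1. trace_on V (f ^^ k) \<noteq> 0"
proof -
  obtain N :: nat and e \<kappa> where b: "dual_basis V {..<N} e \<kappa>" by (rule dual_basis_nat[OF B])
  define A where "A = mat_of N e \<kappa> f"
  define x where "x = vec N (\<lambda>i. \<kappa> i u)"
  have A: "A \<in> carrier_mat N N" by (simp add: A_def mat_of_def)
  have tr: "trace_on V (f ^^ k) = mat_trace (A ^\<^sub>m k)" for k
  proof -
    have "trace_on V (f ^^ k) = mat_trace (mat_of N e \<kappa> (f ^^ k))"
      unfolding trace_on_dual_basis[OF b linear_map_on_power[OF f]]
      by (simp add: mat_trace_def mat_of_def)
    then show ?thesis by (simp only: mat_of_power[OF b f] A_def)
  qed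
  have "x \<noteq> 0\<^sub>v N"
  proof
    assume *: "x = 0\<^sub>v N"
    have "\<kappa> i u = 0" if "i < N" for i
    proof -
      have "x $ i = 0" using that * by simp
      then show ?thesis using that by (simp add: x_def)
    qed
    then have "u = 0" using dual_basis_eqI[OF b u(1) fs.subspace_0[OF dual_basisD(2)[OF b]]]
        dual_basis_functional_0[OF b] by simp
    with u show False by simp
  qed
  moreover have "A *\<^sub>v x = 1 \<cdot>\<^sub>v x"
  proof (rule eq_vecI; simp add: A_def x_def mat_of_def scalar_prod_def)
    fix i assume i: "i < N"
    have "\<kappa> i u = (\<Sum>k<N. \<kappa> k u * \<kappa> i (f (e k)))"
      using functional_of_image[OF b b f u(1), of i] i u(3) by simp
    then show "(\<Sum>j = 0..<N. \<kappa> i (f (e j)) * \<kappa> j u) = \<kappa> i u"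
      by (simp add: atLeast0LessThan mult.commute)
  qed
  moreover have "x \<in> carrier_vec (dim_row A)" using A by (simp add: x_def)
  ultimately have "eigenvalue A 1" unfolding eigenvalue_def eigenvector_def using A by auto
  from mat_trace_power_nonzero[OF A this] show ?thesis unfolding tr .
qed

section \<open>Representations and the group algebra\<close>

lemma one_in_GL: "1\<^sub>m n \<in> GL n"
  by (auto simp: GL_def invertible_mat_def inverts_mat_def intro!: exI[of _ "1\<^sub>m n"])

lemma GL_iff: "g \<in> GL n \<longleftrightarrow> g \<in> carrier_mat n n \<and> (\<exists>h\<in>carrier_mat n n. g * h = 1\<^sub>m n \<and> h * g = 1\<^sub>m n)"
proof
  assume "g \<in> GL n"
  then obtain h where g: "g \<in> carrier_mat n n" and h: "g * h = 1\<^sub>m n" "h * g = 1\<^sub>m (dim_row h)"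
    by (auto simp: GL_def invertible_mat_def inverts_mat_def)
  \<comment> \<open>The size of the inverse is not part of \<open>invertible_mat\<close>; it is read
    off from the number of columns in the two product equations.\<close>
  have "dim_col h = n" using arg_cong[OF h(1), of dim_col] by simp
  moreover have "dim_row h = n" using arg_cong[OF h(2), of dim_col] g by simp
  ultimately show "g \<in> carrier_mat n n \<and> (\<exists>h\<in>carrier_mat n n. g * h = 1\<^sub>m n \<and> h * g = 1\<^sub>m n)"
    using g h by auto
qed (auto simp: GL_def invertible_mat_def inverts_mat_def)

lemma GL_carrier: "g \<in> GL n \<Longrightarrow> g \<in> carrier_mat n n"
  by (simp add: GL_def)

lemma GL_mult:
  assumes "g \<in> GL n" "h \<in> GL n"
  shows "g * h \<in> GL n"
proof -
  obtain g' h' where *: "g \<in> carrier_mat n n" "g' \<in> carrier_mat n n" "g * g' = 1\<^sub>m n" "g' * g = 1\<^sub>m n"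
    "h \<in> carrier_mat n n" "h' \<in> carrier_mat n n" "h * h' = 1\<^sub>m n" "h' * h = 1\<^sub>m n"
    using assms by (auto simp: GL_iff)
  have "(g * h) * (h' * g') = g * (h * (h' * g'))"
    using * by (intro assoc_mult_mat) auto
  also have "h * (h' * g') = (h * h') * g'"
    using * by (intro assoc_mult_mat[symmetric]) auto
  finally have 1: "(g * h) * (h' * g') = 1\<^sub>m n" using * by simp
  have "(h' * g') * (g * h) = h' * (g' * (g * h))"
    using * by (intro assoc_mult_mat) auto
  also have "g' * (g * h) = (g' * g) * h"
    using * by (intro assoc_mult_mat[symmetric]) auto
  finally have 2: "(h' * g') * (g * h) = 1\<^sub>m n" using * by simp
  show ?thesis unfolding GL_iff using 1 2 * by (intro conjI bexI[of _ "h' * g'"]) auto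
qed

lemma is_repD:
  assumes "is_rep n R"
  shows "fs.subspace (rep_space R)"
    "\<And>g. g \<in> GL n \<Longrightarrow> linear_map_on (rep_space R) (rep_space R) (rep_act R g)"
    "\<And>v. v \<in> rep_space R \<Longrightarrow> rep_act R (1\<^sub>m n) v = v"
    "\<And>g h v. g \<in> GL n \<Longrightarrow> h \<in> GL n \<Longrightarrow> v \<in> rep_space R \<Longrightarrow> rep_act R (g * h) v = rep_act R g (rep_act R h v)"
proof -
  show "fs.subspace (rep_space R)"
    using assms fs.subspace_span unfolding is_rep_def is_basis_def by metis
qed (use assms in \<open>auto simp: is_rep_def\<close>)

lemma is_rep_basis:
  assumes "is_rep n R"
  obtains B where "is_basis (rep_space R) B" "finite B"
  using assms by (auto simp: is_rep_def)

section \<open>The group algebra and its action\<close>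

text \<open>A list of pairs \<open>(c, g)\<close> stands for the element \<open>\<Sum> c g\<close> of the group algebra.\<close>

type_synonym galg = "(complex \<times> complex mat) list"

definition galg :: "nat \<Rightarrow> galg set" where
  "galg n = {a. \<forall>(c, g)\<in>set a. g \<in> GL n}"

definition ract :: "'a rep \<Rightarrow> galg \<Rightarrow> ('a \<Rightarrow> complex) \<Rightarrow> 'a \<Rightarrow> complex" where
  "ract R a v = (\<Sum>(c, g)\<leftarrow>a. fscale c (rep_act R g v))"

definition gmul :: "galg \<Rightarrow> galg \<Rightarrow> galg" where
  "gmul a b = concat (map (\<lambda>(c, g). map (\<lambda>(d, h). (c * d, g * h)) b) a)"

lemma galg_simps [simp]: "[] \<in> galg n" "x # a \<in> galg n \<longleftrightarrow> snd x \<in> GL n \<and> a \<in> galg n"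
  "a @ b \<in> galg n \<longleftrightarrow> a \<in> galg n \<and> b \<in> galg n"
  by (auto simp: galg_def split: prod.splits)

lemma ract_Nil [simp]: "ract R [] v = 0"
  and ract_Cons [simp]: "ract R ((c, g) # a) v = fscale c (rep_act R g v) + ract R a v"
  and ract_append: "ract R (a @ b) v = ract R a v + ract R b v"
  by (simp_all only: ract_def list.map map_append sum_list.Nil sum_list.Cons sum_list_append prod.case)

lemma galg_gmul: "a \<in> galg n \<Longrightarrow> b \<in> galg n \<Longrightarrow> gmul a b \<in> galg n"
  by (fastforce simp: galg_def gmul_def GL_mult)

lemma linear_map_on_add:
  assumes "linear_map_on V W f" "linear_map_on V W g" "fs.subspace W"
  shows "linear_map_on V W (\<lambda>v. f v + g v)"
  unfolding linear_map_on_def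
proof (intro conjI ballI allI)
  fix u v c assume u: "u \<in> V"
  note f = linear_map_onD[OF assms(1)] and g = linear_map_onD[OF assms(2)]
  show "f u + g u \<in> W" by (rule fs.subspace_add[OF assms(3) f(1)[OF u] g(1)[OF u]])
  show "f (fscale c u) + g (fscale c u) = fscale c (f u + g u)"
    unfolding f(3)[OF u] g(3)[OF u] by (rule fs.scale_right_distrib[symmetric])
  assume v: "v \<in> V"
  show "f (u + v) + g (u + v) = f u + g u + (f v + g v)"
    unfolding f(2)[OF u v] g(2)[OF u v] by (rule add.assoc[THEN trans]) (simp add: algebra_simps)
qed

lemma linear_map_on_scale:
  assumes "linear_map_on V W f" "fs.subspace W"
  shows "linear_map_on V W (\<lambda>v. fscale c (f v))"
  unfolding linear_map_on_def
proof (intro conjI ballI allI)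
  fix u v d assume u: "u \<in> V"
  note f = linear_map_onD[OF assms(1)]
  show "fscale c (f u) \<in> W" by (rule fs.subspace_scale[OF assms(2) f(1)[OF u]])
  show "fscale c (f (fscale d u)) = fscale d (fscale c (f u))"
    unfolding f(3)[OF u] by (rule fs.scale_left_commute)
  assume v: "v \<in> V"
  show "fscale c (f (u + v)) = fscale c (f u) + fscale c (f v)"
    unfolding f(2)[OF u v] by (rule fs.scale_right_distrib)
qed

lemma linear_map_on_zero: "fs.subspace W \<Longrightarrow> linear_map_on V W (\<lambda>v. 0)"
  unfolding linear_map_on_def by (auto simp: fs.subspace_0)

lemma ract_linear:
  assumes R: "is_rep n R"
  shows "a \<in> galg n \<Longrightarrow> linear_map_on (rep_space R) (rep_space R) (ract R a)"
proof (induction a)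
  case Nil
  show ?case unfolding ract_Nil[abs_def] by (rule linear_map_on_zero[OF is_repD(1)[OF R]])
next
  case (Cons x a)
  obtain c g where x: "x = (c, g)" by (cases x)
  show ?case unfolding x ract_Cons[abs_def]
    using Cons is_repD(1,2)[OF R] x
    by (intro linear_map_on_add linear_map_on_scale) auto
qed

lemma ract_mult1:
  assumes R: "is_rep n R" and g: "g \<in> GL n" and b: "b \<in> galg n" and v: "v \<in> rep_space R"
  shows "ract R (map (\<lambda>(d, h). (c * d, g * h)) b) v = fscale c (rep_act R g (ract R b v))"
  using b
proof (induction b)
  case Nil
  then show ?case using linear_map_on_0[OF is_repD(2)[OF R g] is_repD(1)[OF R]]
    by (simp del: zero_fun_apply)
next
  case (Cons y b)
  obtain d h where y: "y = (d, h)" by (cases y)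
  note lin = linear_map_onD[OF is_repD(2)[OF R g]]
  have h: "h \<in> GL n" and b: "b \<in> galg n" using Cons.prems y by auto
  have hv: "rep_act R h v \<in> rep_space R" using linear_map_onD(1)[OF is_repD(2)[OF R h] v] .
  have bv: "ract R b v \<in> rep_space R" using linear_map_onD(1)[OF ract_linear[OF R b] v] .
  have "rep_act R g (fscale d (rep_act R h v) + ract R b v) = fscale d (rep_act R g (rep_act R h v)) + rep_act R g (ract R b v)"
    unfolding lin(2)[OF fs.subspace_scale[OF is_repD(1)[OF R] hv] bv] lin(3)[OF hv] ..
  then show ?case
    unfolding y list.map prod.case ract_Cons Cons.IH[OF b] is_repD(4)[OF R g h v]
    by (simp only: fs.scale_right_distrib fs.scale_scale)
qed

lemma ract_gmul:
  assumes R: "is_rep n R" and b: "b \<in> galg n" and v: "v \<in> rep_space R"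
  shows "a \<in> galg n \<Longrightarrow> ract R (gmul a b) v = ract R a (ract R b v)"
proof (induction a)
  case Nil
  then show ?case by (simp add: gmul_def)
next
  case (Cons x a)
  obtain c g where x: "x = (c, g)" by (cases x)
  have "gmul (x # a) b = map (\<lambda>(d, h). (c * d, g * h)) b @ gmul a b"
    by (simp add: gmul_def x)
  then show ?case using Cons ract_mult1[OF R _ b v, of g c] x by (simp only: ract_append ract_Cons) simp
qed

lemma ract_one: "is_rep n R \<Longrightarrow> v \<in> rep_space R \<Longrightarrow> ract R [(c, 1\<^sub>m n)] v = fscale c v"
  using is_repD(3)[of n R v] by (simp only: ract_Cons ract_Nil add_0_right)

lemma one_galg: "[(c, 1\<^sub>m n)] \<in> galg n"
  by (simp add: one_in_GL)

section \<open>Submodules, ideals and annihilators\<close>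

definition submodule :: "nat \<Rightarrow> 'a rep \<Rightarrow> ('a \<Rightarrow> complex) set \<Rightarrow> bool" where
  "submodule n R U \<longleftrightarrow> fs.subspace U \<and> U \<subseteq> rep_space R \<and> (\<forall>g\<in>GL n. rep_act R g ` U \<subseteq> U)"

definition equivariant_on ::
  "nat \<Rightarrow> ('a \<Rightarrow> complex) set \<Rightarrow> 'a rep \<Rightarrow> 'b rep \<Rightarrow> (('a \<Rightarrow> complex) \<Rightarrow> 'b \<Rightarrow> complex) \<Rightarrow> bool" where
  "equivariant_on n M R S \<phi> \<longleftrightarrow> (\<forall>g\<in>GL n. \<forall>v\<in>M. \<phi> (rep_act R g v) = rep_act S g (\<phi> v))"

text \<open>Lists are formal sums that are never collected: \<open>[]\<close> is zero and
  \<open>@\<close> is addition. Closure under scalars is left multiplication by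
  \<open>[(c, 1\<^sub>m n)]\<close>.\<close>

definition left_ideal :: "nat \<Rightarrow> galg set \<Rightarrow> bool" where
  "left_ideal n L \<longleftrightarrow> L \<subseteq> galg n \<and> [] \<in> L \<and> (\<forall>a\<in>L. \<forall>b\<in>L. a @ b \<in> L) \<and> (\<forall>a\<in>galg n. \<forall>b\<in>L. gmul a b \<in> L)"

definition two_sided_ideal :: "nat \<Rightarrow> galg set \<Rightarrow> bool" where
  "two_sided_ideal n J \<longleftrightarrow> left_ideal n J \<and> (\<forall>a\<in>J. \<forall>b\<in>galg n. gmul a b \<in> J)"

definition ann :: "nat \<Rightarrow> 'a rep \<Rightarrow> ('a \<Rightarrow> complex) set \<Rightarrow> galg set" where
  "ann n R A = {a \<in> galg n. \<forall>v\<in>A. ract R a v = 0}"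

lemma irreducibleD:
  "is_irreducible n R \<Longrightarrow> submodule n R U \<Longrightarrow> U = {0} \<or> U = rep_space R"
  by (auto simp: is_irreducible_def submodule_def)

lemma irreducible_nonzero:
  assumes "is_rep n R" "is_irreducible n R"
  obtains u where "u \<in> rep_space R" "u \<noteq> 0"
proof -
  have "rep_space R \<noteq> {0}" "0 \<in> rep_space R"
    using assms fs.subspace_0[OF is_repD(1)] by (auto simp: is_irreducible_def)
  then show ?thesis using that by blast
qed

lemma left_ideal_galg: "left_ideal n (galg n)"
  by (auto simp: left_ideal_def galg_gmul)

lemma ideal_galg: "two_sided_ideal n (galg n)"
  by (auto simp: two_sided_ideal_def left_ideal_galg galg_gmul)

lemma ideal_Int: "two_sided_ideal n I \<Longrightarrow> two_sided_ideal n J \<Longrightarrow> two_sided_ideal n (I \<inter> J)"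
  by (auto simp: two_sided_ideal_def left_ideal_def)

lemma left_ideal_ann:
  assumes R: "is_rep n R" and A: "A \<subseteq> rep_space R"
  shows "left_ideal n (ann n R A)"
proof -
  have "ract R (gmul a b) v = 0" if "a \<in> galg n" "b \<in> ann n R A" "v \<in> A" for a b v
    using that A ract_gmul[OF R, of b v a] linear_map_on_0[OF ract_linear[OF R that(1)] is_repD(1)[OF R]]
    by (auto simp: ann_def)
  moreover have "ract R (a @ b) v = 0" if "a \<in> ann n R A" "b \<in> ann n R A" "v \<in> A" for a b v
    using that by (simp add: ann_def ract_append)
  ultimately show ?thesis by (auto simp: left_ideal_def ann_def galg_gmul)
qed

lemma ideal_ann:
  assumes R: "is_rep n R"
  shows "two_sided_ideal n (ann n R (rep_space R))"
proof -
  have "ract R (gmul a b) v = 0" if "a \<in> ann n R (rep_space R)" "b \<in> galg n" "v \<in> rep_space R" for a b v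
    using that ract_gmul[OF R, of b v a] linear_map_onD(1)[OF ract_linear[OF R that(2)]]
    by (auto simp: ann_def)
  then show ?thesis using left_ideal_ann[OF R subset_refl]
    by (auto simp: two_sided_ideal_def ann_def galg_gmul)
qed

lemma ract_diff:
  assumes R: "is_rep n R" and b: "b \<in> galg n" and v: "v \<in> rep_space R"
  shows "ract R (a @ gmul [(-1, 1\<^sub>m n)] b) v = ract R a v - ract R b v"
  unfolding ract_append ract_gmul[OF R b v one_galg]
    ract_one[OF R linear_map_onD(1)[OF ract_linear[OF R b] v]]
  by (simp add: fs.scale_minus_left)

lemma submodule_orbit:
  assumes R: "is_rep n R" and L: "left_ideal n L" and v: "v \<in> rep_space R"
  shows "submodule n R ((\<lambda>a. ract R a v) ` L)"
proof -
  have Lg: "a \<in> galg n" if "a \<in> L" for a using L that by (auto simp: left_ideal_def)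
  have in_sp: "ract R a v \<in> rep_space R" if "a \<in> L" for a
    using linear_map_onD(1)[OF ract_linear[OF R Lg[OF that]] v] .
  \<comment> \<open>Used twice: with \<open>g = 1\<^sub>m n\<close> it yields closure under scalars,
    with \<open>c = 1\<close> stability under the group.\<close>
  have act: "fscale c (rep_act R g (ract R a v)) \<in> (\<lambda>a. ract R a v) ` L" if "a \<in> L" "g \<in> GL n" for c g a
  proof
    have cg: "[(c, g)] \<in> galg n" using that by simp
    show "fscale c (rep_act R g (ract R a v)) = ract R (gmul [(c, g)] a) v"
      unfolding ract_gmul[OF R Lg[OF that(1)] v cg] ract_Cons ract_Nil add_0_right ..
    show "gmul [(c, g)] a \<in> L" using L that by (auto simp: left_ideal_def)
  qed
  have "fs.subspace ((\<lambda>a. ract R a v) ` L)"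
  proof (rule fs.subspaceI)
    show "0 \<in> (\<lambda>a. ract R a v) ` L" using L by (auto simp: left_ideal_def intro!: image_eqI[of _ _ "[]"])
  next
    fix x y assume "x \<in> (\<lambda>a. ract R a v) ` L" "y \<in> (\<lambda>a. ract R a v) ` L"
    then obtain a b where "a \<in> L" "b \<in> L" "x = ract R a v" "y = ract R b v" by auto
    then show "x + y \<in> (\<lambda>a. ract R a v) ` L" using L
      by (intro image_eqI[of _ _ "a @ b"]) (auto simp: left_ideal_def ract_append)
  next
    fix c x assume "x \<in> (\<lambda>a. ract R a v) ` L"
    then obtain a where a: "a \<in> L" "x = ract R a v" by auto
    then show "fscale c x \<in> (\<lambda>a. ract R a v) ` L"
      using act[OF a(1) one_in_GL, of c] is_repD(3)[OF R in_sp[OF a(1)]] by simp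
  qed
  moreover have "rep_act R g ` ((\<lambda>a. ract R a v) ` L) \<subseteq> (\<lambda>a. ract R a v) ` L" if "g \<in> GL n" for g
    using act[OF _ that, of _ 1] by auto
  ultimately show ?thesis using in_sp by (auto simp: submodule_def)
qed

text \<open>The assignment of \<open>ract S a u\<close> to \<open>ract R a v\<close> is well
  defined: if two elements of \<open>L\<close> agree on \<open>v\<close>, their difference lies in
  \<open>L\<close> and kills \<open>v\<close>, so by \<open>kill\<close> it also kills
  \<open>u\<close>.\<close>

lemma orbit_hom:
  assumes R: "is_rep n R" and S: "is_rep n S" and L: "left_ideal n L"
    and v: "v \<in> rep_space R" and u: "u \<in> rep_space S"
    and kill: "\<And>a. a \<in> L \<Longrightarrow> ract R a v = 0 \<Longrightarrow> ract S a u = 0"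
  obtains \<psi> where "linear_map_on ((\<lambda>a. ract R a v) ` L) (rep_space S) \<psi>"
    "equivariant_on n ((\<lambda>a. ract R a v) ` L) R S \<psi>"
    "\<And>a. a \<in> L \<Longrightarrow> \<psi> (ract R a v) = ract S a u"
proof -
  have Lg: "a \<in> galg n" if "a \<in> L" for a using L that by (auto simp: left_ideal_def)
  define \<psi> where "\<psi> m = ract S (SOME a. a \<in> L \<and> ract R a v = m) u" for m
  have eq: "\<psi> (ract R a v) = ract S a u" if a: "a \<in> L" for a
  proof -
    define b where "b = (SOME b. b \<in> L \<and> ract R b v = ract R a v)"
    have "b \<in> L \<and> ract R b v = ract R a v"
      unfolding b_def by (rule someI[of _ a]) (use a in auto)
    then have b: "b \<in> L" "ract R b v = ract R a v" by auto
    define c where "c = b @ gmul [(-1, 1\<^sub>m n)] a"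
    have "c \<in> L" using L a b one_galg by (auto simp: c_def left_ideal_def)
    moreover have "ract R c v = 0" unfolding c_def ract_diff[OF R Lg[OF a] v] b(2) by simp
    ultimately have "ract S c u = 0" by (rule kill)
    then show ?thesis unfolding c_def ract_diff[OF S Lg[OF a] u] by (simp add: \<psi>_def flip: b_def)
  qed
  have lin: "linear_map_on ((\<lambda>a. ract R a v) ` L) (rep_space S) \<psi>"
    unfolding linear_map_on_def
  proof (intro conjI ballI allI)
    fix x y c assume "x \<in> (\<lambda>a. ract R a v) ` L"
    then obtain a where a: "a \<in> L" "x = ract R a v" by auto
    show "\<psi> x \<in> rep_space S" using eq[OF a(1)] a(2) linear_map_onD(1)[OF ract_linear[OF S Lg[OF a(1)]] u] by simp
    have ca: "gmul [(c, 1\<^sub>m n)] a \<in> L" using L a one_galg by (auto simp: left_ideal_def)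
    have "ract R (gmul [(c, 1\<^sub>m n)] a) v = fscale c x"
      unfolding ract_gmul[OF R Lg[OF a(1)] v one_galg] a(2)
      by (rule ract_one[OF R linear_map_onD(1)[OF ract_linear[OF R Lg[OF a(1)]] v]])
    moreover have "ract S (gmul [(c, 1\<^sub>m n)] a) u = fscale c (ract S a u)"
      unfolding ract_gmul[OF S Lg[OF a(1)] u one_galg]
      by (rule ract_one[OF S linear_map_onD(1)[OF ract_linear[OF S Lg[OF a(1)]] u]])
    ultimately show "\<psi> (fscale c x) = fscale c (\<psi> x)" using eq[OF ca] eq[OF a(1)] a(2) by simp
    assume "y \<in> (\<lambda>a. ract R a v) ` L"
    then obtain b where b: "b \<in> L" "y = ract R b v" by auto
    have "a @ b \<in> L" using L a b by (auto simp: left_ideal_def)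
    from eq[OF this] show "\<psi> (x + y) = \<psi> x + \<psi> y"
      by (simp only: ract_append a(2) b(2) eq[OF a(1)] eq[OF b(1)])
  qed
  have "equivariant_on n ((\<lambda>a. ract R a v) ` L) R S \<psi>"
    unfolding equivariant_on_def
  proof (intro ballI)
    fix g x assume g: "g \<in> GL n" and "x \<in> (\<lambda>a. ract R a v) ` L"
    then obtain a where a: "a \<in> L" "x = ract R a v" by auto
    have gg: "[(1, g)] \<in> galg n" using g by simp
    have ga: "gmul [(1, g)] a \<in> L" using L a gg by (auto simp: left_ideal_def)
    have "ract R (gmul [(1, g)] a) v = rep_act R g x"
      unfolding ract_gmul[OF R Lg[OF a(1)] v gg] a(2) by simp
    moreover have "ract S (gmul [(1, g)] a) u = rep_act S g (ract S a u)"
      unfolding ract_gmul[OF S Lg[OF a(1)] u gg] by simp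
    ultimately show "\<psi> (rep_act R g x) = rep_act S g (\<psi> x)" using eq[OF ga] eq[OF a(1)] a(2) by simp
  qed
  with lin eq that show ?thesis by blast
qed

text \<open>The group algebra elements killing \<open>vs\<close> form a left ideal \<open>L\<close>. Either \<open>L u = 0\<close>, and one
  vector fewer suffices, or \<open>L u\<close> is all of \<open>S\<close> and \<open>a v \<mapsto> a u\<close> is defined on \<open>L v\<close>.\<close>

lemma hom_onto_irreducible:
  assumes R: "is_rep n R" and S: "is_rep n S" and irr: "is_irreducible n S"
    and u: "u \<in> rep_space S" "u \<noteq> 0"
  shows "set vs \<subseteq> rep_space R \<Longrightarrow> (\<And>a. a \<in> ann n R (set vs) \<Longrightarrow> ract S a u = 0) \<Longrightarrow>
    \<exists>M \<psi>. submodule n R M \<and> linear_map_on M (rep_space S) \<psi> \<and> equivariant_on n M R S \<psi> \<and> \<psi> ` M = rep_space S"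
proof (induction vs)
  case Nil
  \<comment> \<open>With no vectors left the annihilator is the whole group algebra, whose unit
    would have to kill the nonzero \<open>u\<close>.\<close>
  have "ract S [(1, 1\<^sub>m n)] u = 0" using Nil by (intro Nil.prems(2)) (simp add: ann_def one_in_GL)
  then show ?case using ract_one[OF S u(1), of 1] u(2) by (simp del: ract_Cons)
next
  case (Cons v vs)
  have v: "v \<in> rep_space R" and vs: "set vs \<subseteq> rep_space R" using Cons.prems by auto
  define L where "L = ann n R (set vs)"
  have L: "left_ideal n L" unfolding L_def by (rule left_ideal_ann[OF R vs])
  from irreducibleD[OF irr submodule_orbit[OF S L u(1)]] show ?case
  proof
    assume "(\<lambda>a. ract S a u) ` L = {0}"
    then have "ract S a u = 0" if "a \<in> ann n R (set vs)" for a using that L_def by blast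
    from Cons.IH[OF vs this] show ?case by blast
  next
    assume onto: "(\<lambda>a. ract S a u) ` L = rep_space S"
    have "ract S a u = 0" if "a \<in> L" "ract R a v = 0" for a
      by (rule Cons.prems(2)) (use that in \<open>auto simp: L_def ann_def\<close>)
    from orbit_hom[OF R S L v u(1) this] obtain \<psi> where
      \<psi>: "linear_map_on ((\<lambda>a. ract R a v) ` L) (rep_space S) \<psi>"
        "equivariant_on n ((\<lambda>a. ract R a v) ` L) R S \<psi>" "\<And>a. a \<in> L \<Longrightarrow> \<psi> (ract R a v) = ract S a u"
      by blast
    have "\<psi> ` ((\<lambda>a. ract R a v) ` L) = rep_space S"
      using \<psi>(3) onto by (auto simp: image_image)
    with \<psi>(1,2) submodule_orbit[OF R L v] show ?case by blast
  qed
qed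

text \<open>Complements are required inside every submodule \<open>M\<close>, not only inside the
  whole space, because they will be taken for the kernel of a map that is defined on a submodule
  only.\<close>

definition semisimple :: "nat \<Rightarrow> 'a rep \<Rightarrow> bool" where
  "semisimple n R \<longleftrightarrow> (\<forall>K M. submodule n R K \<longrightarrow> submodule n R M \<longrightarrow> K \<subseteq> M \<longrightarrow>
     (\<exists>N. submodule n R N \<and> N \<subseteq> M \<and> K \<inter> N = {0} \<and> (\<forall>m\<in>M. \<exists>k\<in>K. \<exists>l\<in>N. m = k + l)))"

lemma submodule_zero: "is_rep n R \<Longrightarrow> submodule n R {0}"
  using linear_map_on_0[OF is_repD(2) is_repD(1)] fs.subspace_0[OF is_repD(1)]
  by (auto simp: submodule_def fs.subspace_single_0)

lemma irreducible_semisimple: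
  assumes R: "is_rep n R" and irr: "is_irreducible n R"
  shows "semisimple n R"
  unfolding semisimple_def
proof (intro allI impI)
  fix K M assume K: "submodule n R K" and M: "submodule n R M" and "K \<subseteq> M"
  consider "K = {0}" | "K = M"
    using irreducibleD[OF irr K] irreducibleD[OF irr M] \<open>K \<subseteq> M\<close> M by (auto simp: submodule_def)
  then show "\<exists>N. submodule n R N \<and> N \<subseteq> M \<and> K \<inter> N = {0} \<and> (\<forall>m\<in>M. \<exists>k\<in>K. \<exists>l\<in>N. m = k + l)"
  proof cases
    case 1
    then show ?thesis using M \<open>K \<subseteq> M\<close> by (intro exI[of _ M]) auto
  next
    case 2
    then show ?thesis using submodule_zero[OF R] fs.subspace_0[of M] M
      by (intro exI[of _ "{0}"]) (auto simp: submodule_def)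
  qed
qed

text \<open>An element that kills a finite basis of \<open>R\<close> kills \<open>R\<close> and
  hence \<open>S\<close>, so \<open>hom_onto_irreducible\<close>, applied to the list of basis
  vectors, maps a submodule of \<open>R\<close> onto \<open>S\<close>. A complement of the kernel in
  that submodule is mapped bijectively, and the inverse is the embedding.\<close>

lemma embedding_of_ann_le:
  assumes R: "is_rep n R" and ss: "semisimple n R" and S: "is_rep n S" and irr: "is_irreducible n S"
    and le: "ann n R (rep_space R) \<subseteq> ann n S (rep_space S)"
  obtains \<phi> where "linear_map_on (rep_space S) (rep_space R) \<phi>" "equivariant_on n (rep_space S) S R \<phi>"
    "inj_on \<phi> (rep_space S)"
proof -
  obtain u where u: "u \<in> rep_space S" "u \<noteq> 0" by (rule irreducible_nonzero[OF S irr])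
  obtain B where B: "is_basis (rep_space R) B" "finite B" by (rule is_rep_basis[OF R])
  obtain vs where vs: "set vs = B" using finite_list[OF B(2)] by blast
  have BR: "B \<subseteq> rep_space R" using B fs.span_superset by (auto simp: is_basis_def)
  have "ract S a u = 0" if a: "a \<in> ann n R (set vs)" for a
  proof -
    have ag: "a \<in> galg n" using a by (simp add: ann_def)
    have "ract R a v = 0" if v: "v \<in> rep_space R" for v
    proof -
      note b = dual_basis_of_basis[OF B] and lin = ract_linear[OF R ag]
      have "ract R a v = ract R a (\<Sum>b\<in>B. fscale (fs.representation B v b) b)"
        using dual_basisD(7)[OF b v] by simp
      also have "\<dots> = (\<Sum>b\<in>B. ract R a (fscale (fs.representation B v b) b))"
        by (rule linear_map_on_sum[OF lin is_repD(1)[OF R]])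
          (use BR in \<open>auto intro: fs.subspace_scale[OF is_repD(1)[OF R]]\<close>)
      also have "\<dots> = 0"
        using a vs BR by (intro sum.neutral) (auto simp: ann_def linear_map_onD(3)[OF lin])
      finally show ?thesis .
    qed
    then have "a \<in> ann n R (rep_space R)" using ag by (simp add: ann_def)
    then show ?thesis using le u by (auto simp: ann_def)
  qed
  from hom_onto_irreducible[OF R S irr u _ this] vs BR obtain M \<psi> where
    M: "submodule n R M" and lin: "linear_map_on M (rep_space S) \<psi>" and eqv: "equivariant_on n M R S \<psi>"
    and onto: "\<psi> ` M = rep_space S" by blast
  have sM: "fs.subspace M" using M by (simp add: submodule_def)
  define K where "K = {m \<in> M. \<psi> m = 0}"
  have \<psi>0: "\<psi> 0 = 0" by (rule linear_map_on_0[OF lin sM])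
  have "submodule n R K"
  proof -
    have "fs.subspace K"
      unfolding K_def
      by (rule fs.subspaceI)
         (auto simp: fs.subspace_0[OF sM] \<psi>0 fs.subspace_add[OF sM] fs.subspace_scale[OF sM]
           linear_map_onD(2)[OF lin] linear_map_onD(3)[OF lin])
    moreover have "rep_act R g k \<in> K" if g: "g \<in> GL n" and "k \<in> K" for g k
      using that M eqv linear_map_on_0[OF is_repD(2)[OF S g] is_repD(1)[OF S]]
      unfolding K_def submodule_def equivariant_on_def by (auto 0 4)
    ultimately show ?thesis using M by (auto simp: submodule_def K_def)
  qed
  then obtain N where N: "submodule n R N" "N \<subseteq> M" "K \<inter> N = {0}" "\<And>m. m \<in> M \<Longrightarrow> \<exists>k\<in>K. \<exists>l\<in>N. m = k + l"
    using ss M unfolding semisimple_def K_def by (metis (no_types, lifting) mem_Collect_eq subsetI)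
  have sN: "fs.subspace N" using N by (simp add: submodule_def)
  have inj: "inj_on \<psi> N"
  proof (rule inj_onI)
    fix x y assume x: "x \<in> N" and y: "y \<in> N" and "\<psi> x = \<psi> y"
    then have "\<psi> (x - y) = 0"
      using linear_map_on_diff[OF lin sM, of x y] x y N(2) by auto
    moreover have "x - y \<in> M" using fs.subspace_diff[OF sM, of x y] x y N(2) by auto
    ultimately have "x - y \<in> K \<inter> N" using fs.subspace_diff[OF sN x y] by (simp add: K_def)
    then show "x = y" using N(3) by simp
  qed
  have onN: "\<psi> ` N = rep_space S"
  proof
    show "\<psi> ` N \<subseteq> rep_space S" using onto N(2) by auto
    show "rep_space S \<subseteq> \<psi> ` N"
    proof
      fix s assume "s \<in> rep_space S"
      then obtain m where m: "m \<in> M" "s = \<psi> m" using onto by auto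
      then obtain k l where kl: "k \<in> K" "l \<in> N" "m = k + l" using N(4) by blast
      have "s = \<psi> k + \<psi> l" unfolding m(2) kl(3)
        by (rule linear_map_onD(2)[OF lin]) (use kl N(2) in \<open>auto simp: K_def\<close>)
      then have "s = \<psi> l" using kl by (simp add: K_def)
      then show "s \<in> \<psi> ` N" using kl by blast
    qed
  qed
  have NM: "linear_map_on N (rep_space S) \<psi>"
    using lin N(2) unfolding linear_map_on_def by blast
  obtain \<phi> where \<phi>: "linear_map_on (rep_space S) N \<phi>"
    and \<psi>\<phi>: "\<And>s. s \<in> rep_space S \<Longrightarrow> \<psi> (\<phi> s) = s" and \<phi>\<psi>: "\<And>x. x \<in> N \<Longrightarrow> \<phi> (\<psi> x) = x"
    by (rule linear_bijection_inverse[OF sN NM]) (use inj onN in \<open>auto simp: bij_betw_def\<close>)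
  note \<phi>N = linear_map_onD(1)[OF \<phi>]
  have "linear_map_on (rep_space S) (rep_space R) \<phi>"
    using \<phi> N(1) unfolding linear_map_on_def submodule_def by blast
  moreover have "equivariant_on n (rep_space S) S R \<phi>"
    unfolding equivariant_on_def
  proof (intro ballI)
    fix g s assume g: "g \<in> GL n" and s: "s \<in> rep_space S"
    have gN: "rep_act R g (\<phi> s) \<in> N" using N(1) \<phi>N[OF s] g by (auto simp: submodule_def)
    have "\<psi> (rep_act R g (\<phi> s)) = rep_act S g (\<psi> (\<phi> s))"
      using eqv g \<phi>N[OF s] N(2) by (auto simp: equivariant_on_def)
    then have "\<psi> (rep_act R g (\<phi> s)) = rep_act S g s" using \<psi>\<phi>[OF s] by simp
    then show "\<phi> (rep_act S g s) = rep_act R g (\<phi> s)" using \<phi>\<psi>[OF gN] by simp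
  qed
  moreover have "inj_on \<phi> (rep_space S)" using \<psi>\<phi> by (metis inj_on_inverseI)
  ultimately show ?thesis by (rule that)
qed

text \<open>Some \<open>a\<close> in \<open>J\<close> has \<open>ract S a v \<noteq> 0\<close> for
  some \<open>v\<close>, and irreducibility writes \<open>v\<close> as \<open>ract S b u\<close>.
  The product of \<open>a\<close> and \<open>b\<close> lies in \<open>J\<close> because
  \<open>J\<close> is also a right ideal, so the submodule of all \<open>ract S a u\<close> with
  \<open>a\<close> in \<open>J\<close> is nonzero and therefore everything.\<close>

lemma ideal_orbit_irreducible:
  assumes S: "is_rep n S" and irr: "is_irreducible n S" and J: "two_sided_ideal n J"
    and nk: "\<not> J \<subseteq> ann n S (rep_space S)" and u: "u \<in> rep_space S" "u \<noteq> 0" and w: "w \<in> rep_space S"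
  obtains a where "a \<in> J" "ract S a u = w"
proof -
  have Jl: "left_ideal n J" and Jr: "\<And>a b. a \<in> J \<Longrightarrow> b \<in> galg n \<Longrightarrow> gmul a b \<in> J"
    using J by (auto simp: two_sided_ideal_def)
  have Jg: "a \<in> galg n" if "a \<in> J" for a using Jl that by (auto simp: left_ideal_def)
  obtain a v where a: "a \<in> J" and v: "v \<in> rep_space S" and av: "ract S a v \<noteq> 0"
    using nk Jg by (auto simp: ann_def)
  from irreducibleD[OF irr submodule_orbit[OF S left_ideal_galg u(1)]]
  have "(\<lambda>b. ract S b u) ` galg n = rep_space S"
  proof
    assume "(\<lambda>b. ract S b u) ` galg n = {0}"
    then have "ract S [(1, 1\<^sub>m n)] u = 0" using one_galg by blast
    with ract_one[OF S u(1), of 1] u(2) show ?thesis by (simp del: ract_Cons)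
  qed
  then obtain b where b: "b \<in> galg n" "v = ract S b u" using v by auto
  have "ract S (gmul a b) u \<noteq> 0" using av ract_gmul[OF S b(1) u(1) Jg[OF a]] b(2) by simp
  then have "(\<lambda>a. ract S a u) ` J \<noteq> {0}" using Jr[OF a b(1)] by blast
  with irreducibleD[OF irr submodule_orbit[OF S Jl u(1)]] w have "w \<in> (\<lambda>a. ract S a u) ` J" by auto
  then show ?thesis using that by blast
qed

text \<open>Annihilators of irreducible representations are prime ideals.\<close>

lemma ideal_INT_not_killing:
  assumes S: "is_rep n S" and irr: "is_irreducible n S"
  shows "finite I \<Longrightarrow> (\<And>i. i \<in> I \<Longrightarrow> two_sided_ideal n (J i) \<and> \<not> J i \<subseteq> ann n S (rep_space S)) \<Longrightarrow>
    two_sided_ideal n (galg n \<inter> (\<Inter>i\<in>I. J i)) \<and> \<not> (galg n \<inter> (\<Inter>i\<in>I. J i)) \<subseteq> ann n S (rep_space S)"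
proof (induction I rule: finite_induct)
  case empty
  obtain u where u: "u \<in> rep_space S" "u \<noteq> 0" by (rule irreducible_nonzero[OF S irr])
  have "ract S [(1, 1\<^sub>m n)] u \<noteq> 0" using ract_one[OF S u(1), of 1] u(2) by (simp del: ract_Cons)
  then have "[(1, 1\<^sub>m n)] \<notin> ann n S (rep_space S)" using u by (auto simp: ann_def simp del: ract_Cons)
  then show ?case using ideal_galg one_galg by (auto simp: subset_eq simp del: galg_simps)
next
  case (insert i I)
  define K where "K = galg n \<inter> (\<Inter>i\<in>I. J i)"
  have K: "two_sided_ideal n K" "\<not> K \<subseteq> ann n S (rep_space S)" using insert by (auto simp: K_def)
  have Ji: "two_sided_ideal n (J i)" "\<not> J i \<subseteq> ann n S (rep_space S)" using insert by auto
  have eq: "galg n \<inter> (\<Inter>i\<in>insert i I. J i) = J i \<inter> K" by (auto simp: K_def)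
  obtain u where u: "u \<in> rep_space S" "u \<noteq> 0" by (rule irreducible_nonzero[OF S irr])
  \<comment> \<open>Both elements are chosen to fix the same \<open>u\<close>, so their product
    fixes \<open>u\<close> and does not annihilate. It lies in \<open>J i\<close> as a right
    multiple of \<open>a\<close> and in \<open>K\<close> as a left multiple of
    \<open>b\<close>.\<close>
  obtain b where b: "b \<in> K" "ract S b u = u" by (rule ideal_orbit_irreducible[OF S irr K u u(1)])
  obtain a where a: "a \<in> J i" "ract S a u = u" by (rule ideal_orbit_irreducible[OF S irr Ji u u(1)])
  have g: "a \<in> galg n" "b \<in> galg n"
    using a b Ji(1) K(1) by (auto simp: two_sided_ideal_def left_ideal_def)
  have "gmul a b \<in> J i \<inter> K"
    using a b g Ji(1) K(1) by (auto simp: two_sided_ideal_def left_ideal_def)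
  moreover have "ract S (gmul a b) u = u" using ract_gmul[OF S g(2) u(1) g(1)] a b by simp
  then have "gmul a b \<notin> ann n S (rep_space S)" using u by (auto simp: ann_def)
  ultimately show ?case unfolding eq using ideal_Int[OF Ji(1) K(1)] by blast
qed

section \<open>Traces on the group algebra and embeddings of the summands\<close>

lemma trace_ract:
  assumes R: "is_rep n R" and a: "a \<in> galg n"
  shows "trace_on (rep_space R) (ract R a) = (\<Sum>(c, g)\<leftarrow>a. c * trace_on (rep_space R) (rep_act R g))"
proof -
  obtain B where B: "is_basis (rep_space R) B" "finite B" by (rule is_rep_basis[OF R])
  note b = dual_basis_of_basis[OF B]
  show ?thesis using a
  proof (induction a)
    case Nil
    have "trace_on (rep_space R) (ract R []) = 0"
      unfolding trace_on_dual_basis[OF b ract_linear[OF R Nil]]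
      by (simp add: fs.representation_zero)
    then show ?case by (simp del: ract_Nil)
  next
    case (Cons x a)
    obtain c g where x: "x = (c, g)" by (cases x)
    have g: "g \<in> GL n" and a: "a \<in> galg n" using Cons.prems x by auto
    note gl = linear_map_onD(1)[OF is_repD(2)[OF R g]] and al = linear_map_onD(1)[OF ract_linear[OF R a]]
    have "trace_on (rep_space R) (ract R (x # a)) = (\<Sum>v\<in>B. fs.representation B (ract R (x # a) v) v)"
      by (rule trace_on_dual_basis[OF b ract_linear[OF R Cons.prems]])
    also have "\<dots> = (\<Sum>v\<in>B. c * fs.representation B (rep_act R g v) v + fs.representation B (ract R a v) v)"
    proof (rule sum.cong[OF refl])
      fix v assume v: "v \<in> B"
      then have vR: "v \<in> rep_space R" using dual_basisD(3)[OF b] by blast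
      show "fs.representation B (ract R (x # a) v) v = c * fs.representation B (rep_act R g v) v + fs.representation B (ract R a v) v"
        unfolding x ract_Cons
          dual_basisD(4)[OF b v fs.subspace_scale[OF is_repD(1)[OF R] gl[OF vR]] al[OF vR]]
          dual_basisD(5)[OF b v gl[OF vR]] ..
    qed
    also have "\<dots> = c * trace_on (rep_space R) (rep_act R g) + trace_on (rep_space R) (ract R a)"
      unfolding trace_on_dual_basis[OF b ract_linear[OF R a]] trace_on_dual_basis[OF b is_repD(2)[OF R g]]
      by (simp add: sum.distrib sum_distrib_left)
    finally show ?case using Cons.IH[OF a] by (simp add: x del: ract_Cons)
  qed
qed

lemma trace_ract_ann:
  assumes R: "is_rep n R" and a: "a \<in> ann n R (rep_space R)"
  shows "trace_on (rep_space R) (ract R a) = 0"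
proof -
  obtain C where C: "is_basis (rep_space R) C" "finite C" by (rule is_rep_basis[OF R])
  note c = dual_basis_of_basis[OF C]
  have ag: "a \<in> galg n" using a by (simp add: ann_def)
  show ?thesis unfolding trace_on_dual_basis[OF c ract_linear[OF R ag]]
    using a dual_basisD(3)[OF c] by (intro sum.neutral) (auto simp: ann_def fs.representation_zero)
qed

text \<open>The exponent is shifted: \<open>gpow a k\<close> is the power k + 1 of \<open>a\<close>,
  so every value stays in any left ideal that contains \<open>a\<close>, which the unit would
  not.\<close>

primrec gpow :: "galg \<Rightarrow> nat \<Rightarrow> galg" where
  "gpow a 0 = a"
| "gpow a (Suc k) = gmul a (gpow a k)"

lemma gpow_left_ideal: "left_ideal n J \<Longrightarrow> a \<in> J \<Longrightarrow> gpow a k \<in> J"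
  by (induction k) (auto simp: left_ideal_def)

lemma ract_gpow:
  assumes "is_rep n R" "a \<in> galg n" "v \<in> rep_space R"
  shows "ract R (gpow a k) v = (ract R a ^^ Suc k) v"
proof (induction k)
  case (Suc k)
  have "gpow a k \<in> galg n" by (rule gpow_left_ideal[OF left_ideal_galg assms(2)])
  then show ?case using ract_gmul[OF assms(1) _ assms(3,2)] Suc by simp
qed simp

lemma embedding_of_traces:
  fixes V :: "'a rep" and W :: "'k \<Rightarrow> 'b rep"
  assumes V: "is_rep n V" "semisimple n V" and X: "finite X" "l \<in> X"
    and W: "\<And>k. k \<in> X \<Longrightarrow> is_rep n (W k)" "\<And>k. k \<in> X \<Longrightarrow> is_irreducible n (W k)"
    and ann: "\<And>k. k \<in> X \<Longrightarrow> k \<noteq> l \<Longrightarrow> \<not> ann n (W k) (rep_space (W k)) \<subseteq> ann n (W l) (rep_space (W l))"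
    and tr: "\<And>g. g \<in> GL n \<Longrightarrow> trace_on (rep_space V) (rep_act V g) = (\<Sum>k\<in>X. trace_on (rep_space (W k)) (rep_act (W k) g))"
  obtains \<phi> where "linear_map_on (rep_space (W l)) (rep_space V) \<phi>" "equivariant_on n (rep_space (W l)) (W l) V \<phi>"
    "inj_on \<phi> (rep_space (W l))"
proof -
  define S where "S = rep_space (W l)"
  have rl: "is_rep n (W l)" and irr: "is_irreducible n (W l)" using W X by auto
  have "ann n V (rep_space V) \<subseteq> ann n (W l) S"
  proof (rule ccontr)
    assume *: "\<not> ann n V (rep_space V) \<subseteq> ann n (W l) S"
    \<comment> \<open>The index \<open>l\<close> itself must not contribute its own annihilator, so
      its place in the family is taken by the annihilator of \<open>V\<close>. The intersection then
      kills \<open>V\<close> and all summands other than \<open>W l\<close>.\<close>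
    define A where "A k = (if k = l then ann n V (rep_space V) else ann n (W k) (rep_space (W k)))" for k
    define J where "J = galg n \<inter> (\<Inter>k\<in>X. A k)"
    have "two_sided_ideal n (A k) \<and> \<not> A k \<subseteq> ann n (W l) (rep_space (W l))" if "k \<in> X" for k
      using * ann[OF that] ideal_ann[OF V(1)] ideal_ann[OF W(1)[OF that]] by (simp add: A_def S_def)
    then have J: "two_sided_ideal n J" "\<not> J \<subseteq> ann n (W l) S"
      using ideal_INT_not_killing[OF rl irr X(1), of A] by (simp_all add: J_def S_def)
    obtain u where u: "u \<in> S" "u \<noteq> 0" unfolding S_def by (rule irreducible_nonzero[OF rl irr])
    obtain a where a: "a \<in> J" "ract (W l) a u = u"
      using ideal_orbit_irreducible[OF rl irr J[unfolded S_def] u[unfolded S_def] u(1)[unfolded S_def]] by blast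
    have Jl: "left_ideal n J" using J by (simp add: two_sided_ideal_def)
    have ag: "a \<in> galg n" using a by (simp add: J_def)
    obtain B where B: "is_basis S B" "finite B" unfolding S_def by (rule is_rep_basis[OF rl])
    obtain k where k: "k \<ge> 1" "trace_on S (ract (W l) a ^^ k) \<noteq> 0"
      using trace_on_power_nonzero[OF B ract_linear[OF rl ag, folded S_def] u a(2)] by blast
    define b where "b = gpow a (k - 1)"
    have b: "b \<in> J" unfolding b_def by (rule gpow_left_ideal[OF Jl a(1)])
    then have bA: "b \<in> A k" if "k \<in> X" for k using that by (simp add: J_def)
    have bg: "b \<in> galg n" using b by (simp add: J_def)
    have bV: "b \<in> ann n V (rep_space V)" using bA[OF X(2)] by (simp add: A_def)
    have bk: "b \<in> ann n (W k) (rep_space (W k))" if "k \<in> X" "k \<noteq> l" for k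
      using bA[OF that(1)] that(2) by (simp add: A_def)
    note zeroW = trace_ract_ann[OF W(1) bk] and zeroV = trace_ract_ann[OF V(1) bV]
    have "0 = (\<Sum>(c, g)\<leftarrow>b. c * trace_on (rep_space V) (rep_act V g))"
      using zeroV trace_ract[OF V(1) bg] by simp
    \<comment> \<open>The trace hypothesis speaks of group elements and is extended linearly to
      \<open>b\<close> here.\<close>
    also have "\<dots> = (\<Sum>(c, g)\<leftarrow>b. c * (\<Sum>k\<in>X. trace_on (rep_space (W k)) (rep_act (W k) g)))"
      using bg tr by (intro arg_cong[of _ _ sum_list] map_cong) (auto simp: galg_def)
    also have "\<dots> = (\<Sum>k\<in>X. \<Sum>(c, g)\<leftarrow>b. c * trace_on (rep_space (W k)) (rep_act (W k) g))"
      by (induction b) (auto simp: sum.distrib sum_distrib_left)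
    also have "\<dots> = (\<Sum>k\<in>X. trace_on (rep_space (W k)) (ract (W k) b))"
      using trace_ract[OF W(1) bg] by simp
    also have "\<dots> = trace_on S (ract (W l) b)"
      using zeroW X by (simp add: sum.remove[of X l] S_def)
    also have "\<dots> = trace_on S (ract (W l) a ^^ k)"
    proof (rule trace_on_cong[OF dual_basis_of_basis[OF B]])
      show "linear_map_on S S (ract (W l) b)" unfolding S_def by (rule ract_linear[OF rl bg])
      show "ract (W l) b v = (ract (W l) a ^^ k) v" if "v \<in> S" for v
        using ract_gpow[OF rl ag that[unfolded S_def], of "k - 1"] k(1) by (simp add: b_def)
    qed
    finally show False using k(2) by simp
  qed
  then show ?thesis using embedding_of_ann_le[OF V rl irr] that unfolding S_def by blast
qed

text \<open>The images of a basis of \<open>V\<close> stay independent and are as many as a basis of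
  \<open>W\<close>; a vector outside their span would give an independent set that is too
  large.\<close>

lemma injective_linear_map_onto:
  assumes b: "dual_basis V I e \<kappa>" and c: "dual_basis W J e' \<kappa>'" and card: "card I = card J"
    and f: "linear_map_on V W f" and inj: "inj_on f V"
  shows "f ` V = W"
proof
  show "f ` V \<subseteq> W" using linear_map_onD(1)[OF f] by blast
  note V = dual_basisD(2)[OF b] and W = dual_basisD(2)[OF c]
  have f0: "f 0 = 0" by (rule linear_map_on_0[OF f V])
  have inje: "inj_on (\<lambda>i. f (e i)) I"
    using comp_inj_on[OF dual_basis_inj[OF b], of f] inj_on_subset[OF inj, of "e ` I"] dual_basisD(3)[OF b]
    by (auto simp: comp_def)
  define B where "B = (\<lambda>i. f (e i)) ` I"
  have lin: "f (\<Sum>i\<in>I. fscale (d i) (e i)) = (\<Sum>i\<in>I. fscale (d i) (f (e i)))" for d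
  proof -
    have "f (\<Sum>i\<in>I. fscale (d i) (e i)) = (\<Sum>i\<in>I. f (fscale (d i) (e i)))"
      by (rule linear_map_on_sum[OF f V]) (use fs.subspace_scale[OF V dual_basisD(3)[OF b]] in auto)
    also have "\<dots> = (\<Sum>i\<in>I. fscale (d i) (f (e i)))"
      by (rule sum.cong[OF refl]) (use linear_map_onD(3)[OF f dual_basisD(3)[OF b]] in auto)
    finally show ?thesis .
  qed
  have ind: "fs.independent B"
  proof (rule fs.independent_if_scalars_zero)
    show "finite B" using dual_basisD(1)[OF b] by (simp add: B_def)
    fix d x assume *: "(\<Sum>x\<in>B. fscale (d x) x) = 0" and "x \<in> B"
    then obtain i where i: "i \<in> I" "x = f (e i)" by (auto simp: B_def)
    define v where "v = (\<Sum>i\<in>I. fscale (d (f (e i))) (e i))"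
    have v: "v \<in> V" unfolding v_def
      by (rule fs.subspace_sum[OF V]) (use fs.subspace_scale[OF V dual_basisD(3)[OF b]] in auto)
    have "f v = (\<Sum>x\<in>B. fscale (d x) x)"
      unfolding v_def lin B_def by (simp add: sum.reindex[OF inje])
    then have "f v = f 0" using * f0 by simp
    then have "v = 0" using inj v fs.subspace_0[OF V] by (auto simp: inj_on_def)
    then have "0 = \<kappa> i v" using dual_basis_functional_0[OF b i(1)] by simp
    also have "\<dots> = (\<Sum>j\<in>I. d (f (e j)) * \<kappa> i (e j))"
      unfolding v_def by (rule dual_basis_functional_lincomb[OF b i(1) dual_basisD(3)[OF b]])
    also have "\<dots> = (\<Sum>j\<in>I. if i = j then d (f (e j)) else 0)"
      using dual_basisD(6)[OF b i(1)] by (intro sum.cong) auto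
    also have "\<dots> = d x" using i dual_basisD(1)[OF b] by simp
    finally show "d x = 0" by simp
  qed
  have BW: "B \<subseteq> W" using linear_map_onD(1)[OF f dual_basisD(3)[OF b]] by (auto simp: B_def)
  have WB: "W \<subseteq> fs.span B"
  proof
    fix w assume w: "w \<in> W"
    show "w \<in> fs.span B"
    proof (rule ccontr)
      assume nw: "w \<notin> fs.span B"
      have "fs.independent (insert w B)" by (rule fs.independent_insertI[OF nw ind])
      moreover have "insert w B \<subseteq> fs.span (e' ` J)"
        using BW w dual_basis_is_basis[OF c] by (auto simp: is_basis_def)
      ultimately have "card (insert w B) \<le> card (e' ` J)"
        using fs.independent_span_bound[of "e' ` J" "insert w B"] dual_basisD(1)[OF c] by blast
      moreover have "card B = card J" unfolding B_def card_image[OF inje] by (rule card)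
      moreover have "w \<notin> B" using nw fs.span_base by blast
      moreover have "finite B" using dual_basisD(1)[OF b] by (simp add: B_def)
      ultimately show False using card_image[OF dual_basis_inj[OF c]] by simp
    qed
  qed
  have "fs.subspace (f ` V)" by (rule linear_map_image_subspace[OF f V])
  then have "fs.span B \<subseteq> f ` V" using dual_basisD(3)[OF b] by (intro fs.span_minimal) (auto simp: B_def)
  then show "W \<subseteq> f ` V" using WB by blast
qed

text \<open>The map built below goes from the direct sum to \<open>V\<close>, while the theorem asks
  for the other direction. Only the subspace property and stability are assumed of \<open>R\<close>,
  so that it applies to the direct sum directly.\<close>

lemma rep_iso_converse:
  assumes R: "fs.subspace (rep_space R)" and stable: "\<And>g v. g \<in> GL n \<Longrightarrow> v \<in> rep_space R \<Longrightarrow> rep_act R g v \<in> rep_space R"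
    and lin: "linear_map_on (rep_space R) (rep_space S) \<phi>" and bij: "bij_betw \<phi> (rep_space R) (rep_space S)"
    and eqv: "equivariant_on n (rep_space R) R S \<phi>"
  shows "rep_iso n S R"
proof -
  obtain \<psi> where \<psi>: "linear_map_on (rep_space S) (rep_space R) \<psi>" "bij_betw \<psi> (rep_space S) (rep_space R)"
    and \<phi>\<psi>: "\<And>w. w \<in> rep_space S \<Longrightarrow> \<phi> (\<psi> w) = w" and \<psi>\<phi>: "\<And>v. v \<in> rep_space R \<Longrightarrow> \<psi> (\<phi> v) = v"
    by (rule linear_bijection_inverse[OF R lin bij]) blast
  have "\<psi> (rep_act S g s) = rep_act R g (\<psi> s)" if g: "g \<in> GL n" and s: "s \<in> rep_space S" for g s
  proof -
    note \<psi>s = linear_map_onD(1)[OF \<psi>(1) s]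
    have "\<phi> (rep_act R g (\<psi> s)) = rep_act S g s"
      using eqv g \<psi>s \<phi>\<psi>[OF s] by (auto simp: equivariant_on_def)
    then show ?thesis using \<psi>\<phi>[OF stable[OF g \<psi>s]] by metis
  qed
  with \<psi> show ?thesis unfolding rep_iso_def by blast
qed

lemma equal_traces_of_rep_iso:
  assumes R: "is_rep n R" and S: "is_rep n S" and iso: "rep_iso n R S" and g: "g \<in> GL n"
  shows "trace_on (rep_space R) (rep_act R g) = trace_on (rep_space S) (rep_act S g)"
proof -
  obtain \<phi> where lin: "linear_map_on (rep_space R) (rep_space S) \<phi>" and bij: "bij_betw \<phi> (rep_space R) (rep_space S)"
    and eqv: "\<And>v. v \<in> rep_space R \<Longrightarrow> \<phi> (rep_act R g v) = rep_act S g (\<phi> v)"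
    using iso g by (auto simp: rep_iso_def)
  obtain \<psi> where \<psi>: "linear_map_on (rep_space S) (rep_space R) \<psi>"
    and \<phi>\<psi>: "\<And>w. w \<in> rep_space S \<Longrightarrow> \<phi> (\<psi> w) = w" and \<psi>\<phi>: "\<And>v. v \<in> rep_space R \<Longrightarrow> \<psi> (\<phi> v) = v"
    by (rule linear_bijection_inverse[OF is_repD(1)[OF R] lin bij]) blast
  obtain B where B: "is_basis (rep_space R) B" "finite B" by (rule is_rep_basis[OF R])
  obtain C where C: "is_basis (rep_space S) C" "finite C" by (rule is_rep_basis[OF S])
  note b = dual_basis_of_basis[OF B] and c = dual_basis_of_basis[OF C]
  note Rg = is_repD(2)[OF R g] and Sg = is_repD(2)[OF S g]
  have "trace_on (rep_space R) (rep_act R g) = trace_on (rep_space R) (\<lambda>v. \<psi> (rep_act S g (\<phi> v)))"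
    by (rule trace_on_cong[OF b Rg]) (simp add: \<psi>\<phi> linear_map_onD(1)[OF Rg] flip: eqv)
  also have "\<dots> = (\<Sum>v\<in>B. fs.representation B (\<psi> (rep_act S g (\<phi> v))) v)"
    by (rule trace_on_dual_basis[OF b linear_map_on_compose[OF lin linear_map_on_compose[OF Sg \<psi>]]])
  also have "\<dots> = (\<Sum>w\<in>C. fs.representation C (\<phi> (\<psi> (rep_act S g w))) w)"
    by (rule trace_dual_basis_comm[OF b c lin linear_map_on_compose[OF Sg \<psi>]])
  also have "\<dots> = (\<Sum>w\<in>C. fs.representation C (rep_act S g w) w)"
    by (rule sum.cong[OF refl]) (simp add: \<phi>\<psi> linear_map_onD(1)[OF Sg] dual_basisD(3)[OF c])
  also have "\<dots> = trace_on (rep_space S) (rep_act S g)"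
    by (rule trace_on_dual_basis[OF c Sg, symmetric])
  finally show ?thesis .
qed

text \<open>The indices outside \<open>X\<close> will be the partitions with too many parts, whose
  summands are zero by convention; a basis is collected from the summands over
  \<open>X\<close>.\<close>

lemma dual_basis_direct_sum:
  fixes W :: "'k \<Rightarrow> 'a rep"
  assumes X: "finite X" "X \<subseteq> I" and b: "\<And>k. k \<in> X \<Longrightarrow> dual_basis (rep_space (W k)) (J k) (e k) (\<kappa> k)"
    and zero: "\<And>k. k \<in> I - X \<Longrightarrow> rep_space (W k) = {0}"
  shows "dual_basis (rep_space (direct_sum_rep I W)) (Sigma X J)
    (\<lambda>(k, j) (k', a). if k' = k then e k j a else 0) (\<lambda>(k, j) f. \<kappa> k j (\<lambda>a. f (k, a)))"
    (is "dual_basis ?D _ ?e ?\<kappa>")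
proof -
  have D: "?D = {f. (\<forall>k\<in>X. (\<lambda>a. f (k, a)) \<in> rep_space (W k)) \<and> (\<forall>k a. k \<notin> X \<longrightarrow> f (k, a) = 0)}"
    unfolding direct_sum_rep_def rep.simps
  proof (rule Collect_cong, rule iffI)
    fix f assume *: "(\<forall>k\<in>I. (\<lambda>a. f (k, a)) \<in> rep_space (W k)) \<and> (\<forall>k a. k \<notin> I \<longrightarrow> f (k, a) = 0)"
    have "f (k, a) = 0" if "k \<in> I - X" for k a
    proof -
      have "(\<lambda>a. f (k, a)) = 0" using * zero[OF that] that by blast
      from fun_cong[OF this, of a] show ?thesis by simp
    qed
    then show "(\<forall>k\<in>X. (\<lambda>a. f (k, a)) \<in> rep_space (W k)) \<and> (\<forall>k a. k \<notin> X \<longrightarrow> f (k, a) = 0)"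
      using * X(2) by blast
  next
    fix f assume *: "(\<forall>k\<in>X. (\<lambda>a. f (k, a)) \<in> rep_space (W k)) \<and> (\<forall>k a. k \<notin> X \<longrightarrow> f (k, a) = 0)"
    have "(\<lambda>a. f (k, a)) \<in> rep_space (W k)" if "k \<in> I - X" for k
      unfolding zero[OF that] using * that by (auto simp: zero_fun_def)
    then show "(\<forall>k\<in>I. (\<lambda>a. f (k, a)) \<in> rep_space (W k)) \<and> (\<forall>k a. k \<notin> I \<longrightarrow> f (k, a) = 0)"
      using * X(2) by blast
  qed
  note sub = dual_basisD(2)[OF b]
  have "fs.subspace ?D"
    unfolding D
  proof (rule fs.subspaceI, goal_cases)
    case 1
    show ?case using fs.subspace_0[OF sub] by (auto simp: zero_fun_def)
  next
    case (2 f g)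
    then show ?case using fs.subspace_add[OF sub] by (fastforce simp: plus_fun_def)
  next
    case (3 c f)
    then show ?case using fs.subspace_scale[OF sub] by (fastforce simp: fscale_def)
  qed
  moreover have "?e p \<in> ?D" if "p \<in> Sigma X J" for p
  proof -
    obtain k j where p: "p = (k, j)" "k \<in> X" "j \<in> J k" using \<open>p \<in> Sigma X J\<close> by auto
    have "(\<lambda>a. if k' = k then e k j a else 0) \<in> rep_space (W k')" if "k' \<in> X" for k'
      using dual_basisD(3)[OF b p(3)] p(2) fs.subspace_0[OF sub[OF that]]
      by (cases "k' = k") (auto simp: zero_fun_def)
    then show ?thesis unfolding D using p by auto
  qed
  moreover have "(\<Sum>p\<in>Sigma X J. fscale (?\<kappa> p f) (?e p)) = f" if f: "f \<in> ?D" for f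
  proof (rule ext)
    fix q :: "'k \<times> 'a"
    obtain k a where q: "q = (k, a)" by (cases q)
    have fin: "finite (J k)" if "k \<in> X" for k using dual_basisD(1)[OF b[OF that]] .
    have "(\<Sum>p\<in>Sigma X J. fscale (?\<kappa> p f) (?e p)) q
        = (\<Sum>(k', j)\<in>Sigma X J. if k' = k then \<kappa> k j (\<lambda>a. f (k, a)) * e k j a else 0)"
      unfolding q by (simp add: sum_fun_apply fscale_def) (intro sum.cong, auto)
    also have "\<dots> = (\<Sum>k'\<in>X. \<Sum>j\<in>J k'. if k' = k then \<kappa> k j (\<lambda>a. f (k, a)) * e k j a else 0)"
      using X(1) fin by (subst sum.Sigma) auto
    also have "\<dots> = (\<Sum>k'\<in>X. if k' = k then \<Sum>j\<in>J k. \<kappa> k j (\<lambda>a. f (k, a)) * e k j a else 0)"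
      by (intro sum.cong) auto
    also have "\<dots> = (if k \<in> X then \<Sum>j\<in>J k. \<kappa> k j (\<lambda>a. f (k, a)) * e k j a else 0)"
      using X(1) by simp
    also have "\<dots> = f (k, a)"
    proof (cases "k \<in> X")
      case True
      then have "(\<Sum>j\<in>J k. fscale (\<kappa> k j (\<lambda>a. f (k, a))) (e k j)) = (\<lambda>a. f (k, a))"
        using dual_basisD(7)[OF b[OF True]] f unfolding D by blast
      from fun_cong[OF this, of a] True show ?thesis by (simp add: sum_fun_apply fscale_def)
    next
      case False
      then show ?thesis using f unfolding D by simp
    qed
    finally show "(\<Sum>p\<in>Sigma X J. fscale (?\<kappa> p f) (?e p)) q = f q" unfolding q .
  qed
  moreover have "?\<kappa> p (?e q) = (if p = q then 1 else 0)" if "p \<in> Sigma X J" "q \<in> Sigma X J" for p q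
    using that dual_basisD(6)[OF b] dual_basis_functional_0[OF b]
    by (cases "fst p = fst q") (auto simp: zero_fun_def split: if_splits)
  moreover have "?\<kappa> p (f + g) = ?\<kappa> p f + ?\<kappa> p g" if "p \<in> Sigma X J" "f \<in> ?D" "g \<in> ?D" for p f g
    using that dual_basisD(4)[OF b, of "fst p" "snd p" "\<lambda>a. f (fst p, a)" "\<lambda>a. g (fst p, a)"] unfolding D
    by (auto simp: plus_fun_def)
  moreover have "?\<kappa> p (fscale c f) = c * ?\<kappa> p f" if "p \<in> Sigma X J" "f \<in> ?D" for p c f
    using that dual_basisD(5)[OF b, of "fst p" "snd p" "\<lambda>a. f (fst p, a)"] unfolding D
    by (auto simp: fscale_def)
  ultimately show ?thesis
    unfolding dual_basis_def using X(1) dual_basisD(1)[OF b] by blast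
qed


lemma rep_act_direct_sum:
  "k \<in> I \<Longrightarrow> (\<lambda>a. rep_act (direct_sum_rep I W) g f (k, a)) = rep_act (W k) g (\<lambda>a. f (k, a))"
  by (simp add: direct_sum_rep_def)

text \<open>The surjective half of Schur's lemma: the image is a nonzero submodule of an irreducible
  representation.\<close>

lemma rep_iso_of_embedding:
  assumes R: "is_rep n R" and irrR: "is_irreducible n R" and S: "is_rep n S" and irrS: "is_irreducible n S"
    and lin: "linear_map_on (rep_space S) (rep_space R) \<phi>" and eqv: "equivariant_on n (rep_space S) S R \<phi>"
    and inj: "inj_on \<phi> (rep_space S)"
  shows "rep_iso n S R"
proof -
  have S0: "fs.subspace (rep_space S)" by (rule is_repD(1)[OF S])
  have "submodule n R (\<phi> ` rep_space S)"
    unfolding submodule_def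
  proof (intro conjI ballI)
    show "fs.subspace (\<phi> ` rep_space S)" by (rule linear_map_image_subspace[OF lin S0])
    show "\<phi> ` rep_space S \<subseteq> rep_space R" using linear_map_onD(1)[OF lin] by blast
    show "rep_act R g ` \<phi> ` rep_space S \<subseteq> \<phi> ` rep_space S" if g: "g \<in> GL n" for g
    proof clarify
      fix v assume v: "v \<in> rep_space S"
      have "rep_act R g (\<phi> v) = \<phi> (rep_act S g v)" using eqv g v by (simp add: equivariant_on_def)
      then show "rep_act R g (\<phi> v) \<in> \<phi> ` rep_space S" using linear_map_onD(1)[OF is_repD(2)[OF S g] v] by simp
    qed
  qed
  moreover have "\<phi> ` rep_space S \<noteq> {0}"
  proof
    assume *: "\<phi> ` rep_space S = {0}"
    obtain u where u: "u \<in> rep_space S" "u \<noteq> 0" by (rule irreducible_nonzero[OF S irrS])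
    have "\<phi> u = 0" using * u by blast
    then have "\<phi> u = \<phi> 0" using linear_map_on_0[OF lin S0] by simp
    then show False using inj u fs.subspace_0[OF S0] by (auto simp: inj_on_def)
  qed
  ultimately have "\<phi> ` rep_space S = rep_space R" using irreducibleD[OF irrR] by blast
  then show ?thesis using lin eqv inj unfolding rep_iso_def bij_betw_def equivariant_on_def by blast
qed

lemma ract_equivariant:
  assumes S: "is_rep n S" and lin: "linear_map_on (rep_space S) (rep_space R) \<phi>"
    and eqv: "equivariant_on n (rep_space S) S R \<phi>" and v: "v \<in> rep_space S"
  shows "a \<in> galg n \<Longrightarrow> \<phi> (ract S a v) = ract R a (\<phi> v)"
proof (induction a)
  case Nil
  then show ?case using linear_map_on_0[OF lin is_repD(1)[OF S]] by (simp del: zero_fun_apply)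
next
  case (Cons x a)
  obtain c g where x: "x = (c, g)" by (cases x)
  have g: "g \<in> GL n" and a: "a \<in> galg n" using Cons.prems x by auto
  note gv = linear_map_onD(1)[OF is_repD(2)[OF S g] v] and av = linear_map_onD(1)[OF ract_linear[OF S a] v]
  have "\<phi> (rep_act S g v) = rep_act R g (\<phi> v)" using eqv g v by (simp add: equivariant_on_def)
  then show ?case
    unfolding x ract_Cons linear_map_onD(2)[OF lin fs.subspace_scale[OF is_repD(1)[OF S] gv] av]
      linear_map_onD(3)[OF lin gv] Cons.IH[OF a] by simp
qed

lemma trace_one:
  assumes R: "is_rep n R" and E: "is_basis (rep_space R) E" "finite E"
  shows "trace_on (rep_space R) (rep_act R (1\<^sub>m n)) = of_nat (card E)"
proof -
  note e = dual_basis_of_basis[OF E]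
  have "trace_on (rep_space R) (rep_act R (1\<^sub>m n)) = trace_on (rep_space R) (\<lambda>v. v)"
    by (rule trace_on_cong[OF e is_repD(2)[OF R one_in_GL]]) (rule is_repD(3)[OF R])
  then show ?thesis using trace_on_id[OF e] dual_basis_dim[OF e] by simp
qed

text \<open>Each \<open>W l\<close> embeds into \<open>V\<close>, and the embeddings are added up to
  a map from the direct sum. Injectivity comes from separating the summands by the group algebra,
  surjectivity from equality of dimensions.\<close>

theorem rep_iso_direct_sum_of_traces:
  fixes V :: "'a rep" and W :: "'k \<Rightarrow> 'b rep"
  assumes V: "is_rep n V" "semisimple n V" and X: "finite X" "X \<subseteq> I"
    and W: "\<And>k. k \<in> X \<Longrightarrow> is_rep n (W k)" "\<And>k. k \<in> X \<Longrightarrow> is_irreducible n (W k)"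
    and zero: "\<And>k. k \<in> I - X \<Longrightarrow> rep_space (W k) = {0}" "\<And>k. k \<in> I - X \<Longrightarrow> is_rep n (W k)"
    and noniso: "\<And>k l. k \<in> X \<Longrightarrow> l \<in> X \<Longrightarrow> k \<noteq> l \<Longrightarrow> \<not> rep_iso n (W k) (W l)"
    and tr: "\<And>g. g \<in> GL n \<Longrightarrow> trace_on (rep_space V) (rep_act V g) = (\<Sum>k\<in>X. trace_on (rep_space (W k)) (rep_act (W k) g))"
  shows "rep_iso n V (direct_sum_rep I W)"
proof -
  define D where "D = direct_sum_rep I W"
  \<comment> \<open>An inclusion of annihilators would embed \<open>W l\<close> into
    \<open>W k\<close>, and between irreducible representations an embedding is an
    isomorphism.\<close>
  have ann: "\<not> ann n (W k) (rep_space (W k)) \<subseteq> ann n (W l) (rep_space (W l))"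
    if "k \<in> X" "l \<in> X" "k \<noteq> l" for k l
  proof
    assume "ann n (W k) (rep_space (W k)) \<subseteq> ann n (W l) (rep_space (W l))"
    from embedding_of_ann_le[OF W(1)[OF that(1)] irreducible_semisimple[OF W[OF that(1)]] W[OF that(2)] this]
      rep_iso_of_embedding[OF W[OF that(1)] W[OF that(2)]]
    have "rep_iso n (W l) (W k)" by blast
    with noniso[of l k] that show False by auto
  qed
  have "\<exists>\<phi>. \<forall>l\<in>X. linear_map_on (rep_space (W l)) (rep_space V) (\<phi> l) \<and>
      equivariant_on n (rep_space (W l)) (W l) V (\<phi> l) \<and> inj_on (\<phi> l) (rep_space (W l))"
  proof (intro bchoice ballI)
    fix l assume l: "l \<in> X"
    from embedding_of_traces[OF V X(1) l W ann[OF _ l] tr]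
    show "\<exists>\<phi>. linear_map_on (rep_space (W l)) (rep_space V) \<phi> \<and>
      equivariant_on n (rep_space (W l)) (W l) V \<phi> \<and> inj_on \<phi> (rep_space (W l))" by blast
  qed
  then obtain \<phi> where lin: "\<And>l. l \<in> X \<Longrightarrow> linear_map_on (rep_space (W l)) (rep_space V) (\<phi> l)"
    and eqv: "\<And>l. l \<in> X \<Longrightarrow> equivariant_on n (rep_space (W l)) (W l) V (\<phi> l)"
    and inj: "\<And>l. l \<in> X \<Longrightarrow> inj_on (\<phi> l) (rep_space (W l))" by blast
  define \<Phi> where "\<Phi> f = (\<Sum>l\<in>X. \<phi> l (\<lambda>a. f (l, a)))" for f
  note V0 = is_repD(1)[OF V(1)]
  have comp: "(\<lambda>a. f (l, a)) \<in> rep_space (W l)" if "f \<in> rep_space D" "l \<in> X" for f l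
    using that X(2) by (auto simp: D_def direct_sum_rep_def)
  have \<Phi>lin: "linear_map_on (rep_space D) (rep_space V) \<Phi>"
    unfolding linear_map_on_def
  proof (intro conjI ballI allI)
    fix f g c assume f: "f \<in> rep_space D"
    show "\<Phi> f \<in> rep_space V" unfolding \<Phi>_def
      by (intro fs.subspace_sum[OF V0] linear_map_onD(1)[OF lin] comp f)
    have "\<phi> l (\<lambda>a. fscale c f (l, a)) = fscale c (\<phi> l (\<lambda>a. f (l, a)))" if l: "l \<in> X" for l
      using linear_map_onD(3)[OF lin[OF l] comp[OF f l]] by (simp add: fscale_def)
    then show "\<Phi> (fscale c f) = fscale c (\<Phi> f)" by (simp add: \<Phi>_def fs.scale_sum_right)
    assume g: "g \<in> rep_space D"
    have "\<phi> l (\<lambda>a. (f + g) (l, a)) = \<phi> l (\<lambda>a. f (l, a)) + \<phi> l (\<lambda>a. g (l, a))" if l: "l \<in> X" for l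
      using linear_map_onD(2)[OF lin[OF l] comp[OF f l] comp[OF g l]] by (simp add: plus_fun_def)
    then have "\<Phi> (f + g) = (\<Sum>l\<in>X. \<phi> l (\<lambda>a. f (l, a)) + \<phi> l (\<lambda>a. g (l, a)))"
      unfolding \<Phi>_def by (intro sum.cong) auto
    then show "\<Phi> (f + g) = \<Phi> f + \<Phi> g" unfolding \<Phi>_def sum.distrib .
  qed
  have \<Phi>eqv: "equivariant_on n (rep_space D) D V \<Phi>"
    unfolding equivariant_on_def
  proof (intro ballI)
    fix g f assume g: "g \<in> GL n" and f: "f \<in> rep_space D"
    have "\<phi> l (\<lambda>a. rep_act D g f (l, a)) = rep_act V g (\<phi> l (\<lambda>a. f (l, a)))" if l: "l \<in> X" for l
    proof -
      have "(\<lambda>a. rep_act D g f (l, a)) = rep_act (W l) g (\<lambda>a. f (l, a))"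
        unfolding D_def using l X(2) by (intro rep_act_direct_sum) auto
      then show ?thesis using eqv[OF l] g comp[OF f l] by (simp add: equivariant_on_def)
    qed
    then have "\<Phi> (rep_act D g f) = (\<Sum>l\<in>X. rep_act V g (\<phi> l (\<lambda>a. f (l, a))))"
      unfolding \<Phi>_def by (intro sum.cong) auto
    also have "\<dots> = rep_act V g (\<Phi> f)"
      unfolding \<Phi>_def
      by (rule linear_map_on_sum[OF is_repD(2)[OF V(1) g] V0, symmetric])
        (intro linear_map_onD(1)[OF lin] comp f)
    finally show "\<Phi> (rep_act D g f) = rep_act V g (\<Phi> f)" .
  qed
  have "\<exists>B. \<forall>k\<in>X. is_basis (rep_space (W k)) (B k) \<and> finite (B k)"
    by (intro bchoice ballI) (metis is_rep_basis W(1))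
  then obtain B where B: "\<And>k. k \<in> X \<Longrightarrow> is_basis (rep_space (W k)) (B k)" "\<And>k. k \<in> X \<Longrightarrow> finite (B k)" by blast
  note bW = dual_basis_of_basis[OF B]
  have bD: "dual_basis (rep_space D) (Sigma X B) (\<lambda>(k, j) (k', a). if k' = k then j a else 0)
      (\<lambda>(k, j) f. fs.representation (B k) (\<lambda>a. f (k, a)) j)"
    unfolding D_def
    by (rule dual_basis_direct_sum[where W = W and e = "\<lambda>k j. j" and \<kappa> = "\<lambda>k j v. fs.representation (B k) v j"])
      (use X bW zero(1) in auto)
  have D0: "fs.subspace (rep_space D)" by (rule dual_basisD(2)[OF bD])
  have kernel: "f = 0" if f: "f \<in> rep_space D" and \<Phi>f: "\<Phi> f = 0" for f
  proof -
    have "f (k, a) = 0" for k a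
    proof (cases "k \<in> X")
      case False
      then show ?thesis
      proof (cases "k \<in> I")
        case True
        then have "(\<lambda>a. f (k, a)) = 0" using f zero(1)[of k] False by (auto simp: D_def direct_sum_rep_def)
        from fun_cong[OF this, of a] show ?thesis by simp
      qed (use f in \<open>simp add: D_def direct_sum_rep_def\<close>)
    next
      case k: True
      define w where "w = (\<lambda>a. f (k, a))"
      have w: "w \<in> rep_space (W k)" unfolding w_def by (rule comp[OF f k])
      have "w = 0"
      proof (rule ccontr)
        assume "w \<noteq> 0"
        \<comment> \<open>Some \<open>b\<close> in this ideal fixes the component \<open>w\<close>
          and kills all other summands, so applying \<open>b\<close> to the relation
          \<open>\<Phi> f = 0\<close> leaves only \<open>\<phi> k w\<close>.\<close>
        define J where "J = galg n \<inter> (\<Inter>l\<in>X - {k}. ann n (W l) (rep_space (W l)))"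
        have "two_sided_ideal n (ann n (W l) (rep_space (W l))) \<and>
            \<not> ann n (W l) (rep_space (W l)) \<subseteq> ann n (W k) (rep_space (W k))" if "l \<in> X - {k}" for l
          using ann[of l k] ideal_ann[OF W(1)[of l]] that k by auto
        then have J: "two_sided_ideal n J" "\<not> J \<subseteq> ann n (W k) (rep_space (W k))"
          using ideal_INT_not_killing[OF W[OF k], of "X - {k}" "\<lambda>l. ann n (W l) (rep_space (W l))"] X(1)
          by (simp_all add: J_def)
        obtain b where b: "b \<in> J" "ract (W k) b w = w"
          by (rule ideal_orbit_irreducible[OF W[OF k] J w \<open>w \<noteq> 0\<close> w])
        have bg: "b \<in> galg n" using b by (simp add: J_def)
        have "0 = ract V b (\<Phi> f)" unfolding \<Phi>f by (rule linear_map_on_0[OF ract_linear[OF V(1) bg] V0, symmetric])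
        also have "\<dots> = (\<Sum>l\<in>X. ract V b (\<phi> l (\<lambda>a. f (l, a))))"
          unfolding \<Phi>_def by (rule linear_map_on_sum[OF ract_linear[OF V(1) bg] V0]) (intro linear_map_onD(1)[OF lin] comp f)
        also have "\<dots> = (\<Sum>l\<in>X. \<phi> l (ract (W l) b (\<lambda>a. f (l, a))))"
          using ract_equivariant[OF W(1) lin eqv comp[OF f] bg] by (intro sum.cong) auto
        also have "\<dots> = (\<Sum>l\<in>X. if l = k then \<phi> k w else 0)"
        proof (rule sum.cong[OF refl])
          fix l assume l: "l \<in> X"
          show "\<phi> l (ract (W l) b (\<lambda>a. f (l, a))) = (if l = k then \<phi> k w else 0)"
          proof (cases "l = k")
            case True
            then show ?thesis using b(2) by (simp add: w_def)
          next
            case False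
            then have "b \<in> ann n (W l) (rep_space (W l))" using b(1) l by (simp add: J_def)
            then have "ract (W l) b (\<lambda>a. f (l, a)) = 0" using comp[OF f l] by (simp add: ann_def)
            then show ?thesis using False linear_map_on_0[OF lin[OF l] is_repD(1)[OF W(1)[OF l]]] by simp
          qed
        qed
        also have "\<dots> = \<phi> k w" using X(1) k by simp
        finally have "\<phi> k w = \<phi> k 0" using linear_map_on_0[OF lin[OF k] is_repD(1)[OF W(1)[OF k]]] by simp
        then show False using inj[OF k] w fs.subspace_0[OF is_repD(1)[OF W(1)[OF k]]] \<open>w \<noteq> 0\<close>
          by (auto simp: inj_on_def)
      qed
      from fun_cong[OF this, of a] show ?thesis by (simp add: w_def)
    qed
    then show "f = 0" by (auto simp: fun_eq_iff)
  qed
  have \<Phi>inj: "inj_on \<Phi> (rep_space D)"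
  proof (rule inj_onI)
    fix f g assume f: "f \<in> rep_space D" and g: "g \<in> rep_space D" and "\<Phi> f = \<Phi> g"
    then have "\<Phi> (f - g) = 0" using linear_map_on_diff[OF \<Phi>lin D0 f g] by simp
    from kernel[OF fs.subspace_diff[OF D0 f g] this] show "f = g" by simp
  qed
  obtain C where C: "is_basis (rep_space V) C" "finite C" by (rule is_rep_basis[OF V(1)])
  note bV = dual_basis_of_basis[OF C]
  \<comment> \<open>The trace hypothesis at the identity matrix is an equality of
    dimensions.\<close>
  have "of_nat (card C) = (\<Sum>k\<in>X. of_nat (card (B k)) :: complex)"
    using tr[OF one_in_GL] by (simp add: trace_one[OF V(1) C] trace_one[OF W(1) B])
  then have "card C = card (Sigma X B)"
    using X(1) B(2) by (simp add: card_SigmaI flip: of_nat_sum)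
  then have "\<Phi> ` rep_space D = rep_space V"
    using injective_linear_map_onto[OF bD bV _ \<Phi>lin \<Phi>inj] by simp
  then have bij: "bij_betw \<Phi> (rep_space D) (rep_space V)" using \<Phi>inj by (simp add: bij_betw_def)
  have stable: "rep_act D g f \<in> rep_space D" if g: "g \<in> GL n" and f: "f \<in> rep_space D" for g f
  proof -
    have rW: "is_rep n (W k)" if "k \<in> I" for k using W(1) zero(2) that by blast
    have "(\<lambda>a. rep_act D g f (k, a)) \<in> rep_space (W k)" if k: "k \<in> I" for k
    proof -
      have "(\<lambda>a. f (k, a)) \<in> rep_space (W k)" using f k by (simp add: D_def direct_sum_rep_def)
      from linear_map_onD(1)[OF is_repD(2)[OF rW[OF k] g] this] show ?thesis
        unfolding D_def rep_act_direct_sum[OF k] .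
    qed
    moreover have "rep_act D g f (k, a) = 0" if "k \<notin> I" for k a using that by (simp add: D_def direct_sum_rep_def)
    ultimately show ?thesis unfolding D_def direct_sum_rep_def by simp
  qed
  show ?thesis using rep_iso_converse[OF D0 stable \<Phi>lin bij \<Phi>eqv] by (simp add: D_def)
qed

section \<open>Representations with a unitary structure\<close>

definition adj :: "nat \<Rightarrow> complex mat \<Rightarrow> complex mat" where
  "adj n g = mat n n (\<lambda>(i, j). cnj (g $$ (j, i)))"

lemma adj_mult:
  assumes "g \<in> carrier_mat n n" "h \<in> carrier_mat n n"
  shows "adj n (g * h) = adj n h * adj n g"
  using assms by (intro eq_matI) (auto simp: adj_def scalar_prod_def mult.commute intro!: sum.cong)

lemma adj_GL: "g \<in> GL n \<Longrightarrow> adj n g \<in> GL n"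
proof -
  assume "g \<in> GL n"
  then obtain h where h: "g \<in> carrier_mat n n" "h \<in> carrier_mat n n" "g * h = 1\<^sub>m n" "h * g = 1\<^sub>m n"
    by (auto simp: GL_iff)
  have 1: "adj n (1\<^sub>m n) = 1\<^sub>m n" by (intro eq_matI) (auto simp: adj_def)
  have "adj n h * adj n g = 1\<^sub>m n" "adj n g * adj n h = 1\<^sub>m n"
    using adj_mult[of g n h] adj_mult[of h n g] h 1 by auto
  then show ?thesis unfolding GL_iff by (intro conjI bexI[of _ "adj n h"]) (auto simp: adj_def)
qed

text \<open>The basis \<open>e\<close> with coordinates \<open>\<kappa>\<close> is orthonormal for a form with \<open>\<langle>g u, v\<rangle> = \<langle>u, g\<^sup>* v\<rangle>\<close>, and
  consists of weight vectors with weights \<open>w\<close>.\<close>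

definition unitary_basis ::
  "nat \<Rightarrow> 'a rep \<Rightarrow> 'i set \<Rightarrow> ('i \<Rightarrow> 'a \<Rightarrow> complex) \<Rightarrow> ('i \<Rightarrow> ('a \<Rightarrow> complex) \<Rightarrow> complex) \<Rightarrow> ('i \<Rightarrow> (nat \<Rightarrow> complex) \<Rightarrow> complex) \<Rightarrow> bool"
  where
  "unitary_basis n R I e \<kappa> w \<longleftrightarrow> is_rep n R \<and> dual_basis (rep_space R) I e \<kappa> \<and>
     (\<forall>i\<in>I. \<forall>j\<in>I. \<exists>p. polynomial_in_entries n p \<and> (\<forall>g\<in>GL n. \<kappa> i (rep_act R g (e j)) = p g)) \<and>
     (\<forall>g\<in>GL n. \<forall>i\<in>I. \<forall>j\<in>I. \<kappa> i (rep_act R (adj n g) (e j)) = cnj (\<kappa> j (rep_act R g (e i)))) \<and>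
     (\<forall>y. (\<forall>k<n. y k \<noteq> 0) \<longrightarrow>
       (\<forall>i\<in>I. \<forall>j\<in>I. \<kappa> i (rep_act R (mat_diag n y) (e j)) = (if i = j then w i y else 0)))"

lemma unitary_basisD:
  assumes "unitary_basis n R I e \<kappa> w"
  shows "is_rep n R" "dual_basis (rep_space R) I e \<kappa>"
    "\<And>i j. i \<in> I \<Longrightarrow> j \<in> I \<Longrightarrow> \<exists>p. polynomial_in_entries n p \<and> (\<forall>g\<in>GL n. \<kappa> i (rep_act R g (e j)) = p g)"
    "\<And>g i j. g \<in> GL n \<Longrightarrow> i \<in> I \<Longrightarrow> j \<in> I \<Longrightarrow> \<kappa> i (rep_act R (adj n g) (e j)) = cnj (\<kappa> j (rep_act R g (e i)))"
    "\<And>y i j. (\<And>k. k < n \<Longrightarrow> y k \<noteq> 0) \<Longrightarrow> i \<in> I \<Longrightarrow> j \<in> I \<Longrightarrow>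
       \<kappa> i (rep_act R (mat_diag n y) (e j)) = (if i = j then w i y else 0)"
  using assms by (simp_all add: unitary_basis_def)

lemma mat_diag_GL:
  assumes "\<And>k. k < n \<Longrightarrow> (y k :: complex) \<noteq> 0"
  shows "mat_diag n y \<in> GL n"
proof -
  have "mat_diag n y * mat_diag n (\<lambda>k. inverse (y k)) = 1\<^sub>m n" "mat_diag n (\<lambda>k. inverse (y k)) * mat_diag n y = 1\<^sub>m n"
    using assms by (simp_all, auto simp: mat_diag_def intro!: eq_matI)
  then show ?thesis unfolding GL_iff by (intro conjI bexI[of _ "mat_diag n (\<lambda>k. inverse (y k))"]) auto
qed

lemma unitary_basis_trace:
  assumes u: "unitary_basis n R I e \<kappa> w" and y: "\<And>k. k < n \<Longrightarrow> y k \<noteq> 0"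
  shows "trace_on (rep_space R) (rep_act R (mat_diag n y)) = (\<Sum>i\<in>I. w i y)"
proof -
  have g: "mat_diag n y \<in> GL n" using mat_diag_GL y by blast
  show ?thesis
    unfolding trace_on_dual_basis[OF unitary_basisD(2)[OF u] is_repD(2)[OF unitary_basisD(1)[OF u] g]]
    by (rule sum.cong[OF refl]) (simp add: unitary_basisD(5)[OF u y])
qed

lemma unitary_basis_reindex:
  assumes u: "unitary_basis n R I e \<kappa> w" and h: "bij_betw h J I"
  shows "unitary_basis n R J (e \<circ> h) (\<kappa> \<circ> h) (w \<circ> h)"
proof -
  have 1: "h j \<in> I" if "j \<in> J" for j using h that by (auto simp: bij_betw_def)
  have 2: "h i = h j \<longleftrightarrow> i = j" if "i \<in> J" "j \<in> J" for i j
    using h that by (auto simp: bij_betw_def inj_on_def)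
  show ?thesis unfolding unitary_basis_def
  proof (intro conjI ballI allI impI)
    show "is_rep n R" by (rule unitary_basisD(1)[OF u])
    show "dual_basis (rep_space R) J (e \<circ> h) (\<kappa> \<circ> h)" by (rule dual_basis_reindex[OF unitary_basisD(2)[OF u] h])
  qed (use 1 2 unitary_basisD(3-5)[OF u] in \<open>simp_all\<close>)
qed

text \<open>The complement of \<open>K\<close> in \<open>M\<close> is its orthogonal complement for
  the form \<open>H\<close> that makes \<open>e\<close> orthonormal; it is stable under
  \<open>g\<close> because \<open>adj n g\<close> is again invertible and preserves
  \<open>K\<close>.\<close>

lemma unitary_basis_semisimple:
  assumes u: "unitary_basis n R I e \<kappa> w"
  shows "semisimple n R"
proof -
  define V where "V = rep_space R"
  note R = unitary_basisD(1)[OF u] and b = unitary_basisD(2)[OF u, folded V_def]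
  note V = dual_basisD(2)[OF b] and fin = dual_basisD(1)[OF b]
  define H where "H x y = (\<Sum>i\<in>I. \<kappa> i x * cnj (\<kappa> i y))" for x y
  have H_add: "H (x + x') y = H x y + H x' y" if "x \<in> V" "x' \<in> V" for x x' y
    using dual_basisD(4)[OF b _ that] by (simp add: H_def sum.distrib distrib_right)
  have H_scale: "H (fscale c x) y = c * H x y" if "x \<in> V" for c x y
    using dual_basisD(5)[OF b _ that] by (simp add: H_def sum_distrib_left mult.assoc)
  have H_cnj: "H y x = cnj (H x y)" for x y
    by (simp add: H_def mult.commute)
  have H_diff: "H (x - x') y = H x y - H x' y" if x: "x \<in> V" "x' \<in> V" for x x' y
    using H_add[OF x(1) fs.subspace_scale[OF V x(2), of "-1"], of y] H_scale[OF x(2), of "-1" y] by simp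
  have H_pos: "x = 0" if x: "x \<in> V" and "H x x = 0" for x
  proof -
    have "H x x = of_real (\<Sum>i\<in>I. (cmod (\<kappa> i x))\<^sup>2)"
      unfolding H_def of_real_sum by (intro sum.cong refl complex_norm_square[symmetric])
    then have "(\<Sum>i\<in>I. (cmod (\<kappa> i x))\<^sup>2) = 0" using \<open>H x x = 0\<close> by (metis of_real_eq_0_iff)
    then have "\<kappa> i x = 0" if "i \<in> I" for i
      using sum_nonneg_eq_0_iff[OF fin, of "\<lambda>i. (cmod (\<kappa> i x))\<^sup>2"] that by simp
    then show ?thesis
      using dual_basis_eqI[OF b x fs.subspace_0[OF V]] dual_basis_functional_0[OF b] by simp
  qed
  have H_adj: "H (rep_act R g x) y = H x (rep_act R (adj n g) y)"
    if g: "g \<in> GL n" and x: "x \<in> V" and y: "y \<in> V" for g x y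
  proof -
    note lg = is_repD(2)[OF R g, folded V_def] and la = is_repD(2)[OF R adj_GL[OF g], folded V_def]
    have "H (rep_act R g x) y = (\<Sum>i\<in>I. \<Sum>j\<in>I. \<kappa> j x * \<kappa> i (rep_act R g (e j)) * cnj (\<kappa> i y))"
      unfolding H_def by (intro sum.cong refl) (simp add: functional_of_image[OF b b lg x] sum_distrib_right)
    also have "\<dots> = (\<Sum>j\<in>I. \<Sum>i\<in>I. \<kappa> j x * \<kappa> i (rep_act R g (e j)) * cnj (\<kappa> i y))"
      by (rule sum.swap)
    also have "\<dots> = (\<Sum>j\<in>I. \<kappa> j x * cnj (\<kappa> j (rep_act R (adj n g) y)))"
      by (intro sum.cong refl)
        (simp add: functional_of_image[OF b b la y] unitary_basisD(4)[OF u g] sum_distrib_left mult_ac)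
    finally show ?thesis by (simp add: H_def)
  qed
  \<comment> \<open>Orthogonal projection onto the span of a finite set, by induction in the manner
    of Gram and Schmidt.\<close>
  have proj: "\<forall>m\<in>V. \<exists>k\<in>fs.span B. \<forall>b\<in>B. H (m - k) b = 0" if "finite B" "B \<subseteq> V" for B
    using that
  proof (induction B rule: finite_induct)
    case empty
    then show ?case by (auto intro: fs.span_zero)
  next
    case (insert x B)
    have x: "x \<in> V" and BV: "B \<subseteq> V" using insert.prems by auto
    have span: "fs.span B \<subseteq> V" by (rule fs.span_minimal[OF BV V])
    have sub: "fs.span B \<subseteq> fs.span (insert x B)" by (rule fs.span_mono) auto
    have perp: "H z k = 0" if z: "z \<in> V" "\<forall>b\<in>B. H z b = 0" and "k \<in> fs.span B" for z k
    proof -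
      have "fs.subspace {k \<in> V. H k z = 0}"
        by (rule fs.subspaceI)
          (auto simp: fs.subspace_0[OF V] fs.subspace_add[OF V] fs.subspace_scale[OF V] H_add H_scale
            dual_basis_functional_0[OF b] H_def[of 0])
      then have "fs.span B \<subseteq> {k \<in> V. H k z = 0}"
        using z(2) BV H_cnj[of _ z] by (intro fs.span_minimal) auto
      then show ?thesis using \<open>k \<in> fs.span B\<close> H_cnj[of z k] by auto
    qed
    obtain p where p: "p \<in> fs.span B" "\<forall>b\<in>B. H (x - p) b = 0" using insert.IH[OF BV] x by blast
    define z where "z = x - p"
    have pV: "p \<in> V" using p span by blast
    have z: "z \<in> V" unfolding z_def by (rule fs.subspace_diff[OF V x pV])
    have zs: "z \<in> fs.span (insert x B)" unfolding z_def
      using p(1) sub by (intro fs.span_diff) (auto intro: fs.span_base)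
    show ?case
    proof
      fix m assume m: "m \<in> V"
      obtain q where q: "q \<in> fs.span B" "\<forall>b\<in>B. H (m - q) b = 0" using insert.IH[OF BV] m by blast
      have qV: "q \<in> V" using q span by blast
      \<comment> \<open>\<open>H z z = 0\<close> forces \<open>z = 0\<close>, which is the case of
        \<open>x\<close> lying in the span of \<open>B\<close> already; the coefficient 0 then works
        too.\<close>
      define c where "c = (if H z z = 0 then 0 else H m z / H z z)"
      define k where "k = q + fscale c z"
      have cz: "fscale c z \<in> V" by (rule fs.subspace_scale[OF V z])
      have mq: "m - q \<in> V" by (rule fs.subspace_diff[OF V m qV])
      have eq: "H (m - k) y = H (m - q) y - c * H z y" for y
      proof -
        have *: "m - k = (m - q) - fscale c z" by (simp add: k_def diff_diff_eq)
        show ?thesis unfolding * H_diff[OF mq cz] H_scale[OF z] ..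
      qed
      have kB: "H (m - k) b = 0" if "b \<in> B" for b
        unfolding eq using q(2) p(2) that by (simp add: z_def)
      have mk: "m - k \<in> V" unfolding k_def using m qV cz by (intro fs.subspace_diff[OF V] fs.subspace_add[OF V])
      have "H q z = 0" using perp[OF z _ q(1)] p(2) H_cnj[of q z] by (simp add: z_def)
      then have kz: "H (m - k) z = 0"
        unfolding eq H_diff[OF m qV] using H_pos[OF z] by (auto simp: c_def H_def dual_basis_functional_0[OF b])
      have "x = z + p" by (simp add: z_def)
      then have "H (m - k) x = cnj (H z (m - k) + H p (m - k))" using H_cnj[of "m - k" x] H_add[OF z pV] by simp
      also have "\<dots> = H (m - k) z + H (m - k) p" using H_cnj[of "m - k"] by simp
      also have "\<dots> = 0" using kz perp[OF mk _ p(1)] kB by simp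
      finally have "\<forall>b\<in>insert x B. H (m - k) b = 0" using kB by simp
      moreover have "k \<in> fs.span (insert x B)" unfolding k_def
        using q(1) sub zs by (intro fs.span_add fs.span_scale) auto
      ultimately show "\<exists>k\<in>fs.span (insert x B). \<forall>b\<in>insert x B. H (m - k) b = 0" by blast
    qed
  qed
  show ?thesis
    unfolding semisimple_def
  proof (intro allI impI)
    fix K M assume K: "submodule n R K" and M: "submodule n R M" and KM: "K \<subseteq> M"
    have sK: "fs.subspace K" and KV: "K \<subseteq> V" and sM: "fs.subspace M" and MV: "M \<subseteq> V"
      using K M by (auto simp: submodule_def V_def)
    define N where "N = {m \<in> M. \<forall>k\<in>K. H m k = 0}"
    have "fs.subspace N" unfolding N_def
      by (rule fs.subspaceI)
        (use MV in \<open>auto simp: fs.subspace_0[OF sM] fs.subspace_add[OF sM] fs.subspace_scale[OF sM] H_add H_scale subset_eq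
            dual_basis_functional_0[OF b] H_def[of 0]\<close>)
    moreover have "rep_act R g m \<in> N" if g: "g \<in> GL n" and m: "m \<in> N" for g m
    proof -
      have "rep_act R g m \<in> M" using M g m unfolding N_def submodule_def by blast
      moreover have "H (rep_act R g m) k = 0" if k: "k \<in> K" for k
      proof -
        have "rep_act R (adj n g) k \<in> K" using K adj_GL[OF g] k by (auto simp: submodule_def)
        then show ?thesis using H_adj[OF g, of m k] m k MV KV by (auto simp: N_def)
      qed
      ultimately show ?thesis by (simp add: N_def)
    qed
    ultimately have "submodule n R N" using M by (auto simp: submodule_def N_def)
    moreover have "N \<subseteq> M" by (auto simp: N_def)
    moreover have "K \<inter> N = {0}"
      using H_pos KV fs.subspace_0[OF sK] fs.subspace_0[OF \<open>fs.subspace N\<close>] by (auto simp: N_def)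
    moreover have "\<exists>k\<in>K. \<exists>l\<in>N. m = k + l" if m: "m \<in> M" for m
    proof -
      \<comment> \<open>\<open>proj\<close> handles spans of finite sets, so \<open>K\<close> is
        presented as such a span.\<close>
      obtain B where B: "B \<subseteq> K" "fs.independent B" "K \<subseteq> fs.span B"
        by (rule fs.maximal_independent_subset)
      have "finite B"
        using fs.independent_span_bound[of "e ` I" B] B(1,2) KV fin dual_basis_is_basis[OF b]
        by (auto simp: is_basis_def)
      moreover have "B \<subseteq> V" using B KV by blast
      ultimately obtain k where k: "k \<in> fs.span B" "\<forall>b\<in>B. H (m - k) b = 0" using proj m MV by blast
      have kK: "k \<in> K" using k(1) fs.span_minimal[OF B(1) sK] by blast
      have mk: "m - k \<in> M" using fs.subspace_diff[OF sM m] kK KM by blast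
      have "fs.subspace {x \<in> V. H x (m - k) = 0}"
        by (rule fs.subspaceI)
          (auto simp: fs.subspace_0[OF V] fs.subspace_add[OF V] fs.subspace_scale[OF V] H_add H_scale
            dual_basis_functional_0[OF b] H_def[of 0])
      then have "fs.span B \<subseteq> {x \<in> V. H x (m - k) = 0}"
        using k(2) \<open>B \<subseteq> V\<close> H_cnj[of _ "m - k"] by (intro fs.span_minimal) auto
      then have "H (m - k) x = 0" if "x \<in> K" for x using that B(3) H_cnj[of "m - k" x] by auto
      then have "m - k \<in> N" using mk by (simp add: N_def)
      then show ?thesis using kK by (intro bexI[of _ k] bexI[of _ "m - k"]) auto
    qed
    ultimately show "\<exists>N. submodule n R N \<and> N \<subseteq> M \<and> K \<inter> N = {0} \<and> (\<forall>m\<in>M. \<exists>k\<in>K. \<exists>l\<in>N. m = k + l)" by blast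
  qed
qed

section \<open>Bases of exterior and symmetric powers\<close>

lemma vectorsD: "vs \<in> vectors V k \<Longrightarrow> length vs = k" "vs \<in> vectors V k \<Longrightarrow> i < k \<Longrightarrow> vs ! i \<in> V"
  by (auto simp: vectors_def)

lemma vectors_update: "vs \<in> vectors V k \<Longrightarrow> u \<in> V \<Longrightarrow> vs[i := u] \<in> vectors V k"
  using set_update_subset_insert[of vs i u] by (auto simp: vectors_def)

lemma vectors_map: "vs \<in> vectors V k \<Longrightarrow> (\<And>v. v \<in> V \<Longrightarrow> f v \<in> W) \<Longrightarrow> map f vs \<in> vectors W k"
  by (auto simp: vectors_def)

lemma multilinear_formD:
  assumes "multilinear_form V k \<omega>" "vs \<in> vectors V k" "i < k"
  shows "\<And>u v. u \<in> V \<Longrightarrow> v \<in> V \<Longrightarrow> \<omega> (vs[i := u + v]) = \<omega> (vs[i := u]) + \<omega> (vs[i := v])"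
    "\<And>c u. u \<in> V \<Longrightarrow> \<omega> (vs[i := fscale c u]) = c * \<omega> (vs[i := u])"
  using assms unfolding multilinear_form_def by blast+

lemma multilinear_form_zero:
  assumes "multilinear_form V k \<omega>" "vs \<in> vectors V k" "i < k" "fs.subspace V"
  shows "\<omega> (vs[i := 0]) = 0"
  using multilinear_formD(2)[OF assms(1-3) fs.subspace_0[OF assms(4)], of 0] by simp

lemma multilinear_form_sum:
  assumes m: "multilinear_form V k \<omega>" "vs \<in> vectors V k" "i < k" and V: "fs.subspace V"
  shows "(\<And>j. j \<in> J \<Longrightarrow> v j \<in> V) \<Longrightarrow> \<omega> (vs[i := (\<Sum>j\<in>J. v j)]) = (\<Sum>j\<in>J. \<omega> (vs[i := v j]))"
proof (induction J rule: infinite_finite_induct)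
  case (insert j J)
  have "\<omega> (vs[i := v j + (\<Sum>j\<in>J. v j)]) = \<omega> (vs[i := v j]) + \<omega> (vs[i := (\<Sum>j\<in>J. v j)])"
    by (rule multilinear_formD(1)[OF m]) (use insert.prems in \<open>auto intro: fs.subspace_sum[OF V]\<close>)
  also have "\<omega> (vs[i := (\<Sum>j\<in>J. v j)]) = (\<Sum>j\<in>J. \<omega> (vs[i := v j]))"
    by (rule insert.IH) (use insert.prems in auto)
  finally show ?case unfolding sum.insert[OF insert.hyps] .
qed (simp_all add: multilinear_form_zero[OF m V])

lemma multilinear_form_linear:
  assumes "multilinear_form V k \<omega>" "\<And>i. i \<in> I \<Longrightarrow> multilinear_form V k (\<theta> i)"
  shows "multilinear_form V k (\<lambda>vs. \<omega> vs - (\<Sum>i\<in>I. c i * \<theta> i vs))"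
  unfolding multilinear_form_def
proof (intro ballI conjI allI impI)
  fix vs i u v and d :: complex assume vs: "vs \<in> vectors V k" and i: "i < k" and u: "u \<in> V"
  show "\<omega> (vs[i := fscale d u]) - (\<Sum>j\<in>I. c j * \<theta> j (vs[i := fscale d u]))
      = d * (\<omega> (vs[i := u]) - (\<Sum>j\<in>I. c j * \<theta> j (vs[i := u])))"
    using multilinear_formD(2)[OF assms(1) vs i u] multilinear_formD(2)[OF assms(2) vs i u]
    by (simp add: algebra_simps sum_distrib_left)
  assume v: "v \<in> V"
  show "\<omega> (vs[i := u + v]) - (\<Sum>j\<in>I. c j * \<theta> j (vs[i := u + v]))
      = \<omega> (vs[i := u]) - (\<Sum>j\<in>I. c j * \<theta> j (vs[i := u])) + (\<omega> (vs[i := v]) - (\<Sum>j\<in>I. c j * \<theta> j (vs[i := v])))"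
    using multilinear_formD(1)[OF assms(1) vs i u v] multilinear_formD(1)[OF assms(2) vs i u v]
    by (simp add: algebra_simps sum.distrib)
qed

lemma multilinear_form_eq_0:
  assumes m: "multilinear_form V k \<omega>" and b: "dual_basis V I e \<kappa>"
    and van: "\<And>is. length is = k \<Longrightarrow> set is \<subseteq> I \<Longrightarrow> \<omega> (map e is) = 0" and vs: "vs \<in> vectors V k"
  shows "\<omega> vs = 0"
proof -
  note V = dual_basisD(2)[OF b]
  \<comment> \<open>The slots from \<open>j\<close> on hold basis vectors and the earlier ones are
    arbitrary. The induction step expands slot \<open>j\<close> in the basis; \<open>j = k\<close>
    imposes no condition.\<close>
  have "\<forall>vs\<in>vectors V k. (\<forall>i<k. i \<ge> j \<longrightarrow> vs ! i \<in> e ` I) \<longrightarrow> \<omega> vs = 0" if "j \<le> k" for j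
    using that
  proof (induction j)
    case 0
    show ?case
    proof (intro ballI impI)
      fix vs assume vs: "vs \<in> vectors V k" and "\<forall>i<k. i \<ge> 0 \<longrightarrow> vs ! i \<in> e ` I"
      then have "\<forall>i. \<exists>x. i < k \<longrightarrow> x \<in> I \<and> vs ! i = e x" by auto
      then obtain h where h: "\<And>i. i < k \<Longrightarrow> h i \<in> I \<and> vs ! i = e (h i)" by metis
      have "vs = map e (map h [0..<k])"
        using h vectorsD(1)[OF vs] by (intro nth_equalityI) auto
      then show "\<omega> vs = 0" using van[of "map h [0..<k]"] h by (auto simp: image_subset_iff)
    qed
  next
    case (Suc j)
    show ?case
    proof (intro ballI impI)
      fix vs assume vs: "vs \<in> vectors V k" and *: "\<forall>i<k. i \<ge> Suc j \<longrightarrow> vs ! i \<in> e ` I"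
      have j: "j < k" using Suc.prems by simp
      define v where "v = vs ! j"
      have v: "v \<in> V" using vectorsD(2)[OF vs j] by (simp add: v_def)
      have eV: "e i \<in> V" if "i \<in> I" for i using dual_basisD(3)[OF b that] .
      have "\<omega> (vs[j := e i]) = 0" if i: "i \<in> I" for i
      proof -
        have "\<forall>l<k. l \<ge> j \<longrightarrow> vs[j := e i] ! l \<in> e ` I"
          using * i vectorsD(1)[OF vs] by (auto simp: nth_list_update)
        then show ?thesis using Suc vectors_update[OF vs eV[OF i]] by auto
      qed
      then have z: "\<omega> (vs[j := fscale (\<kappa> i v) (e i)]) = 0" if "i \<in> I" for i
        using multilinear_formD(2)[OF m vs j eV[OF that]] that by simp
      have "\<omega> vs = \<omega> (vs[j := (\<Sum>i\<in>I. fscale (\<kappa> i v) (e i))])"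
        unfolding dual_basisD(7)[OF b v] by (simp add: v_def)
      also have "\<dots> = (\<Sum>i\<in>I. \<omega> (vs[j := fscale (\<kappa> i v) (e i)]))"
        by (rule multilinear_form_sum[OF m vs j V]) (use eV fs.subspace_scale[OF V] in auto)
      also have "\<dots> = 0" using z by simp
      finally show "\<omega> vs = 0" .
    qed
  qed
  from this[of k] vs show ?thesis by simp
qed

lemma form_product_in: "\<omega> \<in> \<Omega> \<Longrightarrow> form_product \<Omega> vs \<omega> = \<omega> vs"
  by (simp add: form_product_def)

text \<open>Elements of the power are functionals on \<open>\<Omega>\<close>, so evaluation at the
  forms \<open>\<theta> j\<close> can serve as coordinates. The hypothesis \<open>expand\<close>
  writes each form in terms of the \<open>\<theta> j\<close> with coefficients its values at
  \<open>t j\<close>; read for a fixed \<open>vs\<close> it writes the product of \<open>vs\<close>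
  in terms of the products of the \<open>t j\<close>.\<close>

lemma dual_basis_power_rep:
  assumes J: "finite J" and t: "\<And>j. j \<in> J \<Longrightarrow> t j \<in> vectors (rep_space R) k"
    and \<theta>: "\<And>j. j \<in> J \<Longrightarrow> \<theta> j \<in> \<Omega>"
    and dual: "\<And>i j. i \<in> J \<Longrightarrow> j \<in> J \<Longrightarrow> \<theta> i (t j) = (if i = j then 1 else 0)"
    and expand: "\<And>\<omega> vs. \<omega> \<in> \<Omega> \<Longrightarrow> vs \<in> vectors (rep_space R) k \<Longrightarrow> \<omega> vs = (\<Sum>j\<in>J. \<omega> (t j) * \<theta> j vs)"
  shows "dual_basis (rep_space (power_rep \<Omega> k R)) J (\<lambda>j. form_product \<Omega> (t j)) (\<lambda>j x. x (\<theta> j))"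
proof -
  define S where "S = fs.span (form_product \<Omega> ` vectors (rep_space R) k)"
  have S: "rep_space (power_rep \<Omega> k R) = S" by (simp add: power_rep_def S_def)
  define E where "E x = (\<Sum>j\<in>J. fscale (x (\<theta> j)) (form_product \<Omega> (t j)))" for x
  have "S \<subseteq> {x. E x = x}"
    unfolding S_def
  proof (rule fs.span_minimal)
    show "form_product \<Omega> ` vectors (rep_space R) k \<subseteq> {x. E x = x}"
    proof clarify
      fix vs assume vs: "vs \<in> vectors (rep_space R) k"
      show "E (form_product \<Omega> vs) = form_product \<Omega> vs"
      proof
        fix \<omega>
        show "E (form_product \<Omega> vs) \<omega> = form_product \<Omega> vs \<omega>"
          using expand[OF _ vs, of \<omega>] \<theta>
          by (auto simp: E_def sum_fun_apply fscale_def form_product_def mult.commute intro!: sum.cong)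
      qed
    qed
    have add: "E (x + y) = E x + E y" for x y
      by (rule ext) (simp add: E_def sum_fun_apply fscale_def distrib_right sum.distrib)
    have scale: "E (fscale c x) = fscale c (E x)" for c x
      by (rule ext) (simp add: E_def sum_fun_apply fscale_def sum_distrib_left mult.assoc)
    show "fs.subspace {x. E x = x}"
      by (rule fs.subspaceI) (use scale[of 0 0] in \<open>auto simp: add scale\<close>)
  qed
  then show ?thesis unfolding S dual_basis_def
    using J t \<theta> dual fs.subspace_span[of "form_product \<Omega> ` vectors (rep_space R) k"]
    by (auto simp: S_def[symmetric] E_def fscale_def form_product_in intro!: fs.span_base[of _ "form_product \<Omega> ` vectors (rep_space R) k", folded S_def])
qed

lemma power_rep_act_product:
  assumes "\<And>\<omega>. \<omega> \<in> \<Omega> \<Longrightarrow> (\<lambda>vs. \<omega> (map (rep_act R g) vs)) \<in> \<Omega>"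
  shows "rep_act (power_rep \<Omega> k R) g (form_product \<Omega> vs) = form_product \<Omega> (map (rep_act R g) vs)"
  using assms by (auto simp: power_rep_def form_product_def fun_eq_iff)

text \<open>All laws are linear in the vector: the vectors that satisfy one of them form a subspace,
  so it suffices to look at products, where the action is that of \<open>g\<close> on each
  factor.\<close>

lemma is_rep_power_rep:
  assumes R: "is_rep n R" and b: "dual_basis (rep_space (power_rep \<Omega> k R)) J e \<kappa>"
    and stable: "\<And>g \<omega>. g \<in> GL n \<Longrightarrow> \<omega> \<in> \<Omega> \<Longrightarrow> (\<lambda>vs. \<omega> (map (rep_act R g) vs)) \<in> \<Omega>"
  shows "is_rep n (power_rep \<Omega> k R)"
proof -
  define G where "G = form_product \<Omega> ` vectors (rep_space R) k"
  define S where "S = fs.span G"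
  have S: "rep_space (power_rep \<Omega> k R) = S" by (simp add: power_rep_def S_def G_def)
  define A where "A g = rep_act (power_rep \<Omega> k R) g" for g
  have add: "A g (x + y) = A g x + A g y" for g x y
    by (rule ext) (simp add: A_def power_rep_def)
  have scale: "A g (fscale c x) = fscale c (A g x)" for g c x
    by (rule ext) (simp add: A_def power_rep_def fscale_def)
  have zero: "A g 0 = 0" for g using scale[of g 0 0] by simp
  have prod: "A g (form_product \<Omega> vs) = form_product \<Omega> (map (rep_act R g) vs)" if "g \<in> GL n" for g vs
    unfolding A_def by (rule power_rep_act_product) (rule stable[OF that])
  have vec: "map (rep_act R g) vs \<in> vectors (rep_space R) k" if "g \<in> GL n" "vs \<in> vectors (rep_space R) k" for g vs
    by (rule vectors_map[OF that(2)]) (rule linear_map_onD(1)[OF is_repD(2)[OF R that(1)]])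
  have AS: "A g x \<in> S" if g: "g \<in> GL n" and x: "x \<in> S" for g x
  proof -
    have "S \<subseteq> {x. A g x \<in> S}" unfolding S_def
    proof (rule fs.span_minimal)
      show "G \<subseteq> {x. A g x \<in> fs.span G}"
        using prod[OF g] vec[OF g] by (auto simp: G_def intro!: fs.span_base)
      show "fs.subspace {x. A g x \<in> fs.span G}"
        by (rule fs.subspaceI) (auto simp: zero add scale fs.span_zero fs.span_add fs.span_scale)
    qed
    then show ?thesis using x by blast
  qed
  have map_cong: "form_product \<Omega> (map f vs) = form_product \<Omega> (map h vs)"
    if "vs \<in> vectors (rep_space R) k" "\<And>v. v \<in> rep_space R \<Longrightarrow> f v = h v" for f h vs
    using that by (intro arg_cong[of _ _ "form_product \<Omega>"] list.map_cong0) (auto simp: vectors_def)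
  have one: "S \<subseteq> {x. A (1\<^sub>m n) x = x}" unfolding S_def
  proof (rule fs.span_minimal)
    show "G \<subseteq> {x. A (1\<^sub>m n) x = x}"
      using map_cong[of _ "rep_act R (1\<^sub>m n)" "\<lambda>v. v"] is_repD(3)[OF R] by (auto simp: G_def prod[OF one_in_GL])
    show "fs.subspace {x. A (1\<^sub>m n) x = x}" by (rule fs.subspaceI) (auto simp: zero add scale)
  qed
  have mult: "S \<subseteq> {x. A (g * h) x = A g (A h x)}" if g: "g \<in> GL n" and h: "h \<in> GL n" for g h
    unfolding S_def
  proof (rule fs.span_minimal)
    show "G \<subseteq> {x. A (g * h) x = A g (A h x)}"
      using map_cong[of _ "rep_act R (g * h)" "\<lambda>v. rep_act R g (rep_act R h v)"] is_repD(4)[OF R g h]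
      by (auto simp: G_def prod[OF GL_mult[OF g h]] prod[OF g] prod[OF h] comp_def)
    show "fs.subspace {x. A (g * h) x = A g (A h x)}" by (rule fs.subspaceI) (auto simp: zero add scale)
  qed
  show ?thesis unfolding is_rep_def S A_def[symmetric]
  proof (intro conjI ballI)
    show "\<exists>B. finite B \<and> is_basis S B"
      using dual_basis_is_basis[OF b] dual_basisD(1)[OF b] unfolding S by (intro exI[of _ "e ` J"]) simp
    show "linear_map_on S S (A g)" if "g \<in> GL n" for g
      using AS[OF that] add scale by (simp add: linear_map_on_def)
  qed (use one mult in auto)
qed

lemma polynomial_sum:
  "finite I \<Longrightarrow> (\<And>i. i \<in> I \<Longrightarrow> polynomial_in_entries n (p i)) \<Longrightarrow> polynomial_in_entries n (\<lambda>g. \<Sum>i\<in>I. p i g)"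
  by (induction I rule: finite_induct) (auto intro: polynomial_in_entries.intros)

lemma polynomial_prod:
  "finite I \<Longrightarrow> (\<And>i. i \<in> I \<Longrightarrow> polynomial_in_entries n (p i)) \<Longrightarrow> polynomial_in_entries n (\<lambda>g. \<Prod>i\<in>I. p i g)"
  by (induction I rule: finite_induct) (auto intro: polynomial_in_entries.intros)

lemma unitary_basis_defining_rep:
  "unitary_basis n (defining_rep n) {..<n} (\<lambda>i k. if k = i then 1 else 0) (\<lambda>i v. v i) (\<lambda>i y. y i)"
proof -
  let ?R = "defining_rep n"
  have "dual_basis (rep_space ?R) {..<n} (\<lambda>i k. if k = i then 1 else 0) (\<lambda>i v. v i)"
    unfolding dual_basis_def
  proof (intro conjI ballI allI)
    show "fs.subspace (rep_space ?R)"
      by (rule fs.subspaceI) (auto simp: defining_rep_def fscale_def)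
    fix v assume "v \<in> rep_space ?R"
    then have v: "\<And>i. i \<ge> n \<Longrightarrow> v i = 0" by (simp add: defining_rep_def)
    show "(\<Sum>i<n. fscale (v i) (\<lambda>k. if k = i then 1 else 0)) = v"
    proof
      fix k
      have "(\<Sum>i<n. fscale (v i) (\<lambda>k. if k = i then 1 else 0)) k = (\<Sum>i<n. if k = i then v i else 0)"
        unfolding sum_fun_apply by (intro sum.cong) (auto simp: fscale_def)
      also have "\<dots> = v k" using v[of k] by auto
      finally show "(\<Sum>i<n. fscale (v i) (\<lambda>k. if k = i then 1 else 0)) k = v k" .
    qed
  qed (auto simp: defining_rep_def fscale_def)
  note b = this
  have act: "rep_act ?R g v i = (\<Sum>j<n. g $$ (i, j) * v j)" if "i < n" for g v i
    using that by (simp add: defining_rep_def)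
  have act_e: "rep_act ?R g (\<lambda>k. if k = j then 1 else 0) i = g $$ (i, j)" if "i < n" "j < n" for g i j
    using that by (simp add: act if_distrib[of "\<lambda>x. _ * x"] cong: if_cong)
  have "is_rep n ?R"
    unfolding is_rep_def
  proof (intro conjI ballI)
    show "\<exists>B. finite B \<and> is_basis (rep_space ?R) B"
      using dual_basis_is_basis[OF b] by blast
    fix g assume g: "g \<in> GL n"
    show "linear_map_on (rep_space ?R) (rep_space ?R) (rep_act ?R g)"
      by (auto simp: linear_map_on_def defining_rep_def fscale_def fun_eq_iff sum.distrib algebra_simps sum_distrib_left)
    fix h v assume h: "h \<in> GL n" and v: "v \<in> rep_space ?R"
    show "rep_act ?R (g * h) v = rep_act ?R g (rep_act ?R h v)"
    proof
      fix i
      show "rep_act ?R (g * h) v i = rep_act ?R g (rep_act ?R h v) i"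
      proof (cases "i < n")
        case True
        have "rep_act ?R (g * h) v i = (\<Sum>j<n. \<Sum>k<n. g $$ (i, k) * h $$ (k, j) * v j)"
          using True GL_carrier[OF g] GL_carrier[OF h] unfolding act[OF True]
          by (intro sum.cong refl) (auto simp: scalar_prod_def sum_distrib_right atLeast0LessThan intro!: sum.cong)
        also have "\<dots> = (\<Sum>k<n. \<Sum>j<n. g $$ (i, k) * h $$ (k, j) * v j)" by (rule sum.swap)
        also have "\<dots> = rep_act ?R g (rep_act ?R h v) i"
          using True by (simp add: act sum_distrib_left mult.assoc)
        finally show ?thesis .
      qed (simp add: defining_rep_def)
    qed
  next
    fix v assume v: "v \<in> rep_space ?R"
    show "rep_act ?R (1\<^sub>m n) v = v"
    proof
      fix i
      show "rep_act ?R (1\<^sub>m n) v i = v i"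
      proof (cases "i < n")
        case True
        have "rep_act ?R (1\<^sub>m n) v i = (\<Sum>j<n. if i = j then v j else 0)"
          unfolding act[OF True] using True by (intro sum.cong) auto
        then show ?thesis using True by simp
      qed (use v in \<open>simp add: defining_rep_def\<close>)
    qed
  qed
  then show ?thesis
    unfolding unitary_basis_def
  proof (intro conjI ballI allI impI)
    fix i j assume "i \<in> {..<n}" "j \<in> {..<n}"
    then show "\<exists>p. polynomial_in_entries n p \<and> (\<forall>g\<in>GL n. rep_act ?R g (\<lambda>k. if k = j then 1 else 0) i = p g)"
      by (intro exI[of _ "\<lambda>g. g $$ (i, j)"]) (auto simp: act_e intro: polynomial_in_entries.entry)
  qed (use b in \<open>auto simp: act_e adj_def mat_diag_def\<close>)
qed

section \<open>Exterior powers, with minors as coordinates\<close>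

lemma det_zero_row:
  assumes "A \<in> carrier_mat k k" "i < k" "\<And>j. j < k \<Longrightarrow> A $$ (i, j) = (0 :: complex)"
  shows "det A = 0"
proof -
  have "(\<Prod>l = 0..<k. A $$ (l, p l)) = 0" if p: "p permutes {0..<k}" for p
  proof (rule prod_zero)
    have "p i < k" using permutes_in_image[OF p, of i] assms(2) by simp
    then show "\<exists>l\<in>{0..<k}. A $$ (l, p l) = 0" using assms(2,3) by (intro bexI[of _ i]) auto
  qed simp
  then show ?thesis unfolding det_def'[OF assms(1)] by (intro sum.neutral) simp
qed

lemma det_diagonal:
  assumes "A \<in> carrier_mat k k" "\<And>i j. i < k \<Longrightarrow> j < k \<Longrightarrow> i \<noteq> j \<Longrightarrow> A $$ (i, j) = (0 :: complex)"
  shows "det A = (\<Prod>i<k. A $$ (i, i))"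
proof -
  have "upper_triangular A" using assms by (intro upper_triangularI) auto
  from det_upper_triangular[OF this assms(1)] assms(1) show ?thesis
    by (simp add: prod_list_diag_prod atLeast0LessThan)
qed

text \<open>Passes the adjoint rule from matrix entries to minors.\<close>

lemma mat_entries_det_cnj:
  assumes "\<And>i j. i < k \<Longrightarrow> j < k \<Longrightarrow> f i j = cnj (h j i)"
  shows "det (mat k k (\<lambda>(i, j). f i j)) = cnj (det (mat k k (\<lambda>(i, j). h i j)))"
proof -
  interpret cnj: comm_ring_hom cnj by standard auto
  have "mat k k (\<lambda>(i, j). f i j) = transpose_mat (map_mat cnj (mat k k (\<lambda>(i, j). h i j)))"
    using assms by (intro eq_matI) auto
  then show ?thesis using det_transpose[of "map_mat cnj (mat k k (\<lambda>(i, j). h i j))" k] cnj.hom_det by simp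
qed

text \<open>The minor, with columns \<open>S\<close>, of the matrix whose rows are the coordinates
  of \<open>vs\<close>. These minors are dual to the wedge products of basis vectors in increasing
  order.\<close>

definition det_form ::
  "nat \<Rightarrow> (nat \<Rightarrow> ('a \<Rightarrow> complex) \<Rightarrow> complex) \<Rightarrow> nat set \<Rightarrow> ('a \<Rightarrow> complex) list \<Rightarrow> complex" where
  "det_form k \<kappa> S vs = det (mat k k (\<lambda>(b, a). \<kappa> (sorted_list_of_set S ! a) (vs ! b)))"

lemma sorted_list_of_set_nth:
  fixes m :: nat
  assumes "S \<subseteq> {..<m}" "card S = k" "a < k"
  shows "sorted_list_of_set S ! a \<in> S"
  using assms finite_subset[OF assms(1) finite_lessThan] nth_mem[of a "sorted_list_of_set S"] by simp

lemma det_form_alternating: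
  assumes b: "dual_basis V {..<m} e \<kappa>" and S: "S \<subseteq> {..<m}" "card S = k"
  shows "det_form k \<kappa> S \<in> alternating_forms V k"
proof -
  define s where "s a = sorted_list_of_set S ! a" for a
  have s: "s a \<in> {..<m}" if "a < k" for a
    using sorted_list_of_set_nth[OF S that] S by (auto simp: s_def)
  \<comment> \<open>In each term of the Leibniz formula the argument in slot \<open>i\<close> enters
    exactly one factor; linearity in that slot follows.\<close>
  have exp: "det_form k \<kappa> S (vs[i := u]) =
      (\<Sum>p | p permutes {0..<k}. signof p * (\<kappa> (s (p i)) u * (\<Prod>l\<in>{0..<k} - {i}. \<kappa> (s (p l)) (vs ! l))))"
    if vs: "length vs = k" and i: "i < k" for vs i u
  proof -
    have "(\<Prod>l = 0..<k. mat k k (\<lambda>(b, a). \<kappa> (s a) (vs[i := u] ! b)) $$ (l, p l))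
        = \<kappa> (s (p i)) u * (\<Prod>l\<in>{0..<k} - {i}. \<kappa> (s (p l)) (vs ! l))" if p: "p permutes {0..<k}" for p
    proof -
      have "(\<Prod>l = 0..<k. mat k k (\<lambda>(b, a). \<kappa> (s a) (vs[i := u] ! b)) $$ (l, p l)) = (\<Prod>l = 0..<k. \<kappa> (s (p l)) (vs[i := u] ! l))"
        using permutes_in_image[OF p] by (intro prod.cong) auto
      also have "\<dots> = \<kappa> (s (p i)) (vs[i := u] ! i) * (\<Prod>l\<in>{0..<k} - {i}. \<kappa> (s (p l)) (vs[i := u] ! l))"
        using i by (intro prod.remove) auto
      also have "(\<Prod>l\<in>{0..<k} - {i}. \<kappa> (s (p l)) (vs[i := u] ! l)) = (\<Prod>l\<in>{0..<k} - {i}. \<kappa> (s (p l)) (vs ! l))"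
        by (intro prod.cong) auto
      finally show ?thesis using vs i by simp
    qed
    then show ?thesis unfolding det_form_def s_def[symmetric] by (subst det_def'[of _ k]) (auto intro!: sum.cong)
  qed
  have "multilinear_form V k (det_form k \<kappa> S)"
    unfolding multilinear_form_def
  proof (intro ballI conjI allI impI)
    fix vs i u v and c :: complex assume vs: "vs \<in> vectors V k" and i: "i < k" and u: "u \<in> V"
    have sp: "s (p i) \<in> {..<m}" if "p permutes {0..<k}" for p
      using s[of "p i"] permutes_in_image[OF that, of i] i by simp
    show "det_form k \<kappa> S (vs[i := fscale c u]) = c * det_form k \<kappa> S (vs[i := u])"
      unfolding exp[OF vectorsD(1)[OF vs] i] sum_distrib_left
      by (intro sum.cong refl) (simp add: dual_basisD(5)[OF b sp u])
    assume v: "v \<in> V"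
    show "det_form k \<kappa> S (vs[i := u + v]) = det_form k \<kappa> S (vs[i := u]) + det_form k \<kappa> S (vs[i := v])"
      unfolding exp[OF vectorsD(1)[OF vs] i] sum.distrib[symmetric]
      by (intro sum.cong refl) (simp add: dual_basisD(4)[OF b sp u v] algebra_simps)
  qed
  moreover have "det_form k \<kappa> S vs = 0" if vs: "vs \<in> vectors V k" and nd: "\<not> distinct vs" for vs
  proof -
    obtain i j where ij: "i < k" "j < k" "i \<noteq> j" "vs ! i = vs ! j"
      using nd vectorsD(1)[OF vs] by (auto simp: distinct_conv_nth)
    show ?thesis unfolding det_form_def
      by (rule det_identical_rows[OF _ ij(3,1,2)]) (use ij in \<open>auto intro!: eq_vecI\<close>)
  qed
  ultimately show ?thesis by (simp add: alternating_forms_def)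
qed

text \<open>Polarisation: expand the vanishing value with \<open>a + b\<close> in both
  slots.\<close>

lemma alternating_swap:
  assumes \<eta>: "\<eta> \<in> alternating_forms V k" and V: "fs.subspace V" and vs: "vs \<in> vectors V k"
    and ij: "i < k" "j < k" "i \<noteq> j" and a: "a \<in> V" and b: "b \<in> V"
  shows "\<eta> (vs[i := a, j := b]) = - \<eta> (vs[i := b, j := a])"
proof -
  have m: "multilinear_form V k \<eta>" and alt: "\<And>vs. vs \<in> vectors V k \<Longrightarrow> \<not> distinct vs \<Longrightarrow> \<eta> vs = 0"
    using \<eta> by (auto simp: alternating_forms_def)
  have len: "length vs = k" by (rule vectorsD(1)[OF vs])
  have same: "\<eta> (vs[i := x, j := x]) = 0" if x: "x \<in> V" for x
  proof (rule alt)
    show "vs[i := x, j := x] \<in> vectors V k" by (intro vectors_update vs x)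
    have "vs[i := x, j := x] ! i = vs[i := x, j := x] ! j" using ij len by (simp add: nth_list_update)
    then show "\<not> distinct (vs[i := x, j := x])"
      using ij len nth_eq_iff_index_eq[of "vs[i := x, j := x]" i j] by auto
  qed
  have ab: "a + b \<in> V" by (rule fs.subspace_add[OF V a b])
  have J: "\<eta> (vs[i := x, j := a + b]) = \<eta> (vs[i := x, j := a]) + \<eta> (vs[i := x, j := b])" if x: "x \<in> V" for x
    by (rule multilinear_formD(1)[OF m vectors_update[OF vs x] ij(2) a b])
  have I: "\<eta> (vs[i := a + b, j := x]) = \<eta> (vs[i := a, j := x]) + \<eta> (vs[i := b, j := x])" if x: "x \<in> V" for x
    using multilinear_formD(1)[OF m vectors_update[OF vs x, of j] ij(1) a b]
    by (simp only: list_update_swap[OF ij(3)])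
  have "0 = \<eta> (vs[i := a + b, j := a + b])" using same[OF ab] by simp
  also have "\<dots> = \<eta> (vs[i := a, j := b]) + \<eta> (vs[i := b, j := a])"
    unfolding J[OF ab] I[OF a] I[OF b] same[OF a] same[OF b] by simp
  finally show ?thesis by (simp add: eq_neg_iff_add_eq_0)
qed

text \<open>Only the vanishing is carried along the transpositions, so no signs have to be
  tracked.\<close>

lemma alternating_permute_zero:
  assumes \<eta>: "\<eta> \<in> alternating_forms V k" and V: "fs.subspace V" and e: "\<And>i. i \<in> I \<Longrightarrow> e i \<in> V"
    and p: "p permutes {..<k}"
  shows "\<forall>xs. length xs = k \<longrightarrow> set xs \<subseteq> I \<longrightarrow> \<eta> (map e xs) = 0 \<longrightarrow> \<eta> (map e (permute_list p xs)) = 0"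
  using p finite_lessThan[of k]
proof (induction rule: permutes_induct)
  case id
  show ?case by (auto simp: permute_list_id)
next
  case (swap a b p)
  show ?case
  proof (intro allI impI)
    fix xs assume xs: "length xs = k" "set xs \<subseteq> I" "\<eta> (map e xs) = 0"
    define ys where "ys = permute_list (Transposition.transpose a b) xs"
    have ab: "a < k" "b < k" "a \<noteq> b" using swap by auto
    have xI: "xs ! i \<in> I" if "i < k" for i using xs that by (auto simp: subset_eq)
    have ys: "map e ys = (map e xs)[a := e (xs ! b), b := e (xs ! a)]"
      using xs(1) ab by (intro nth_equalityI)
        (auto simp: ys_def permute_list_def nth_list_update Transposition.transpose_def)
    have vx: "map e xs \<in> vectors V k" using xs e by (auto simp: vectors_def)
    have "\<eta> (map e ys) = - \<eta> ((map e xs)[a := e (xs ! a), b := e (xs ! b)])"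
      unfolding ys by (rule alternating_swap[OF \<eta> V vx ab]) (use e xI ab in auto)
    also have "(map e xs)[a := e (xs ! a), b := e (xs ! b)] = map e xs"
      using xs(1) ab by (intro nth_equalityI) (auto simp: nth_list_update)
    finally have "\<eta> (map e ys) = 0" using xs(3) by simp
    moreover have "length ys = k" "set ys \<subseteq> I"
      using xs xI ab by (auto simp: ys_def permute_list_def Transposition.transpose_def set_conv_nth split: if_splits)
    ultimately have "\<eta> (map e (permute_list p ys)) = 0" using swap.IH by blast
    moreover have "permute_list (Transposition.transpose a b \<circ> p) xs = permute_list p ys"
      unfolding ys_def by (rule permute_list_compose) (use swap xs in auto)
    ultimately show "\<eta> (map e (permute_list (Transposition.transpose a b \<circ> p) xs)) = 0" by simp
  qed
qed

text \<open>By multilinearity only tuples of basis vectors matter; those with a repetition give 0,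
  and the others are permutations of increasing ones.\<close>

lemma alternating_eq_0:
  assumes \<eta>: "\<eta> \<in> alternating_forms V k" and b: "dual_basis V {..<m} e \<kappa>"
    and 0: "\<And>S. S \<subseteq> {..<m} \<Longrightarrow> card S = k \<Longrightarrow> \<eta> (map e (sorted_list_of_set S)) = 0"
    and vs: "vs \<in> vectors V k"
  shows "\<eta> vs = 0"
proof (rule multilinear_form_eq_0[OF _ b _ vs])
  show "multilinear_form V k \<eta>" using \<eta> by (simp add: alternating_forms_def)
  fix xs assume xs: "length xs = k" "set xs \<subseteq> {..<m}"
  have eV: "e i \<in> V" if "i \<in> {..<m}" for i by (rule dual_basisD(3)[OF b that])
  show "\<eta> (map e xs) = 0"
  proof (cases "distinct xs")
    case False
    have "map e xs \<in> vectors V k" using xs eV by (auto simp: vectors_def)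
    moreover have "\<not> distinct (map e xs)" using False by (auto simp: distinct_map)
    ultimately show ?thesis using \<eta> by (simp add: alternating_forms_def)
  next
    case True
    define ys where "ys = sorted_list_of_set (set xs)"
    have c: "card (set xs) = k" using True xs(1) distinct_card by metis
    have "mset ys = mset xs"
      using True by (simp add: ys_def set_eq_iff_mset_eq_distinct[symmetric])
    then obtain p where p: "p permutes {..<length ys}" "permute_list p ys = xs"
      by (metis mset_eq_permutation)
    have ys: "length ys = k" "set ys \<subseteq> {..<m}" using c xs by (auto simp: ys_def)
    have "\<eta> (map e ys) = 0" unfolding ys_def by (rule 0[OF xs(2) c])
    moreover have "\<forall>xs. length xs = k \<longrightarrow> set xs \<subseteq> {..<m} \<longrightarrow> \<eta> (map e xs) = 0 \<longrightarrow> \<eta> (map e (permute_list p xs)) = 0"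
      by (rule alternating_permute_zero[OF \<eta> dual_basisD(2)[OF b] eV p(1)[unfolded ys(1)]])
    ultimately show ?thesis using p(2) ys by blast
  qed
qed

lemma alternating_forms_linear:
  assumes "\<omega> \<in> alternating_forms V k" "\<And>i. i \<in> I \<Longrightarrow> \<theta> i \<in> alternating_forms V k"
  shows "(\<lambda>vs. \<omega> vs - (\<Sum>i\<in>I. c i * \<theta> i vs)) \<in> alternating_forms V k"
  using assms multilinear_form_linear[of V k \<omega> I \<theta> c] by (auto simp: alternating_forms_def)

lemma multilinear_form_compose:
  assumes m: "multilinear_form V k \<omega>" and f: "linear_map_on V V f"
  shows "multilinear_form V k (\<lambda>vs. \<omega> (map f vs))"
  unfolding multilinear_form_def
proof (intro ballI conjI allI impI)
  fix vs i u v and c :: complex assume vs: "vs \<in> vectors V k" and i: "i < k" and u: "u \<in> V"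
  note f = linear_map_onD[OF f]
  have fvs: "map f vs \<in> vectors V k" by (rule vectors_map[OF vs f(1)])
  show "\<omega> (map f (vs[i := fscale c u])) = c * \<omega> (map f (vs[i := u]))"
    unfolding map_update f(3)[OF u] by (rule multilinear_formD(2)[OF m fvs i f(1)[OF u]])
  assume v: "v \<in> V"
  show "\<omega> (map f (vs[i := u + v])) = \<omega> (map f (vs[i := u])) + \<omega> (map f (vs[i := v]))"
    unfolding map_update f(2)[OF u v] by (rule multilinear_formD(1)[OF m fvs i f(1)[OF u] f(1)[OF v]])
qed

lemma alternating_forms_compose:
  assumes "\<omega> \<in> alternating_forms V k" "linear_map_on V V f"
  shows "(\<lambda>vs. \<omega> (map f vs)) \<in> alternating_forms V k"
  using assms multilinear_form_compose[of V k \<omega> f] vectors_map[of _ V k f V] linear_map_onD(1)[OF assms(2)]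
  by (auto simp: alternating_forms_def distinct_map)

text \<open>The matrix entries on the exterior power are the minors of the matrix of
  \<open>g\<close>, so polynomiality, the adjoint rule and diagonality are inherited. Numbers as
  indices of \<open>R\<close> provide the order in which the factors of a wedge product are
  written.\<close>

lemma unitary_basis_exterior_power:
  assumes u: "unitary_basis n R {..<m} e \<kappa> w"
  shows "unitary_basis n (exterior_power k R) {S. S \<subseteq> {..<m} \<and> card S = k}
    (\<lambda>S. form_product (alternating_forms (rep_space R) k) (map e (sorted_list_of_set S)))
    (\<lambda>S x. x (det_form k \<kappa> S)) (\<lambda>S y. \<Prod>s\<in>S. w s y)"
proof -
  define V where "V = rep_space R"
  define \<Omega> where "\<Omega> = alternating_forms V k"
  define J where "J = {S. S \<subseteq> {..<m} \<and> card S = k}"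
  define t where "t S = map e (sorted_list_of_set S)" for S
  note R = unitary_basisD(1)[OF u] and b = unitary_basisD(2)[OF u, folded V_def]
  have J: "finite J" unfolding J_def by simp
  have len: "length (sorted_list_of_set S) = k" if "S \<in> J" for S using that by (simp add: J_def)
  have nth: "sorted_list_of_set S ! a \<in> S" "sorted_list_of_set S ! a < m" if "S \<in> J" "a < k" for S a
    using sorted_list_of_set_nth[of S m k a] that by (auto simp: J_def)
  have t: "t S \<in> vectors V k" if "S \<in> J" for S
    using that len[OF that] dual_basisD(3)[OF b] finite_subset[of S "{..<m}"]
    by (auto simp: J_def t_def vectors_def)
  have \<theta>: "det_form k \<kappa> S \<in> \<Omega>" if "S \<in> J" for S
    unfolding \<Omega>_def by (rule det_form_alternating[OF b]) (use that in \<open>auto simp: J_def\<close>)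
  have stable: "(\<lambda>vs. \<omega> (map (rep_act R g) vs)) \<in> \<Omega>" if "g \<in> GL n" "\<omega> \<in> \<Omega>" for g \<omega>
    using that alternating_forms_compose is_repD(2)[OF R] unfolding \<Omega>_def V_def by blast
  have entry: "det_form k \<kappa> S (map f (t T)) = det (mat k k (\<lambda>(b, a). \<kappa> (sorted_list_of_set S ! a) (f (e (sorted_list_of_set T ! b)))))"
    if "T \<in> J" for S T f
    using len[OF that] by (auto simp: det_form_def t_def intro!: arg_cong[of _ _ det] eq_matI)
  have diag: "det_form k \<kappa> S (map f (t T)) = (if S = T then \<Prod>s\<in>S. c s else 0)"
    if S: "S \<in> J" and T: "T \<in> J" and f: "\<And>i j. i < m \<Longrightarrow> j < m \<Longrightarrow> \<kappa> i (f (e j)) = (if i = j then c i else 0)" for S T f c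
  proof (cases "S = T")
    case True
    have "det_form k \<kappa> S (map f (t S)) = (\<Prod>a<k. c (sorted_list_of_set S ! a))"
      unfolding entry[OF S]
      by (subst det_diagonal) (use nth[OF S] len[OF S] in \<open>auto simp: f nth_eq_iff_index_eq\<close>)
    also have "\<dots> = (\<Prod>s\<in>S. c s)"
    proof (rule prod.reindex_bij_betw)
      show "bij_betw ((!) (sorted_list_of_set S)) {..<k} S"
        using bij_betw_nth[of "sorted_list_of_set S" "{..<k}" S] len[OF S] S finite_subset[of S "{..<m}"]
        by (simp add: J_def)
    qed
    finally show ?thesis using True by simp
  next
    case False
    \<comment> \<open>Distinct sets of equal size do not contain each other, and an element of
      \<open>T\<close> outside \<open>S\<close> produces a zero row in the minor.\<close>
    have "\<exists>x\<in>T. x \<notin> S"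
      using False S T finite_subset[of S "{..<m}"] finite_subset[of T "{..<m}"] card_subset_eq[of S T]
      by (auto simp: J_def)
    then obtain x where x: "x \<in> T" "x \<notin> S" by blast
    have "x \<in> set (sorted_list_of_set T)" using x T finite_subset[of T "{..<m}"] by (simp add: J_def)
    then obtain r where r: "r < k" "sorted_list_of_set T ! r = x" using len[OF T] by (auto simp: in_set_conv_nth)
    have "x < m" using x T by (auto simp: J_def)
    have ne: "sorted_list_of_set S ! a \<noteq> x" if "a < k" for a using nth(1)[OF S that] x(2) by metis
    have "det_form k \<kappa> S (map f (t T)) = 0" unfolding entry[OF T]
      by (rule det_zero_row[of _ k r]) (use r nth(2)[OF S] ne \<open>x < m\<close> in \<open>auto simp: f\<close>)
    then show ?thesis using False by simp
  qed
  have dual: "det_form k \<kappa> S (t T) = (if S = T then 1 else 0)" if "S \<in> J" "T \<in> J" for S T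
    using diag[OF that, of "\<lambda>v. v" "\<lambda>_. 1"] dual_basisD(6)[OF b] by simp
  have expand: "\<omega> vs = (\<Sum>S\<in>J. \<omega> (t S) * det_form k \<kappa> S vs)" if \<omega>: "\<omega> \<in> \<Omega>" and vs: "vs \<in> vectors V k" for \<omega> vs
  proof -
    \<comment> \<open>The difference of both sides is alternating and vanishes on increasing tuples
      of basis vectors.\<close>
    define \<eta> where "\<eta> vs = \<omega> vs - (\<Sum>S\<in>J. \<omega> (t S) * det_form k \<kappa> S vs)" for vs
    have \<eta>: "\<eta> \<in> alternating_forms V k"
      unfolding \<eta>_def by (rule alternating_forms_linear) (use \<omega> \<theta> in \<open>auto simp: \<Omega>_def\<close>)
    have "\<eta> (t T) = 0" if T: "T \<in> J" for T
    proof -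
      have "(\<Sum>S\<in>J. \<omega> (t S) * det_form k \<kappa> S (t T)) = (\<Sum>S\<in>J. if S = T then \<omega> (t S) else 0)"
        using dual T by (intro sum.cong) auto
      then show ?thesis using J T by (simp add: \<eta>_def)
    qed
    then have "\<eta> vs = 0" by (intro alternating_eq_0[OF \<eta> b _ vs]) (auto simp: J_def t_def)
    then show ?thesis by (simp add: \<eta>_def)
  qed
  have ext: "exterior_power k R = power_rep \<Omega> k R" by (simp add: exterior_power_def \<Omega>_def V_def)
  have db: "dual_basis (rep_space (exterior_power k R)) J (\<lambda>S. form_product \<Omega> (t S)) (\<lambda>S x. x (det_form k \<kappa> S))"
    unfolding ext using J t \<theta> dual expand unfolding V_def by (rule dual_basis_power_rep)
  have rep: "is_rep n (exterior_power k R)"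
    unfolding ext by (rule is_rep_power_rep[OF R db[unfolded ext] stable])
  have act: "rep_act (exterior_power k R) g (form_product \<Omega> (t T)) (det_form k \<kappa> S) = det_form k \<kappa> S (map (rep_act R g) (t T))"
    if "g \<in> GL n" "S \<in> J" for g S T
    unfolding ext using power_rep_act_product[of \<Omega> R g k "t T"] stable[OF that(1)] form_product_in[OF \<theta>[OF that(2)]] by simp
  have "unitary_basis n (exterior_power k R) J (\<lambda>S. form_product \<Omega> (t S)) (\<lambda>S x. x (det_form k \<kappa> S)) (\<lambda>S y. \<Prod>s\<in>S. w s y)"
    unfolding unitary_basis_def
  proof (intro conjI ballI allI impI)
    show "is_rep n (exterior_power k R)" by (rule rep)
    show "dual_basis (rep_space (exterior_power k R)) J (\<lambda>S. form_product \<Omega> (t S)) (\<lambda>S x. x (det_form k \<kappa> S))" by (rule db)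
  next
    fix S T assume S: "S \<in> J" and T: "T \<in> J"
    have "\<forall>i<m. \<forall>j<m. \<exists>p. polynomial_in_entries n p \<and> (\<forall>g\<in>GL n. \<kappa> i (rep_act R g (e j)) = p g)"
      using unitary_basisD(3)[OF u] by auto
    then obtain q where q: "\<And>i j. i < m \<Longrightarrow> j < m \<Longrightarrow> polynomial_in_entries n (q i j)"
      "\<And>i j g. i < m \<Longrightarrow> j < m \<Longrightarrow> g \<in> GL n \<Longrightarrow> \<kappa> i (rep_act R g (e j)) = q i j g" by metis
    define r where "r g = (\<Sum>p | p permutes {0..<k}. signof p *
        (\<Prod>b = 0..<k. q (sorted_list_of_set S ! p b) (sorted_list_of_set T ! b) g))" for g
    have "polynomial_in_entries n r" unfolding r_def
      by (intro polynomial_sum polynomial_in_entries.mult polynomial_in_entries.const polynomial_prod q(1))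
        (use nth[OF S] nth[OF T] permutes_in_image in \<open>fastforce simp: finite_permutations\<close>)+
    moreover have "rep_act (exterior_power k R) g (form_product \<Omega> (t T)) (det_form k \<kappa> S) = r g" if g: "g \<in> GL n" for g
      unfolding act[OF g S] entry[OF T] r_def
      by (subst det_def'[of _ k])
        (use nth[OF S] nth[OF T] permutes_in_image in \<open>auto intro!: sum.cong prod.cong simp: q(2)[OF _ _ g]\<close>)
    ultimately show "\<exists>p. polynomial_in_entries n p \<and>
        (\<forall>g\<in>GL n. rep_act (exterior_power k R) g (form_product \<Omega> (t T)) (det_form k \<kappa> S) = p g)" by blast
  next
    fix g S T assume g: "g \<in> GL n" and S: "S \<in> J" and T: "T \<in> J"
    show "rep_act (exterior_power k R) (adj n g) (form_product \<Omega> (t T)) (det_form k \<kappa> S)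
        = cnj (rep_act (exterior_power k R) g (form_product \<Omega> (t S)) (det_form k \<kappa> T))"
      unfolding act[OF g T] act[OF adj_GL[OF g] S] entry[OF S] entry[OF T]
      by (rule mat_entries_det_cnj) (use nth[OF S] nth[OF T] unitary_basisD(4)[OF u g] in auto)
  next
    fix y S T assume y: "\<forall>l<n. (y l :: complex) \<noteq> 0" and S: "S \<in> J" and T: "T \<in> J"
    have yG: "mat_diag n y \<in> GL n" using mat_diag_GL y by blast
    show "rep_act (exterior_power k R) (mat_diag n y) (form_product \<Omega> (t T)) (det_form k \<kappa> S) = (if S = T then \<Prod>s\<in>S. w s y else 0)"
      unfolding act[OF yG S] by (rule diag[OF S T]) (use unitary_basisD(5)[OF u] y in auto)
  qed
  then show ?thesis by (simp add: J_def \<Omega>_def t_def V_def)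
qed

section \<open>The symmetric square\<close>

definition sym_form ::
  "(nat \<Rightarrow> ('a \<Rightarrow> complex) \<Rightarrow> complex) \<Rightarrow> nat \<times> nat \<Rightarrow> ('a \<Rightarrow> complex) list \<Rightarrow> complex" where
  "sym_form \<kappa> p vs = (case p of (i, j) \<Rightarrow> (if i = j then 1 / 2 else 1 / of_real (sqrt 2)) *
     (\<kappa> i (vs ! 0) * \<kappa> j (vs ! 1) + \<kappa> j (vs ! 0) * \<kappa> i (vs ! 1)))"

text \<open>The factor makes the products \<open>e\<^sub>i e\<^sub>j\<close>, \<open>i \<le> j\<close>, orthonormal.\<close>

definition sym_tuple :: "(nat \<Rightarrow> 'a \<Rightarrow> complex) \<Rightarrow> nat \<times> nat \<Rightarrow> ('a \<Rightarrow> complex) list" where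
  "sym_tuple e p = (case p of (i, j) \<Rightarrow> [fscale (if i = j then 1 else of_real (sqrt 2)) (e i), e j])"

lemma sym_form_symmetric:
  assumes b: "dual_basis V {..<m} e \<kappa>" and p: "fst p < m" "snd p < m"
  shows "sym_form \<kappa> p \<in> symmetric_forms V 2"
proof -
  obtain i j where ij: "p = (i, j)" "i \<in> {..<m}" "j \<in> {..<m}" using p by (cases p) auto
  have "multilinear_form V 2 (sym_form \<kappa> p)"
    unfolding multilinear_form_def
  proof (intro ballI conjI allI impI)
    fix vs u v and l :: nat and c :: complex assume vs: "vs \<in> vectors V 2" and l: "l < 2" and u: "u \<in> V"
    have len: "length vs = 2" and l01: "l = 0 \<or> l = 1" using vectorsD(1)[OF vs] l by auto
    show "sym_form \<kappa> p (vs[l := fscale c u]) = c * sym_form \<kappa> p (vs[l := u])"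
      using l01 len by (auto simp: sym_form_def ij(1) dual_basisD(5)[OF b ij(2) u] dual_basisD(5)[OF b ij(3) u] algebra_simps)
    assume v: "v \<in> V"
    show "sym_form \<kappa> p (vs[l := u + v]) = sym_form \<kappa> p (vs[l := u]) + sym_form \<kappa> p (vs[l := v])"
      using l01 len by (auto simp: sym_form_def ij(1) dual_basisD(4)[OF b ij(2) u v] dual_basisD(4)[OF b ij(3) u v] algebra_simps add_divide_distrib)
  qed
  moreover have "sym_form \<kappa> p vs = sym_form \<kappa> p ws"
    if "vs \<in> vectors V 2" "ws \<in> vectors V 2" "mset vs = mset ws" for vs ws
  proof -
    have "length vs = 2" "length ws = 2" using that by (auto simp: vectors_def)
    then obtain a b c d where "vs = [a, b]" "ws = [c, d]"
      by (auto simp: numeral_2_eq_2 length_Suc_conv)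
    with that(3) show ?thesis by (auto simp: sym_form_def ij(1) add_eq_conv_ex add_mset_eq_single algebra_simps)
  qed
  ultimately show ?thesis unfolding symmetric_forms_def by blast
qed

lemma unitary_basis_symmetric_square:
  assumes u: "unitary_basis n R {..<m} e \<kappa> w"
  shows "unitary_basis n (symmetric_power 2 R) {(i, j). i \<le> j \<and> j < m}
    (\<lambda>p. form_product (symmetric_forms (rep_space R) 2) (sym_tuple e p))
    (\<lambda>p x. x (sym_form \<kappa> p)) (\<lambda>(i, j) y. w i y * w j y)"
proof -
  define V where "V = rep_space R"
  define \<Omega> where "\<Omega> = symmetric_forms V 2"
  define J where "J = {(i, j). i \<le> j \<and> j < m}"
  define t where "t = sym_tuple e"
  define d :: "nat \<Rightarrow> nat \<Rightarrow> complex" where "d i j = (if i = j then 1 else of_real (sqrt 2))" for i j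
  \<comment> \<open>\<open>d\<close> and \<open>c\<close> are the coefficients of
    \<open>sym_tuple\<close> and \<open>sym_form\<close>. For equal indices their product is 1/2 and
    both summands of \<open>sym_form\<close> contribute 1; for distinct ones it is 1 and only one
    summand survives.\<close>
  define c :: "nat \<Rightarrow> nat \<Rightarrow> complex" where "c i j = (if i = j then 1 / 2 else 1 / of_real (sqrt 2))" for i j
  note R = unitary_basisD(1)[OF u] and b = unitary_basisD(2)[OF u, folded V_def]
  note V = dual_basisD(2)[OF b]
  have "J \<subseteq> {..<m} \<times> {..<m}" by (auto simp: J_def)
  then have J: "finite J" by (rule finite_subset) simp
  have eV: "e i \<in> V" if "i < m" for i using dual_basisD(3)[OF b] that by simp
  have t: "t p \<in> vectors V 2" if "p \<in> J" for p
    using that eV fs.subspace_scale[OF V] by (auto simp: J_def t_def sym_tuple_def vectors_def)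
  have \<theta>: "sym_form \<kappa> p \<in> \<Omega>" if "p \<in> J" for p
    unfolding \<Omega>_def by (rule sym_form_symmetric[OF b]) (use that in \<open>auto simp: J_def\<close>)
  have stable: "(\<lambda>vs. \<omega> (map (rep_act R g) vs)) \<in> \<Omega>" if g: "g \<in> GL n" and \<omega>: "\<omega> \<in> \<Omega>" for g \<omega>
  proof -
    note f = is_repD(2)[OF R g, folded V_def]
    have "map (rep_act R g) vs \<in> vectors V 2" if "vs \<in> vectors V 2" for vs
      by (rule vectors_map[OF that linear_map_onD(1)[OF f]])
    then show ?thesis using \<omega> multilinear_form_compose[OF _ f]
      by (auto simp: \<Omega>_def symmetric_forms_def)
  qed
  have entry: "sym_form \<kappa> (i, j) (map f (t (k, l))) =
      c i j * d k l * (\<kappa> i (f (e k)) * \<kappa> j (f (e l)) + \<kappa> j (f (e k)) * \<kappa> i (f (e l)))"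
    if "(i, j) \<in> J" "(k, l) \<in> J" and f: "linear_map_on V V f" for i j k l f
  proof -
    have ij: "i \<in> {..<m}" "j \<in> {..<m}" and k: "k < m" using that by (auto simp: J_def)
    note fk = linear_map_onD(1)[OF f eV[OF k]]
    show ?thesis
      by (simp add: sym_form_def t_def sym_tuple_def linear_map_onD(3)[OF f eV[OF k]]
        dual_basisD(5)[OF b ij(1) fk] dual_basisD(5)[OF b ij(2) fk] c_def d_def algebra_simps)
  qed
  have s2: "complex_of_real (sqrt 2) * complex_of_real (sqrt 2) = 2"
    by (metis of_real_mult of_real_numeral real_sqrt_mult_self abs_numeral)
  have s0: "complex_of_real (sqrt 2) \<noteq> 0" by simp
  have half: "complex_of_real (sqrt 2) / 2 = 1 / complex_of_real (sqrt 2)"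
    using s2 s0 by (simp add: field_simps)
  have diag: "sym_form \<kappa> p (map f (t q)) = (if p = q then h (fst p) * h (snd p) else 0)"
    if p: "p \<in> J" and q: "q \<in> J" and f: "linear_map_on V V f"
      and fe: "\<And>i j. i < m \<Longrightarrow> j < m \<Longrightarrow> \<kappa> i (f (e j)) = (if i = j then h i else 0)" for p q f h
  proof -
    obtain i j k l where *: "p = (i, j)" "q = (k, l)" "i \<le> j" "j < m" "k \<le> l" "l < m"
      using p q by (auto simp: J_def)
    show ?thesis unfolding *(1,2) entry[OF p[unfolded *] q[unfolded *] f]
      using * s0 by (auto simp: fe c_def d_def)
  qed
  have dual: "sym_form \<kappa> p (t q) = (if p = q then 1 else 0)" if "p \<in> J" "q \<in> J" for p q
    using diag[OF that linear_map_on_id, of "\<lambda>_. 1"] dual_basisD(6)[OF b] by simp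
  have expand: "\<omega> vs = (\<Sum>p\<in>J. \<omega> (t p) * sym_form \<kappa> p vs)" if \<omega>: "\<omega> \<in> \<Omega>" and vs: "vs \<in> vectors V 2" for \<omega> vs
  proof -
    define \<eta> where "\<eta> vs = \<omega> vs - (\<Sum>p\<in>J. \<omega> (t p) * sym_form \<kappa> p vs)" for vs
    have m\<eta>: "multilinear_form V 2 \<eta>"
      unfolding \<eta>_def by (rule multilinear_form_linear) (use \<omega> \<theta> in \<open>auto simp: \<Omega>_def symmetric_forms_def\<close>)
    have sym: "\<eta> vs = \<eta> ws" if "vs \<in> vectors V 2" "ws \<in> vectors V 2" "mset vs = mset ws" for vs ws
    proof -
      have "sym_form \<kappa> p vs = sym_form \<kappa> p ws" if "p \<in> J" for p
        using \<theta>[OF that] \<open>vs \<in> _\<close> \<open>ws \<in> _\<close> \<open>mset vs = _\<close> unfolding \<Omega>_def symmetric_forms_def by blast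
      moreover have "\<omega> vs = \<omega> ws" using \<omega> that unfolding \<Omega>_def symmetric_forms_def by blast
      ultimately show ?thesis unfolding \<eta>_def by simp
    qed
    have zt: "\<eta> (t q) = 0" if q: "q \<in> J" for q
    proof -
      have "(\<Sum>p\<in>J. \<omega> (t p) * sym_form \<kappa> p (t q)) = (\<Sum>p\<in>J. if p = q then \<omega> (t p) else 0)"
        using dual q by (intro sum.cong) auto
      then show ?thesis using J q by (simp add: \<eta>_def)
    qed
    have ord: "\<eta> [e i, e j] = 0" if "i \<le> j" "j < m" for i j
    proof -
      have v: "[e i, e j] \<in> vectors V 2" and im: "i < m" using that eV by (auto simp: vectors_def)
      have q: "(i, j) \<in> J" using that by (simp add: J_def)
      have "\<eta> ([e i, e j][0 := fscale (d i j) (e i)]) = d i j * \<eta> ([e i, e j][0 := e i])"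
        by (rule multilinear_formD(2)[OF m\<eta> v _ eV[OF im]]) simp
      moreover have "[e i, e j][0 := fscale (d i j) (e i)] = t (i, j)" by (simp add: t_def sym_tuple_def d_def)
      ultimately show ?thesis using zt[OF q] by (simp add: d_def split: if_splits)
    qed
    have "\<eta> vs = 0"
    proof (rule multilinear_form_eq_0[OF m\<eta> b _ vs])
      fix xs assume "length xs = 2" "set xs \<subseteq> {..<m}"
      then obtain i j where ij: "xs = [i, j]" "i < m" "j < m" by (auto simp: numeral_2_eq_2 length_Suc_conv)
      show "\<eta> (map e xs) = 0"
      proof (cases "i \<le> j")
        case False
        have "\<eta> [e i, e j] = \<eta> [e j, e i]" by (rule sym) (use ij eV in \<open>auto simp: vectors_def\<close>)
        then show ?thesis using ord[of j i] False ij by simp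
      qed (use ord ij in simp)
    qed
    then show ?thesis by (simp add: \<eta>_def)
  qed
  have pow: "symmetric_power 2 R = power_rep \<Omega> 2 R" by (simp add: symmetric_power_def \<Omega>_def V_def)
  have db: "dual_basis (rep_space (symmetric_power 2 R)) J (\<lambda>p. form_product \<Omega> (t p)) (\<lambda>p x. x (sym_form \<kappa> p))"
    unfolding pow using J t \<theta> dual expand unfolding V_def by (rule dual_basis_power_rep)
  have rep: "is_rep n (symmetric_power 2 R)"
    unfolding pow by (rule is_rep_power_rep[OF R db[unfolded pow] stable])
  have act: "rep_act (symmetric_power 2 R) g (form_product \<Omega> (t q)) (sym_form \<kappa> p) = sym_form \<kappa> p (map (rep_act R g) (t q))"
    if "g \<in> GL n" "p \<in> J" for g p q
    unfolding pow using power_rep_act_product[of \<Omega> R g 2 "t q"] stable[OF that(1)] form_product_in[OF \<theta>[OF that(2)]] by simp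
  note lin = is_repD(2)[OF R, folded V_def]
  have "unitary_basis n (symmetric_power 2 R) J (\<lambda>p. form_product \<Omega> (t p)) (\<lambda>p x. x (sym_form \<kappa> p)) (\<lambda>(i, j) y. w i y * w j y)"
    unfolding unitary_basis_def
  proof (intro conjI ballI allI impI)
    show "is_rep n (symmetric_power 2 R)" by (rule rep)
    show "dual_basis (rep_space (symmetric_power 2 R)) J (\<lambda>p. form_product \<Omega> (t p)) (\<lambda>p x. x (sym_form \<kappa> p))" by (rule db)
  next
    fix p q assume p: "p \<in> J" and q: "q \<in> J"
    obtain i j k l where *: "p = (i, j)" "q = (k, l)" "i < m" "j < m" "k < m" "l < m"
      using p q by (auto simp: J_def)
    have "\<forall>i<m. \<forall>j<m. \<exists>p. polynomial_in_entries n p \<and> (\<forall>g\<in>GL n. \<kappa> i (rep_act R g (e j)) = p g)"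
      using unitary_basisD(3)[OF u] by auto
    then obtain r where r: "\<And>i j. i < m \<Longrightarrow> j < m \<Longrightarrow> polynomial_in_entries n (r i j)"
      "\<And>i j g. i < m \<Longrightarrow> j < m \<Longrightarrow> g \<in> GL n \<Longrightarrow> \<kappa> i (rep_act R g (e j)) = r i j g" by metis
    show "\<exists>pl. polynomial_in_entries n pl \<and>
        (\<forall>g\<in>GL n. rep_act (symmetric_power 2 R) g (form_product \<Omega> (t q)) (sym_form \<kappa> p) = pl g)"
    proof (intro exI[of _ "\<lambda>g. c i j * d k l * (r i k g * r j l g + r j k g * r i l g)"] conjI ballI)
      show "polynomial_in_entries n (\<lambda>g. c i j * d k l * (r i k g * r j l g + r j k g * r i l g))"
        using * by (intro polynomial_in_entries.mult polynomial_in_entries.add polynomial_in_entries.const r(1))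
      fix g assume g: "g \<in> GL n"
      show "rep_act (symmetric_power 2 R) g (form_product \<Omega> (t q)) (sym_form \<kappa> p) = c i j * d k l * (r i k g * r j l g + r j k g * r i l g)"
        unfolding act[OF g p] unfolding *(1,2) entry[OF p[unfolded *] q[unfolded *] lin[OF g]] using * by (simp add: r(2)[OF _ _ g])
    qed
  next
    fix g p q assume g: "g \<in> GL n" and p: "p \<in> J" and q: "q \<in> J"
    obtain i j k l where *: "p = (i, j)" "q = (k, l)" "i < m" "j < m" "k < m" "l < m"
      using p q by (auto simp: J_def)
    \<comment> \<open>The adjoint rule needs a factor symmetric in the two index pairs. It is
      symmetric because \<open>c\<close> is half of \<open>d\<close>: sqrt 2 / 2 = 1 / sqrt 2. This
      is what fixes the normalisation.\<close>
    have cd: "c i j * d k l = cnj (c k l * d i j)" using half s0 by (auto simp: c_def d_def field_simps)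
    show "rep_act (symmetric_power 2 R) (adj n g) (form_product \<Omega> (t q)) (sym_form \<kappa> p)
        = cnj (rep_act (symmetric_power 2 R) g (form_product \<Omega> (t p)) (sym_form \<kappa> q))"
      unfolding act[OF g q] act[OF adj_GL[OF g] p] unfolding *(1,2) entry[OF p[unfolded *] q[unfolded *] lin[OF adj_GL[OF g]]]
        entry[OF q[unfolded *] p[unfolded *] lin[OF g]] cd
      using * by (simp add: unitary_basisD(4)[OF u g] algebra_simps)
  next
    fix y p q assume y: "\<forall>l<n. (y l :: complex) \<noteq> 0" and p: "p \<in> J" and q: "q \<in> J"
    have yG: "mat_diag n y \<in> GL n" using mat_diag_GL y by blast
    have "sym_form \<kappa> p (map (rep_act R (mat_diag n y)) (t q)) = (if p = q then w (fst p) y * w (snd p) y else 0)"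
      by (rule diag[OF p q lin[OF yG]]) (use unitary_basisD(5)[OF u] y in auto)
    then show "rep_act (symmetric_power 2 R) (mat_diag n y) (form_product \<Omega> (t q)) (sym_form \<kappa> p)
        = (if p = q then (case p of (i, j) \<Rightarrow> \<lambda>y. w i y * w j y) y else 0)"
      unfolding act[OF yG p] by (simp add: case_prod_beta)
  qed
  then show ?thesis by (simp add: J_def \<Omega>_def t_def V_def)
qed

section \<open>Traces are determined on the torus\<close>

text \<open>What the limit argument uses, shared by the exterior power, which comes with a unitary
  basis, and by the \<open>W \<nu>\<close>, which are only known to be polynomial.\<close>

definition has_polynomial_trace :: "nat \<Rightarrow> 'a rep \<Rightarrow> bool" where
  "has_polynomial_trace n R \<longleftrightarrow> is_rep n R \<and>
     (\<exists>p. polynomial_in_entries n p \<and> (\<forall>g\<in>GL n. trace_on (rep_space R) (rep_act R g) = p g))"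

lemma polynomial_rep_trace:
  assumes "is_polynomial_rep n R"
  shows "has_polynomial_trace n R"
proof -
  have R: "is_rep n R" using assms by (simp add: is_polynomial_rep_def)
  obtain B where B: "is_basis (rep_space R) B"
    and "\<forall>b\<in>B. \<forall>c\<in>B. \<exists>p. polynomial_in_entries n p \<and> (\<forall>g\<in>GL n. matrix_entry B (rep_act R g) b c = p g)"
    using assms unfolding is_polynomial_rep_def by blast
  then have "\<forall>b\<in>B. \<exists>p. polynomial_in_entries n p \<and> (\<forall>g\<in>GL n. matrix_entry B (rep_act R g) b b = p g)" by blast
  from bchoice[OF this] obtain q where q: "\<And>b. b \<in> B \<Longrightarrow> polynomial_in_entries n (q b)"
    "\<And>b g. b \<in> B \<Longrightarrow> g \<in> GL n \<Longrightarrow> matrix_entry B (rep_act R g) b b = q b g" by blast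
  obtain C where C: "is_basis (rep_space R) C" "finite C" by (rule is_rep_basis[OF R])
  \<comment> \<open>The basis in the definition of a polynomial representation carries no claim of
    finiteness; it is finite as an independent set in a finite dimensional space.\<close>
  have fin: "finite B"
    using fs.independent_span_bound[of C B] B C fs.span_superset[of B] by (auto simp: is_basis_def)
  have "trace_on (rep_space R) (rep_act R g) = (\<Sum>b\<in>B. q b g)" if g: "g \<in> GL n" for g
    unfolding trace_on_dual_basis[OF dual_basis_of_basis[OF B fin] is_repD(2)[OF R g]]
    using q(2)[OF _ g] by (simp add: matrix_entry_def)
  then show ?thesis unfolding has_polynomial_trace_def
    by (intro conjI R exI[of _ "\<lambda>g. \<Sum>b\<in>B. q b g"] polynomial_sum[OF fin] q(1)) auto
qed

lemma unitary_basis_polynomial_trace: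
  assumes u: "unitary_basis n R I e \<kappa> w"
  shows "has_polynomial_trace n R"
proof -
  note R = unitary_basisD(1)[OF u] and b = unitary_basisD(2)[OF u]
  have "\<forall>i\<in>I. \<exists>p. polynomial_in_entries n p \<and> (\<forall>g\<in>GL n. \<kappa> i (rep_act R g (e i)) = p g)"
    using unitary_basisD(3)[OF u] by blast
  from bchoice[OF this] obtain q where q: "\<And>b. b \<in> I \<Longrightarrow> polynomial_in_entries n (q b)"
    "\<And>i g. i \<in> I \<Longrightarrow> g \<in> GL n \<Longrightarrow> \<kappa> i (rep_act R g (e i)) = q i g" by blast
  have "trace_on (rep_space R) (rep_act R g) = (\<Sum>i\<in>I. q i g)" if g: "g \<in> GL n" for g
    unfolding trace_on_dual_basis[OF b is_repD(2)[OF R g]] using q(2)[OF _ g] by simp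
  then show ?thesis unfolding has_polynomial_trace_def
    by (intro conjI R exI[of _ "\<lambda>g. \<Sum>i\<in>I. q i g"] polynomial_sum[OF dual_basisD(1)[OF b]] q(1)) auto
qed

lemma isCont_polynomial_in_entries:
  assumes "polynomial_in_entries n p" "\<And>i j. i < n \<Longrightarrow> j < n \<Longrightarrow> isCont (\<lambda>s :: complex. M s $$ (i, j)) a"
  shows "isCont (\<lambda>s. p (M s)) a"
  using assms by (induction rule: polynomial_in_entries.induct) (auto intro!: continuous_intros)

lemma upper_triangular_GL:
  assumes B: "B \<in> carrier_mat n n" and u: "upper_triangular B"
  shows "B \<in> GL n \<longleftrightarrow> (\<forall>i<n. B $$ (i, i) \<noteq> 0)"
proof -
  have det: "det B = (\<Prod>i<n. B $$ (i, i))"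
    using det_upper_triangular[OF u B] B by (simp add: prod_list_diag_prod atLeast0LessThan)
  have "B \<in> GL n \<longleftrightarrow> det B \<noteq> 0"
  proof
    assume "B \<in> GL n"
    then obtain h where h: "h \<in> carrier_mat n n" "B * h = 1\<^sub>m n" by (auto simp: GL_iff)
    then show "det B \<noteq> 0" using det_mult[OF B h(1)] by auto
  next
    assume "det B \<noteq> 0"
    from det_non_zero_imp_unit[OF B this, of "()"] obtain h where "h \<in> carrier_mat n n" "B * h = 1\<^sub>m n" "h * B = 1\<^sub>m n"
      unfolding Units_def ring_mat_def by auto
    then show "B \<in> GL n" using B by (auto simp: GL_iff)
  qed
  then show ?thesis using det by auto
qed

lemma trace_conj:
  assumes R: "is_rep n R" and g: "g \<in> GL n" and h: "h \<in> GL n" and k: "k \<in> GL n" and hk: "k * h = 1\<^sub>m n"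
  shows "trace_on (rep_space R) (rep_act R (h * g * k)) = trace_on (rep_space R) (rep_act R g)"
proof -
  obtain C where C: "is_basis (rep_space R) C" "finite C" by (rule is_rep_basis[OF R])
  note b = dual_basis_of_basis[OF C] and lin = is_repD(2)[OF R]
  have hg: "h * g \<in> GL n" and gk: "k * (h * g) \<in> GL n" by (intro GL_mult g h k)+
  have "trace_on (rep_space R) (rep_act R (h * g * k)) = trace_on (rep_space R) (\<lambda>v. rep_act R (h * g) (rep_act R k v))"
    by (rule trace_on_cong[OF b lin[OF GL_mult[OF hg k]]]) (rule is_repD(4)[OF R hg k])
  also have "\<dots> = trace_on (rep_space R) (\<lambda>v. rep_act R k (rep_act R (h * g) v))"
    by (rule trace_on_comm[OF b lin[OF hg] lin[OF k]])
  also have "\<dots> = trace_on (rep_space R) (rep_act R (k * (h * g)))"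
    by (rule trace_on_cong[OF b lin[OF gk], symmetric]) (rule is_repD(4)[OF R k hg])
  also have "k * (h * g) = g"
    using assoc_mult_mat[OF GL_carrier[OF k] GL_carrier[OF h] GL_carrier[OF g]] hk GL_carrier[OF g] by simp
  finally show ?thesis .
qed

text \<open>Conjugation by \<open>diag(1, s, s\<^sup>2, \<dots>)\<close> scales the entries above the diagonal by positive powers
  of \<open>s\<close>, and \<open>s \<rightarrow> 0\<close> leaves the diagonal part.\<close>

lemma trace_upper_triangular:
  assumes tr: "has_polynomial_trace n R" and B: "B \<in> GL n" and u: "upper_triangular B"
  shows "trace_on (rep_space R) (rep_act R B) = trace_on (rep_space R) (rep_act R (mat_diag n (\<lambda>i. B $$ (i, i))))"
proof -
  obtain p where R: "is_rep n R" and p: "polynomial_in_entries n p"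
    and pt: "\<And>g. g \<in> GL n \<Longrightarrow> trace_on (rep_space R) (rep_act R g) = p g"
    using tr by (auto simp: has_polynomial_trace_def)
  note Bc = GL_carrier[OF B]
  \<comment> \<open>Given by its entries rather than as a conjugate of \<open>B\<close>, so that it
    makes sense at \<open>s = 0\<close>, where \<open>0 ^ 0 = 1\<close> keeps exactly the
    diagonal.\<close>
  define M where "M s = mat n n (\<lambda>(i, j). if i \<le> j then B $$ (i, j) * s ^ (j - i) else 0)" for s :: complex
  have nz: "B $$ (i, i) \<noteq> 0" if "i < n" for i using upper_triangular_GL[OF Bc u] B that by blast
  have "isCont (\<lambda>s. p (M s)) 0"
  proof (rule isCont_polynomial_in_entries[OF p])
    show "isCont (\<lambda>s. M s $$ (i, j)) 0" if "i < n" "j < n" for i j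
      using that by (cases "i \<le> j") (auto simp: M_def intro!: continuous_intros)
  qed
  then have lim: "((\<lambda>s. p (M s)) \<longlongrightarrow> p (M 0)) (at 0)" by (simp add: isCont_def)
  have "p (M s) = p B" if s: "s \<noteq> 0" for s
  proof -
    define h where "h = mat_diag n (\<lambda>i. inverse s ^ i)"
    define k where "k = mat_diag n (\<lambda>i. s ^ i)"
    have hG: "h \<in> GL n" "k \<in> GL n" unfolding h_def k_def by (rule mat_diag_GL, use s in simp)+
    have kh: "k * h = 1\<^sub>m n" unfolding k_def h_def using s by (simp add: power_mult_distrib[symmetric])
    have "M s = h * B * k"
      unfolding h_def k_def mat_diag_mult_left[OF Bc]
      by (subst mat_diag_mult_right[of _ n n], simp, rule eq_matI)
        (use s Bc upper_triangularD[OF u] in \<open>auto simp: M_def power_diff field_simps\<close>)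
    then show ?thesis using trace_conj[OF R B hG kh] pt[OF B] pt[OF GL_mult[OF GL_mult[OF hG(1) B] hG(2)]] by simp
  qed
  then have "((\<lambda>s. p (M s)) \<longlongrightarrow> p B) (at 0)"
    by (intro tendsto_eventually) (auto simp: eventually_at_filter)
  from tendsto_unique[OF _ lim this] have "p (M 0) = p B" by simp
  moreover have "M 0 = mat_diag n (\<lambda>i. B $$ (i, i))"
    by (rule eq_matI) (auto simp: M_def mat_diag_def power_0_left)
  moreover have "mat_diag n (\<lambda>i. B $$ (i, i)) \<in> GL n" by (rule mat_diag_GL) (rule nz)
  ultimately show ?thesis using pt B by simp
qed

lemma GL_triangular_form:
  assumes g: "g \<in> GL n"
  obtains B P Q where "B \<in> GL n" "upper_triangular B" "P \<in> GL n" "Q \<in> GL n" "Q * P = 1\<^sub>m n" "g = P * B * Q"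
proof -
  note gc = GL_carrier[OF g]
  obtain es where es: "char_poly g = (\<Prod>e\<leftarrow>es. [:- e, 1:])" using char_poly_factorized[OF gc] by auto
  obtain B P Q where "schur_decomposition g es = (B, P, Q)" by (cases "schur_decomposition g es") auto
  from schur_decomposition[OF gc es this] have sim: "similar_mat_wit g B P Q" and u: "upper_triangular B" by auto
  note s = similar_mat_witD2[OF gc sim]
  have PQ: "P \<in> GL n" "Q \<in> GL n" using s by (auto simp: GL_iff)
  have "Q * g * P = B"
    using similar_mat_witD2(3)[OF s(5) similar_mat_wit_sym[OF sim]] by simp
  then have B: "B \<in> GL n" using GL_mult[OF GL_mult[OF PQ(2) g] PQ(1)] by simp
  show ?thesis by (rule that[OF B u PQ s(2,3)])
qed

lemma trace_triangular_form:
  assumes tr: "has_polynomial_trace n R" and B: "B \<in> GL n" "upper_triangular B"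
    and PQ: "P \<in> GL n" "Q \<in> GL n" "Q * P = 1\<^sub>m n" and g: "g = P * B * Q"
  shows "trace_on (rep_space R) (rep_act R g) = trace_on (rep_space R) (rep_act R (mat_diag n (\<lambda>i. B $$ (i, i))))"
  using trace_upper_triangular[OF tr B] trace_conj[OF _ B(1) PQ, of R] tr
  by (simp add: has_polynomial_trace_def g)

section \<open>Schur polynomials as quotients of alternants\<close>

text \<open>Row lengths are a function on a fixed number of rows, with zero rows allowed: removing
  the largest letter then simply lowers the number of rows by one.\<close>

definition row_diagram :: "nat \<Rightarrow> (nat \<Rightarrow> nat) \<Rightarrow> (nat \<times> nat) set" where
  "row_diagram n \<nu> = {(i, j). 1 \<le> i \<and> i \<le> n \<and> 1 \<le> j \<and> j \<le> \<nu> i}"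

definition tableaux :: "nat \<Rightarrow> (nat \<Rightarrow> nat) \<Rightarrow> (nat \<times> nat \<Rightarrow> nat) set" where
  "tableaux n \<nu> = {T \<in> row_diagram n \<nu> \<rightarrow>\<^sub>E {1..n}.
     (\<forall>i j j'. (i, j) \<in> row_diagram n \<nu> \<and> (i, j') \<in> row_diagram n \<nu> \<and> j < j' \<longrightarrow> T (i, j) \<le> T (i, j')) \<and>
     (\<forall>i i' j. (i, j) \<in> row_diagram n \<nu> \<and> (i', j) \<in> row_diagram n \<nu> \<and> i < i' \<longrightarrow> T (i, j) < T (i', j))}"

definition tableau_sum :: "nat \<Rightarrow> (nat \<Rightarrow> nat) \<Rightarrow> (nat \<Rightarrow> complex) \<Rightarrow> complex" where
  "tableau_sum n \<nu> x = (\<Sum>T\<in>tableaux n \<nu>. \<Prod>c\<in>row_diagram n \<nu>. x (T c))"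

lemma row_diagram_Sigma: "row_diagram n \<nu> = Sigma {1..n} (\<lambda>i. {1..\<nu> i})"
  by (auto simp: row_diagram_def)

lemma row_diagram_0 [simp]: "row_diagram 0 \<nu> = {}"
  by (auto simp: row_diagram_def)

lemma finite_row_diagram [simp]: "finite (row_diagram n \<nu>)"
  by (simp add: row_diagram_Sigma)

lemma card_row_diagram: "card (row_diagram n \<nu>) = (\<Sum>i=1..n. \<nu> i)"
  by (simp add: row_diagram_Sigma)

lemma finite_tableaux [simp]: "finite (tableaux n \<nu>)"
  unfolding tableaux_def by (rule finite_subset[OF _ finite_PiE[of "row_diagram n \<nu>" "\<lambda>_. {1..n}"]]) auto

lemma tableauxD:
  assumes "T \<in> tableaux n \<nu>"
  shows "\<And>i j. (i, j) \<in> row_diagram n \<nu> \<Longrightarrow> 1 \<le> T (i, j) \<and> T (i, j) \<le> n"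
    "\<And>c. c \<notin> row_diagram n \<nu> \<Longrightarrow> T c = undefined"
    "\<And>i j j'. (i, j) \<in> row_diagram n \<nu> \<Longrightarrow> (i, j') \<in> row_diagram n \<nu> \<Longrightarrow> j \<le> j' \<Longrightarrow> T (i, j) \<le> T (i, j')"
    "\<And>i i' j. (i, j) \<in> row_diagram n \<nu> \<Longrightarrow> (i', j) \<in> row_diagram n \<nu> \<Longrightarrow> i < i' \<Longrightarrow> T (i, j) < T (i', j)"
proof -
  have row: "\<forall>i j j'. (i, j) \<in> row_diagram n \<nu> \<and> (i, j') \<in> row_diagram n \<nu> \<and> j < j' \<longrightarrow> T (i, j) \<le> T (i, j')"
    and col: "\<forall>i i' j. (i, j) \<in> row_diagram n \<nu> \<and> (i', j) \<in> row_diagram n \<nu> \<and> i < i' \<longrightarrow> T (i, j) < T (i', j)"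
    and PiE: "T \<in> row_diagram n \<nu> \<rightarrow>\<^sub>E {1..n}" using assms by (auto simp: tableaux_def)
  show "1 \<le> T (i, j) \<and> T (i, j) \<le> n" if "(i, j) \<in> row_diagram n \<nu>" for i j
    using PiE_mem[OF PiE that] by simp
  show "T c = undefined" if "c \<notin> row_diagram n \<nu>" for c using PiE_arb[OF PiE that] .
  show "T (i, j) \<le> T (i, j')" if "(i, j) \<in> row_diagram n \<nu>" "(i, j') \<in> row_diagram n \<nu>" "j \<le> j'" for i j j'
    using row that by (cases "j = j'") auto
  show "T (i, j) < T (i', j)" if "(i, j) \<in> row_diagram n \<nu>" "(i', j) \<in> row_diagram n \<nu>" "i < i'" for i i' j
    using col that by blast
qed

text \<open>Columns increase strictly and start with at least 1. In particular the last of
  \<open>n\<close> rows contains only the letter \<open>n\<close>.\<close>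

lemma tableau_ge_row:
  assumes T: "T \<in> tableaux n \<nu>" and anti: "\<And>i. 1 \<le> i \<Longrightarrow> i < n \<Longrightarrow> \<nu> (Suc i) \<le> \<nu> i"
  shows "(i, j) \<in> row_diagram n \<nu> \<Longrightarrow> i \<le> T (i, j)"
proof (induction i)
  case (Suc i)
  show ?case
  proof (cases "i = 0")
    case False
    then have "(i, j) \<in> row_diagram n \<nu>" using Suc.prems anti[of i] by (auto simp: row_diagram_def)
    with Suc.IH tableauxD(4)[OF T this Suc.prems] show ?thesis by simp
  qed (use tableauxD(1)[OF T Suc.prems] in simp)
qed simp

text \<open>The cells with entries at most \<open>n\<close> form a tableau whose shape interlaces
  \<nu>, since the cells with the letter n + 1 are at the ends of rows and no two of them share a
  column. Conversely any tableau of an interlacing shape extends uniquely.\<close>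

lemma tableau_sum_branching:
  assumes anti: "\<And>i. 1 \<le> i \<Longrightarrow> i \<le> n \<Longrightarrow> \<nu> (Suc i) \<le> \<nu> i"
  shows "tableau_sum (Suc n) \<nu> x = (\<Sum>\<mu>\<in>Pi\<^sub>E {1..n} (\<lambda>i. {\<nu> (Suc i)..\<nu> i}).
    tableau_sum n \<mu> x * x (Suc n) ^ ((\<Sum>i=1..Suc n. \<nu> i) - (\<Sum>i=1..n. \<mu> i)))"
proof -
  have anti_le: "\<nu> b \<le> \<nu> a" if "1 \<le> a" "a \<le> b" "b \<le> Suc n" for a b
    using that(2,3)
  proof (induction b rule: dec_induct)
    case (step b)
    then show ?case using anti[of b] that(1) by simp
  qed simp
  define D where "D = row_diagram (Suc n) \<nu>"
  define M where "M = Pi\<^sub>E {1..n} (\<lambda>i. {\<nu> (Suc i)..\<nu> i})"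
  define shape where "shape T = restrict (\<lambda>i. card {j. 1 \<le> j \<and> j \<le> \<nu> i \<and> T (i, j) \<le> n}) {1..n}" for T :: "nat \<times> nat \<Rightarrow> nat"
  \<comment> \<open>The inverse construction fills the remaining cells with the new letter;
    \<open>undefined\<close> outside \<open>D\<close> is what the extensional function space
    demands.\<close>
  define ext where "ext \<mu> T' = (\<lambda>c. if c \<in> row_diagram n \<mu> then T' c else if c \<in> D then Suc n else undefined)"
    for \<mu> and T' :: "nat \<times> nat \<Rightarrow> nat"
  have sub: "row_diagram n \<mu> \<subseteq> D" if "\<mu> \<in> M" for \<mu>
  proof clarify
    fix i j assume "(i, j) \<in> row_diagram n \<mu>"
    moreover from this have "\<mu> i \<le> \<nu> i" using that by (auto simp: M_def row_diagram_def PiE_iff)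
    ultimately show "(i, j) \<in> D" by (auto simp: D_def row_diagram_def)
  qed
  have small: "T (i, j) \<le> n \<longleftrightarrow> (i, j) \<in> row_diagram n (shape T)"
    if T: "T \<in> tableaux (Suc n) \<nu>" and ij: "(i, j) \<in> D" for T i j
  proof -
    note TD = tableauxD[OF T, folded D_def]
    have i: "1 \<le> i" "i \<le> Suc n" "1 \<le> j" "j \<le> \<nu> i" using ij by (auto simp: D_def row_diagram_def)
    have last: "\<not> T (i, j) \<le> n" if "i = Suc n"
      using tableau_ge_row[OF T, of i j] anti ij that by (auto simp: D_def)
    have in_D: "(i, j') \<in> D \<longleftrightarrow> 1 \<le> j' \<and> j' \<le> \<nu> i" for j' using i by (auto simp: D_def row_diagram_def)
    define A where "A = {j. 1 \<le> j \<and> j \<le> \<nu> i \<and> T (i, j) \<le> n}"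
    have fin: "finite A" unfolding A_def by simp
    have down: "j' \<in> A" if "j'' \<in> A" "1 \<le> j'" "j' \<le> j''" for j' j''
      using that TD(3)[of i j' j''] in_D by (auto simp: A_def)
    \<comment> \<open>Rows increase weakly, so the cells with small entries are an initial segment
      of the row, determined by its length.\<close>
    have initial: "j' \<in> A \<longleftrightarrow> 1 \<le> j' \<and> j' \<le> card A" for j'
    proof
      assume j': "j' \<in> A"
      then have "{1..j'} \<subseteq> A" using down by auto
      from card_mono[OF fin this] j' show "1 \<le> j' \<and> j' \<le> card A" by (auto simp: A_def)
    next
      assume j': "1 \<le> j' \<and> j' \<le> card A"
      show "j' \<in> A"
      proof (rule ccontr)
        assume "j' \<notin> A"
        then have "A \<subseteq> {1..<j'}" using down j' by (fastforce simp: A_def not_less)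
        from card_mono[OF _ this] j' show False by (cases j') auto
      qed
    qed
    have "T (i, j) \<le> n \<longleftrightarrow> j \<in> A" using i by (simp add: A_def)
    then have le: "T (i, j) \<le> n \<longleftrightarrow> j \<le> card A" using i by (simp add: initial)
    show ?thesis
    proof (cases "i \<le> n")
      case True
      then have "shape T i = card A" using i by (simp add: shape_def A_def)
      then show ?thesis using i True by (simp add: le row_diagram_def)
    next
      case False
      then show ?thesis using i last by (simp add: row_diagram_def)
    qed
  qed
  have shapeM: "shape T \<in> M" if T: "T \<in> tableaux (Suc n) \<nu>" for T
  proof -
    note TD = tableauxD[OF T, folded D_def]
    have "\<nu> (Suc i) \<le> shape T i \<and> shape T i \<le> \<nu> i" if i: "i \<in> {1..n}" for i
    proof
      \<comment> \<open>An entry with a cell below it is smaller than an entry that is at most n +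
        1.\<close>
      have "{1..\<nu> (Suc i)} \<subseteq> {j. 1 \<le> j \<and> j \<le> \<nu> i \<and> T (i, j) \<le> n}"
      proof
        fix j assume j: "j \<in> {1..\<nu> (Suc i)}"
        have a: "(i, j) \<in> D" "(Suc i, j) \<in> D" using i j anti[of i] by (auto simp: D_def row_diagram_def)
        have "T (i, j) < T (Suc i, j)" by (rule TD(4)[OF a]) simp
        then show "j \<in> {j. 1 \<le> j \<and> j \<le> \<nu> i \<and> T (i, j) \<le> n}" using TD(1)[OF a(2)] i j anti[of i] by auto
      qed
      from card_mono[OF _ this] show "\<nu> (Suc i) \<le> shape T i" using i by (simp add: shape_def)
      have "{j. 1 \<le> j \<and> j \<le> \<nu> i \<and> T (i, j) \<le> n} \<subseteq> {1..\<nu> i}" by auto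
      from card_mono[OF _ this] show "shape T i \<le> \<nu> i" using i by (simp add: shape_def)
    qed
    then show ?thesis by (auto simp: M_def PiE_iff shape_def extensional_def)
  qed
  have restr: "restrict T (row_diagram n (shape T)) \<in> tableaux n (shape T)"
    if T: "T \<in> tableaux (Suc n) \<nu>" for T
  proof -
    note TD = tableauxD[OF T, folded D_def] and s = sub[OF shapeM[OF T]]
    have "1 \<le> T (i, j) \<and> T (i, j) \<le> n" if "(i, j) \<in> row_diagram n (shape T)" for i j
      using small[OF T] that s TD(1)[of i j] by auto
    then show ?thesis using TD(3,4) s unfolding tableaux_def by (auto simp: subset_eq)
  qed
  have ext_tab: "ext \<mu> T' \<in> tableaux (Suc n) \<nu>" if \<mu>: "\<mu> \<in> M" and T': "T' \<in> tableaux n \<mu>" for \<mu> T'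
  proof -
    note TD = tableauxD[OF T']
    have val: "ext \<mu> T' c = (if c \<in> row_diagram n \<mu> then T' c else Suc n)" if "c \<in> D" for c
      using that by (simp add: ext_def)
    have le: "T' c \<le> n" "1 \<le> T' c" if "c \<in> row_diagram n \<mu>" for c using TD(1) that by (cases c; auto)+
    have "ext \<mu> T' (i, j) \<le> ext \<mu> T' (i, j')" if "(i, j) \<in> D" "(i, j') \<in> D" "j < j'" for i j j'
    proof (cases "(i, j') \<in> row_diagram n \<mu>")
      case True
      then have "(i, j) \<in> row_diagram n \<mu>" using that by (auto simp: row_diagram_def D_def)
      then show ?thesis using True TD(3) that by (simp add: val)
    next
      case False
      then show ?thesis using le that by (auto simp: val intro: le_SucI)
    qed
    moreover have "ext \<mu> T' (i, j) < ext \<mu> T' (i', j)" if ij: "(i, j) \<in> D" "(i', j) \<in> D" "i < i'" for i i' j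
    proof -
      have mono: "\<nu> i' \<le> \<nu> (Suc i)"
        using anti_le[of "Suc i" i'] ij by (auto simp: D_def row_diagram_def)
      have "\<nu> (Suc i) \<le> \<mu> i" using \<mu> ij by (auto simp: M_def PiE_iff D_def row_diagram_def)
      then have 1: "(i, j) \<in> row_diagram n \<mu>" using mono ij by (auto simp: D_def row_diagram_def)
      show ?thesis
      proof (cases "(i', j) \<in> row_diagram n \<mu>")
        case True
        then show ?thesis using TD(4)[OF 1 True] ij 1 by (simp add: val)
      next
        case False
        then show ?thesis using le(1)[OF 1] ij 1 by (simp add: val)
      qed
    qed
    moreover have "ext \<mu> T' \<in> D \<rightarrow>\<^sub>E {1..Suc n}"
    proof (rule PiE_I)
      show "ext \<mu> T' c \<in> {1..Suc n}" if "c \<in> D" for c using le[of c] that by (auto simp: val)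
      show "ext \<mu> T' c = undefined" if "c \<notin> D" for c using that sub[OF \<mu>] by (auto simp: ext_def)
    qed
    ultimately show ?thesis unfolding tableaux_def D_def[symmetric] by blast
  qed
  have shape_ext: "shape (ext \<mu> T') = \<mu>" if \<mu>: "\<mu> \<in> M" and T': "T' \<in> tableaux n \<mu>" for \<mu> T'
  proof
    fix i
    show "shape (ext \<mu> T') i = \<mu> i"
    proof (cases "i \<in> {1..n}")
      case True
      have mi: "\<mu> i \<le> \<nu> i" using \<mu> True by (auto simp: M_def PiE_iff)
      have "{j. 1 \<le> j \<and> j \<le> \<nu> i \<and> ext \<mu> T' (i, j) \<le> n} = {1..\<mu> i}"
      proof (rule Set.set_eqI)
        fix j
        show "j \<in> {j. 1 \<le> j \<and> j \<le> \<nu> i \<and> ext \<mu> T' (i, j) \<le> n} \<longleftrightarrow> j \<in> {1..\<mu> i}"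
          using True mi tableauxD(1)[OF T', of i j] by (auto simp: ext_def D_def row_diagram_def)
      qed
      then show ?thesis using True by (simp add: shape_def)
    next
      case False
      then show ?thesis using \<mu> by (auto simp: shape_def M_def PiE_iff extensional_def)
    qed
  qed
  have "tableau_sum (Suc n) \<nu> x =
      (\<Sum>(\<mu>, T')\<in>Sigma M (tableaux n). (\<Prod>c\<in>row_diagram n \<mu>. x (T' c)) * x (Suc n) ^ card (D - row_diagram n \<mu>))"
    unfolding tableau_sum_def D_def[symmetric]
  proof (rule sum.reindex_bij_witness[where i = "\<lambda>(\<mu>, T'). ext \<mu> T'" and j = "\<lambda>T. (shape T, restrict T (row_diagram n (shape T)))"])
    fix T assume T: "T \<in> tableaux (Suc n) \<nu>"
    note s = sub[OF shapeM[OF T]]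
    have big: "T c = Suc n" if "c \<in> D - row_diagram n (shape T)" for c
      using small[OF T, of "fst c" "snd c"] tableauxD(1)[OF T, folded D_def, of "fst c" "snd c"] that by auto
    show "(case (shape T, restrict T (row_diagram n (shape T))) of (\<mu>, T') \<Rightarrow> ext \<mu> T') = T"
      using big tableauxD(2)[OF T, folded D_def] s by (auto simp: ext_def fun_eq_iff)
    show "(shape T, restrict T (row_diagram n (shape T))) \<in> Sigma M (tableaux n)"
      using shapeM[OF T] restr[OF T] by simp
    have "(\<Prod>c\<in>D. x (T c)) = (\<Prod>c\<in>row_diagram n (shape T). x (T c)) * (\<Prod>c\<in>D - row_diagram n (shape T). x (T c))"
      using s by (subst prod.subset_diff[OF s]) (auto simp: D_def mult.commute)
    also have "(\<Prod>c\<in>D - row_diagram n (shape T). x (T c)) = x (Suc n) ^ card (D - row_diagram n (shape T))"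
      using big by simp
    finally show "(case (shape T, restrict T (row_diagram n (shape T))) of (\<mu>, T') \<Rightarrow>
        (\<Prod>c\<in>row_diagram n \<mu>. x (T' c)) * x (Suc n) ^ card (D - row_diagram n \<mu>)) = (\<Prod>c\<in>D. x (T c))" by simp
  next
    fix q assume q: "q \<in> Sigma M (tableaux n)"
    obtain \<mu> T' where *: "q = (\<mu>, T')" "\<mu> \<in> M" "T' \<in> tableaux n \<mu>" using q by auto
    show "(case q of (\<mu>, T') \<Rightarrow> ext \<mu> T') \<in> tableaux (Suc n) \<nu>" using ext_tab * by simp
    have "restrict (ext \<mu> T') (row_diagram n \<mu>) = T'"
      using tableauxD(2)[OF *(3)] by (auto simp: fun_eq_iff ext_def)
    then show "(shape (case q of (\<mu>, T') \<Rightarrow> ext \<mu> T'), restrict (case q of (\<mu>, T') \<Rightarrow> ext \<mu> T') (row_diagram n (shape (case q of (\<mu>, T') \<Rightarrow> ext \<mu> T')))) = q"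
      using * by (simp add: shape_ext)
  qed
  also have "\<dots> = (\<Sum>\<mu>\<in>M. \<Sum>T'\<in>tableaux n \<mu>. (\<Prod>c\<in>row_diagram n \<mu>. x (T' c)) * x (Suc n) ^ card (D - row_diagram n \<mu>))"
    by (rule sum.Sigma[symmetric]) (auto simp: M_def intro!: finite_PiE)
  also have "\<dots> = (\<Sum>\<mu>\<in>M. tableau_sum n \<mu> x * x (Suc n) ^ ((\<Sum>i=1..Suc n. \<nu> i) - (\<Sum>i=1..n. \<mu> i)))"
  proof (rule sum.cong[OF refl])
    fix \<mu> assume \<mu>: "\<mu> \<in> M"
    have "card (D - row_diagram n \<mu>) = (\<Sum>i=1..Suc n. \<nu> i) - (\<Sum>i=1..n. \<mu> i)"
      using card_Diff_subset[OF _ sub[OF \<mu>]] unfolding D_def card_row_diagram by simp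
    then show "(\<Sum>T'\<in>tableaux n \<mu>. (\<Prod>c\<in>row_diagram n \<mu>. x (T' c)) * x (Suc n) ^ card (D - row_diagram n \<mu>))
        = tableau_sum n \<mu> x * x (Suc n) ^ ((\<Sum>i=1..Suc n. \<nu> i) - (\<Sum>i=1..n. \<mu> i))"
      by (simp add: tableau_sum_def sum_distrib_right)
  qed
  finally show ?thesis by (simp add: M_def)
qed

section \<open>Alternants and the bialternant formula\<close>

definition vandermonde :: "nat \<Rightarrow> (nat \<Rightarrow> complex) \<Rightarrow> complex" where
  "vandermonde n x = (\<Prod>j=1..n. \<Prod>i=1..<j. x i - x j)"

definition alternant :: "nat \<Rightarrow> (nat \<Rightarrow> nat) \<Rightarrow> (nat \<Rightarrow> complex) \<Rightarrow> complex" where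
  "alternant n l x = det (mat n n (\<lambda>(i, j). x (Suc j) ^ l (Suc i)))"

lemma vandermonde_Suc: "vandermonde (Suc n) x = vandermonde n x * (\<Prod>i=1..n. x i - x (Suc n))"
  by (simp add: vandermonde_def atLeastLessThanSuc_atLeastAtMost)

lemma prod_Suc_shift: "(\<Prod>i = 0..<n. G (Suc i)) = (\<Prod>i=1..n. (G i :: complex))"
  by (simp add: prod.shift_bounds_Suc_ivl[symmetric] atLeastLessThanSuc_atLeastAtMost)

text \<open>Multilinearity in all rows at once: each choice of one summand per row is a function
  \<open>g\<close>, and the factors \<open>d j\<close> common to a column come out.\<close>

lemma det_sum_rows:
  fixes f :: "nat \<Rightarrow> nat \<Rightarrow> nat \<Rightarrow> complex"
  assumes "\<And>i. i \<in> {1..n} \<Longrightarrow> finite (S i)"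
  shows "det (mat n n (\<lambda>(i, j). d j * (\<Sum>k\<in>S (Suc i). c (Suc i) k * f (Suc i) k j))) =
    (\<Prod>j<n. d j) * (\<Sum>g\<in>Pi\<^sub>E {1..n} S. (\<Prod>i=1..n. c i (g i)) * det (mat n n (\<lambda>(i, j). f (Suc i) (g (Suc i)) j)))"
proof -
  note shift = prod_Suc_shift[of _ n]
  have "det (mat n n (\<lambda>(i, j). d j * (\<Sum>k\<in>S (Suc i). c (Suc i) k * f (Suc i) k j))) =
      (\<Sum>p | p permutes {0..<n}. signof p * (\<Prod>i = 0..<n. d (p i) * (\<Sum>k\<in>S (Suc i). c (Suc i) k * f (Suc i) k (p i))))"
    by (subst det_def'[of _ n]) (auto intro!: sum.cong prod.cong dest: permutes_in_image)
  also have "\<dots> = (\<Sum>p | p permutes {0..<n}. signof p * ((\<Prod>j<n. d j) *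
      (\<Sum>g\<in>Pi\<^sub>E {1..n} S. (\<Prod>i=1..n. c i (g i)) * (\<Prod>i = 0..<n. f (Suc i) (g (Suc i)) (p i)))))"
  proof (rule sum.cong[OF refl])
    fix p assume "p \<in> {p. p permutes {0..<n}}"
    then have p: "p permutes {0..<n}" by simp
    have "(\<Prod>i = 0..<n. d (p i)) = (\<Prod>j<n. d j)"
      using prod.permute[OF p, of d] by (simp add: comp_def atLeast0LessThan)
    moreover have "(\<Prod>i = 0..<n. \<Sum>k\<in>S (Suc i). c (Suc i) k * f (Suc i) k (p i))
        = (\<Sum>g\<in>Pi\<^sub>E {1..n} S. (\<Prod>i=1..n. c i (g i)) * (\<Prod>i = 0..<n. f (Suc i) (g (Suc i)) (p i)))"
      using shift[of "\<lambda>i. \<Sum>k\<in>S i. c i k * f i k (p (i - 1))"] prod_sum_PiE[of "{1..n}" S "\<lambda>i k. c i k * f i k (p (i - 1))"] assms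
        shift[of "\<lambda>i. f i (g i) (p (i - 1))" for g]
      by (simp add: prod.distrib)
    ultimately show "signof p * (\<Prod>i = 0..<n. d (p i) * (\<Sum>k\<in>S (Suc i). c (Suc i) k * f (Suc i) k (p i)))
        = signof p * ((\<Prod>j<n. d j) * (\<Sum>g\<in>Pi\<^sub>E {1..n} S. (\<Prod>i=1..n. c i (g i)) * (\<Prod>i = 0..<n. f (Suc i) (g (Suc i)) (p i))))"
      by (simp add: prod.distrib)
  qed
  also have "\<dots> = (\<Sum>p | p permutes {0..<n}. \<Sum>g\<in>Pi\<^sub>E {1..n} S. (\<Prod>j<n. d j) * (\<Prod>i=1..n. c i (g i)) *
      (signof p * (\<Prod>i = 0..<n. f (Suc i) (g (Suc i)) (p i))))"
    by (simp add: sum_distrib_left mult_ac)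
  also have "\<dots> = (\<Sum>g\<in>Pi\<^sub>E {1..n} S. \<Sum>p | p permutes {0..<n}. (\<Prod>j<n. d j) * (\<Prod>i=1..n. c i (g i)) *
      (signof p * (\<Prod>i = 0..<n. f (Suc i) (g (Suc i)) (p i))))"
    by (rule sum.swap)
  also have "\<dots> = (\<Sum>g\<in>Pi\<^sub>E {1..n} S. (\<Prod>j<n. d j) * (\<Prod>i=1..n. c i (g i)) * det (mat n n (\<lambda>(i, j). f (Suc i) (g (Suc i)) j)))"
  proof (rule sum.cong[OF refl])
    fix g
    have "det (mat n n (\<lambda>(i, j). f (Suc i) (g (Suc i)) j)) =
        (\<Sum>p | p permutes {0..<n}. signof p * (\<Prod>i = 0..<n. f (Suc i) (g (Suc i)) (p i)))"
      by (subst det_def'[of _ n]) (auto intro!: sum.cong prod.cong dest: permutes_in_image)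
    then show "(\<Sum>p | p permutes {0..<n}. (\<Prod>j<n. d j) * (\<Prod>i=1..n. c i (g i)) * (signof p * (\<Prod>i = 0..<n. f (Suc i) (g (Suc i)) (p i))))
        = (\<Prod>j<n. d j) * (\<Prod>i=1..n. c i (g i)) * det (mat n n (\<lambda>(i, j). f (Suc i) (g (Suc i)) j))"
      by (simp add: sum_distrib_left)
  qed
  finally show ?thesis by (simp add: sum_distrib_left mult_ac)
qed

text \<open>A geometric sum that starts at \<open>b\<close>; its exponents \<open>b..a\<close>
  become the range of an interlacing row length.\<close>

lemma power_difference_sum:
  fixes x y :: complex
  assumes "b \<le> a"
  shows "x ^ Suc a - y ^ (Suc a - b) * x ^ b = (x - y) * (\<Sum>k=b..a. y ^ (a - k) * x ^ k)"
  using assms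
proof (induction a rule: dec_induct)
  case base
  show ?case by (simp add: algebra_simps)
next
  case (step a)
  define S where "S = (\<Sum>k=b..a. y ^ (a - k) * x ^ k)"
  have "(\<Sum>k=b..a. y ^ (Suc a - k) * x ^ k) = y * S"
    unfolding S_def sum_distrib_left by (intro sum.cong) (auto simp: Suc_diff_le mult.assoc)
  then have "(\<Sum>k=b..Suc a. y ^ (Suc a - k) * x ^ k) = y * S + x ^ Suc a"
    using step.hyps by (simp add: not_less)
  then have "(x - y) * (\<Sum>k=b..Suc a. y ^ (Suc a - k) * x ^ k) = y * ((x - y) * S) + (x - y) * x ^ Suc a"
    by (simp only:) (simp add: algebra_simps)
  also have "(x - y) * S = x ^ Suc a - y ^ (Suc a - b) * x ^ b" unfolding S_def by (rule step.IH[symmetric])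
  finally show ?case using step.hyps by (simp add: Suc_diff_le algebra_simps)
qed

text \<open>Subtracting from each row a multiple of the next one clears the last column; the remaining
  minor factors as \<open>\<Prod> (x\<^sub>j - x\<^sub>n\<^sub>+\<^sub>1)\<close> times a sum of alternants over the shapes interlacing \<open>\<nu>\<close>.\<close>

theorem alternant_eq_tableau_sum:
  "(\<And>i. 1 \<le> i \<Longrightarrow> i < n \<Longrightarrow> \<nu> (Suc i) \<le> \<nu> i) \<Longrightarrow>
    alternant n (\<lambda>i. \<nu> i + n - i) x = tableau_sum n \<nu> x * vandermonde n x"
proof (induction n arbitrary: \<nu>)
  case 0
  have "tableaux 0 \<nu> = {\<lambda>_. undefined}" by (auto simp: tableaux_def)
  then show ?case by (simp add: alternant_def tableau_sum_def vandermonde_def)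
next
  case (Suc n)
  have anti: "\<nu> (Suc i) \<le> \<nu> i" if "1 \<le> i" "i \<le> n" for i using Suc.prems[of i] that by simp
  have branch: "tableau_sum (Suc n) \<nu> x = (\<Sum>\<mu>\<in>Pi\<^sub>E {1..n} (\<lambda>i. {\<nu> (Suc i)..\<nu> i}).
      tableau_sum n \<mu> x * x (Suc n) ^ ((\<Sum>i=1..Suc n. \<nu> i) - (\<Sum>i=1..n. \<mu> i)))"
    by (rule tableau_sum_branching) (rule anti)
  define N where "N = Suc n"
  define y where "y = x N"
  define l where "l i = \<nu> i + N - i" for i
  define A where "A = mat N N (\<lambda>(i, j). x (Suc j) ^ l (Suc i))"
  \<comment> \<open>Unitriangular, so the determinant does not change. The last column holds powers
    of \<open>y\<close>, and the exponent \<open>l i - l (i + 1)\<close> is the one for which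
    subtracting the next row cancels the entry there.\<close>
  define U where "U = mat N N (\<lambda>(i, k). if k = i then 1 else if k = Suc i then - (y ^ (l (Suc i) - l (Suc (Suc i)))) else 0)"
  have A: "A \<in> carrier_mat N N" and U: "U \<in> carrier_mat N N" by (auto simp: A_def U_def)
  have "det U = 1"
    using det_upper_triangular[OF _ U] by (simp add: prod_list_diag_prod) (simp add: upper_triangular_def U_def)
  then have dA: "det A = det (U * A)" using det_mult[OF U A] by simp
  have UA: "(U * A) $$ (i, j) = (if i < n then x (Suc j) ^ l (Suc i) - y ^ (l (Suc i) - l (Suc (Suc i))) * x (Suc j) ^ l (Suc (Suc i))
      else x (Suc j) ^ l N)" if i: "i < N" and j: "j < N" for i j
  proof -
    have "(U * A) $$ (i, j) = (\<Sum>k<N. U $$ (i, k) * A $$ (k, j))"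
      using i j A U by (auto simp: scalar_prod_def atLeast0LessThan)
    also have "\<dots> = (\<Sum>k<N. (if k = i then A $$ (i, j) else 0) +
        (if k = Suc i then - (y ^ (l (Suc i) - l (Suc (Suc i)))) * A $$ (Suc i, j) else 0))"
      using i by (intro sum.cong) (auto simp: U_def)
    also have "\<dots> = A $$ (i, j) + (if Suc i < N then - (y ^ (l (Suc i) - l (Suc (Suc i)))) * A $$ (Suc i, j) else 0)"
      using i by (simp add: sum.distrib)
    finally show ?thesis using i j by (auto simp: A_def N_def less_Suc_eq)
  qed
  have l_Suc: "l (Suc (Suc i)) \<le> l (Suc i)" if "i < n" for i
    using anti[of "Suc i"] that by (simp add: l_def N_def)
  have last: "(U * A) $$ (i, n) = (if i = n then y ^ \<nu> N else 0)" if "i < N" for i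
    using that UA[of i n] l_Suc[of i] by (auto simp: N_def y_def l_def power_add[symmetric])
  have "det A = (\<Sum>i<N. (U * A) $$ (i, n) * cofactor (U * A) i n)"
    unfolding dA by (rule laplace_expansion_column) (use A U in \<open>auto simp: N_def\<close>)
  also have "\<dots> = (\<Sum>i<N. if i = n then y ^ \<nu> N * cofactor (U * A) n n else 0)"
    using last by (intro sum.cong) auto
  also have "\<dots> = y ^ \<nu> N * det (mat_delete (U * A) n n)" by (simp add: N_def cofactor_def)
  finally have detA: "det A = y ^ \<nu> N * det (mat_delete (U * A) n n)" .
  have "mat_delete (U * A) n n = mat n n (\<lambda>(i, j). (x (Suc j) - y) *
      (\<Sum>k\<in>{\<nu> (Suc (Suc i))..\<nu> (Suc i)}. y ^ (\<nu> (Suc i) - k) * x (Suc j) ^ (k + n - Suc i)))" (is "?L = ?R")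
  proof (rule eq_matI)
    fix i j assume "i < dim_row ?R" "j < dim_col ?R"
    then have i: "i < n" and j: "j < n" by auto
    define z where "z = x (Suc j)"
    have le: "\<nu> (Suc (Suc i)) \<le> \<nu> (Suc i)" using anti[of "Suc i"] i by simp
    define e where "e = n - Suc i"
    have l1: "l (Suc i) = Suc (\<nu> (Suc i)) + e" "l (Suc (Suc i)) = \<nu> (Suc (Suc i)) + e"
      using i by (auto simp: l_def N_def e_def)
    have l2: "k + n - Suc i = k + e" for k using i by (simp add: e_def)
    have l3: "l (Suc i) - l (Suc (Suc i)) = Suc (\<nu> (Suc i)) - \<nu> (Suc (Suc i))" by (simp add: l1)
    have "?L $$ (i, j) = (U * A) $$ (i, j)" using i j A U by (simp add: mat_delete_def N_def)
    also have "\<dots> = z ^ l (Suc i) - y ^ (l (Suc i) - l (Suc (Suc i))) * z ^ l (Suc (Suc i))"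
      using i j UA[of i j] by (simp add: N_def z_def)
    also have "\<dots> = z ^ e * (z ^ Suc (\<nu> (Suc i)) - y ^ (Suc (\<nu> (Suc i)) - \<nu> (Suc (Suc i))) * z ^ \<nu> (Suc (Suc i)))"
      unfolding l3 unfolding l1 power_add by (simp add: algebra_simps del: power_Suc)
    also have "\<dots> = (z - y) * (\<Sum>k\<in>{\<nu> (Suc (Suc i))..\<nu> (Suc i)}. y ^ (\<nu> (Suc i) - k) * z ^ (k + n - Suc i))"
      unfolding power_difference_sum[OF le] l2 by (simp add: sum_distrib_left power_add mult_ac)
    finally show "?L $$ (i, j) = ?R $$ (i, j)" using i j by (simp add: z_def)
  qed (use A U in \<open>auto simp: mat_delete_def N_def\<close>)
  then have "det (mat_delete (U * A) n n) = (\<Prod>j<n. x (Suc j) - y) *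
      (\<Sum>g\<in>Pi\<^sub>E {1..n} (\<lambda>i. {\<nu> (Suc i)..\<nu> i}). (\<Prod>i=1..n. y ^ (\<nu> i - g i)) *
        det (mat n n (\<lambda>(i, j). x (Suc j) ^ (g (Suc i) + n - Suc i))))"
    using det_sum_rows[of n "\<lambda>i. {\<nu> (Suc i)..\<nu> i}" "\<lambda>j. x (Suc j) - y" "\<lambda>i k. y ^ (\<nu> i - k)" "\<lambda>i k j. x (Suc j) ^ (k + n - i)"]
    by simp
  also have "\<dots> = (\<Prod>j=1..n. x j - y) * (\<Sum>g\<in>Pi\<^sub>E {1..n} (\<lambda>i. {\<nu> (Suc i)..\<nu> i}).
      (\<Prod>i=1..n. y ^ (\<nu> i - g i)) * (tableau_sum n g x * vandermonde n x))"
  proof (rule arg_cong2[of _ _ _ _ "(*)"])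
    show "(\<Prod>j<n. x (Suc j) - y) = (\<Prod>j=1..n. x j - y)"
      unfolding lessThan_atLeast0 by (rule prod_Suc_shift)
    show "(\<Sum>g\<in>Pi\<^sub>E {1..n} (\<lambda>i. {\<nu> (Suc i)..\<nu> i}). (\<Prod>i=1..n. y ^ (\<nu> i - g i)) *
        det (mat n n (\<lambda>(i, j). x (Suc j) ^ (g (Suc i) + n - Suc i))))
      = (\<Sum>g\<in>Pi\<^sub>E {1..n} (\<lambda>i. {\<nu> (Suc i)..\<nu> i}). (\<Prod>i=1..n. y ^ (\<nu> i - g i)) * (tableau_sum n g x * vandermonde n x))"
    proof (rule sum.cong[OF refl])
      fix g assume g: "g \<in> Pi\<^sub>E {1..n} (\<lambda>i. {\<nu> (Suc i)..\<nu> i})"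
      have gi: "\<nu> (Suc i) \<le> g i \<and> g i \<le> \<nu> i" if "1 \<le> i" "i \<le> n" for i
        using PiE_mem[OF g, of i] that by simp
      have "g (Suc i) \<le> g i" if "1 \<le> i" "i < n" for i
        using gi[of i] gi[of "Suc i"] that by simp
      from Suc.IH[of g, OF this]
      show "(\<Prod>i=1..n. y ^ (\<nu> i - g i)) * det (mat n n (\<lambda>(i, j). x (Suc j) ^ (g (Suc i) + n - Suc i)))
          = (\<Prod>i=1..n. y ^ (\<nu> i - g i)) * (tableau_sum n g x * vandermonde n x)"
        by (simp add: alternant_def)
    qed
  qed
  finally have "det A = (\<Sum>g\<in>Pi\<^sub>E {1..n} (\<lambda>i. {\<nu> (Suc i)..\<nu> i}).
      y ^ \<nu> N * (\<Prod>i=1..n. y ^ (\<nu> i - g i)) * tableau_sum n g x) * (vandermonde n x * (\<Prod>j=1..n. x j - y))"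
    unfolding detA by (simp add: sum_distrib_left sum_distrib_right mult_ac)
  also have "(\<Sum>g\<in>Pi\<^sub>E {1..n} (\<lambda>i. {\<nu> (Suc i)..\<nu> i}). y ^ \<nu> N * (\<Prod>i=1..n. y ^ (\<nu> i - g i)) * tableau_sum n g x)
      = tableau_sum (Suc n) \<nu> x"
    unfolding branch
  proof (rule sum.cong[OF refl])
    fix g assume g: "g \<in> Pi\<^sub>E {1..n} (\<lambda>i. {\<nu> (Suc i)..\<nu> i})"
    have gi: "g i \<le> \<nu> i" if "i \<in> {1..n}" for i using PiE_mem[OF g that] by simp
    \<comment> \<open>The exponents of \<open>y\<close> count the cells outside the smaller shape:
      all of the last row and the ends of the others. This is the weight of the new letter.\<close>
    have "\<nu> N + (\<Sum>i=1..n. \<nu> i - g i) = (\<Sum>i=1..Suc n. \<nu> i) - (\<Sum>i=1..n. g i)"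
      using sum_subtractf_nat[of "{1..n}" g \<nu>] gi sum_mono[of "{1..n}" g \<nu>] by (simp add: N_def)
    then show "y ^ \<nu> N * (\<Prod>i=1..n. y ^ (\<nu> i - g i)) * tableau_sum n g x
        = tableau_sum n g x * x (Suc n) ^ ((\<Sum>i=1..Suc n. \<nu> i) - (\<Sum>i=1..n. g i))"
      by (simp add: y_def N_def power_sum[symmetric] power_add[symmetric] mult_ac)
  qed
  also have "vandermonde n x * (\<Prod>j=1..n. x j - y) = vandermonde (Suc n) x"
    by (simp add: vandermonde_Suc y_def N_def)
  finally show ?case by (simp add: alternant_def A_def l_def N_def)
qed

section \<open>Threshold partitions and hooks\<close>

text \<open>The \<open>i\<close>-th part of the conjugate partition without passing through a list,
  for \<open>1 \<le> i\<close>, where the set is finite.\<close>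

definition col_length :: "nat list \<Rightarrow> nat \<Rightarrow> nat" where
  "col_length \<nu> i = card {j. 1 \<le> j \<and> i \<le> part \<nu> j}"

text \<open>The partitions with at most \<open>m\<close> parts and \<open>\<beta>\<^sub>i + s = \<alpha>\<^sub>i + 1\<close>: threshold partitions for \<open>s = 0\<close>,
  their conjugates for \<open>s = 2\<close>.\<close>

definition shifted_partitions :: "nat \<Rightarrow> nat \<Rightarrow> nat list set" where
  "shifted_partitions s m = {\<nu>. is_partition \<nu> \<and> length \<nu> \<le> m \<and>
     (\<forall>i\<ge>1. i \<le> part \<nu> i \<longrightarrow> col_length \<nu> i + s = part \<nu> i + 1)}"

text \<open>Wraps a hook with arm \<open>m + s - 1\<close> and leg \<open>m\<close> around \<nu>
  padded with zeros to \<open>m\<close> rows. For \<open>m + s = 0\<close> the new first row would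
  be empty, hence the guard \<open>0 < m + s\<close> later on.\<close>

definition add_hook :: "nat \<Rightarrow> nat \<Rightarrow> nat list \<Rightarrow> nat list" where
  "add_hook s m \<nu> = (m + s) # map (\<lambda>i. part \<nu> i + 1) [1..<Suc m]"

lemma part_antimono:
  assumes "is_partition \<nu>" "1 \<le> i" "i \<le> j"
  shows "part \<nu> j \<le> part \<nu> i"
proof (cases "j \<le> length \<nu>")
  case True
  then show ?thesis using assms sorted_wrt_nth_less[of "(\<ge>)" \<nu> "i - 1" "j - 1"]
    by (cases "i = j") (auto simp: is_partition_def part_def)
qed (auto simp: part_def)

lemma part_pos_iff:
  assumes "is_partition \<nu>" "1 \<le> i"
  shows "1 \<le> part \<nu> i \<longleftrightarrow> i \<le> length \<nu>"
proof -
  have "\<nu> ! (i - 1) \<noteq> 0" if "i \<le> length \<nu>"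
    using assms that nth_mem[of "i - 1" \<nu>] by (metis Suc_le_eq Suc_pred' is_partition_def less_eq_Suc_le One_nat_def)
  then show ?thesis using assms(2) by (auto simp: part_def Suc_le_eq)
qed

lemma partition_eqI:
  assumes "is_partition \<mu>" "is_partition \<nu>" "\<And>i. 1 \<le> i \<Longrightarrow> part \<mu> i = part \<nu> i"
  shows "\<mu> = \<nu>"
proof (rule nth_equalityI)
  have "i \<le> length \<mu> \<longleftrightarrow> i \<le> length \<nu>" if "1 \<le> i" for i
    using part_pos_iff[OF assms(1) that] part_pos_iff[OF assms(2) that] assms(3)[OF that] by simp
  from this[of "length \<mu>"] this[of "length \<nu>"] show len: "length \<mu> = length \<nu>"
    by (cases "length \<mu> = 0"; cases "length \<nu> = 0") auto
  show "\<mu> ! i = \<nu> ! i" if "i < length \<mu>" for i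
    using assms(3)[of "Suc i"] that len by (simp add: part_def)
qed

lemma is_partition_map:
  assumes "\<And>i. 1 \<le> i \<Longrightarrow> i < m \<Longrightarrow> f (Suc i) \<le> f i" "\<And>i. 1 \<le> i \<Longrightarrow> i \<le> m \<Longrightarrow> 1 \<le> f i"
  shows "is_partition (map f [1..<Suc m])"
proof -
  have anti: "f j \<le> f i" if "1 \<le> i" "i \<le> j" "j \<le> m" for i j
    using that(2,3)
  proof (induction j rule: dec_induct)
    case (step j)
    then show ?case using assms(1)[of j] that(1) by simp
  qed simp
  have "sorted_wrt (\<ge>) (map f [1..<Suc m])"
    by (auto simp: sorted_wrt_iff_nth_less simp del: upt_Suc intro!: anti)
  moreover have "0 \<notin> set (map f [1..<Suc m])" using assms(2) by fastforce
  ultimately show ?thesis by (simp add: is_partition_def)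
qed

lemma part_map: "1 \<le> i \<Longrightarrow> part (map f [1..<Suc m]) i = (if i \<le> m then f i else 0)"
  by (simp add: part_def del: upt_Suc)

lemma partition_of_function:
  assumes "\<And>i. 1 \<le> i \<Longrightarrow> f (Suc i) \<le> f i" "\<And>i. m < i \<Longrightarrow> f i = 0"
  shows "\<exists>\<mu>. is_partition \<mu> \<and> length \<mu> \<le> m \<and> (\<forall>i\<ge>1. part \<mu> i = f i)"
  using assms(2)
proof (induction m)
  case 0
  then show ?case by (intro exI[of _ "[]"]) (auto simp: is_partition_def part_def)
next
  case (Suc m)
  show ?case
  proof (cases "f (Suc m) = 0")
    case True
    then have "f i = 0" if "m < i" for i using Suc.prems[of i] that by (cases "i = Suc m") auto
    from Suc.IH[OF this] show ?thesis by (auto intro: le_SucI)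
  next
    case False
    have "1 \<le> f i" if "1 \<le> i" "i \<le> Suc m" for i
      using that(2,1)
    proof (induction i rule: inc_induct)
      case (step i)
      then show ?case using assms(1)[of i] by simp
    qed (use False in simp)
    then have "is_partition (map f [1..<Suc (Suc m)])" using assms(1) by (intro is_partition_map)
    moreover have "\<forall>i\<ge>1. part (map f [1..<Suc (Suc m)]) i = f i" using part_map[of _ f "Suc m"] Suc.prems by auto
    ultimately show ?thesis by (intro exI[of _ "map f [1..<Suc (Suc m)]"]) simp
  qed
qed

lemma finite_col: "1 \<le> i \<Longrightarrow> finite {j. 1 \<le> j \<and> i \<le> part \<nu> j}"
  by (rule finite_subset[of _ "{..length \<nu>}"]) (auto simp: part_def split: if_splits)

lemma col_length_iff:
  assumes \<nu>: "is_partition \<nu>" and i: "1 \<le> i" and j: "1 \<le> j"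
  shows "j \<le> col_length \<nu> i \<longleftrightarrow> i \<le> part \<nu> j"
proof
  assume "i \<le> part \<nu> j"
  then have "{1..j} \<subseteq> {j. 1 \<le> j \<and> i \<le> part \<nu> j}"
    using part_antimono[OF \<nu>] order_trans by fastforce
  from card_mono[OF finite_col[OF i] this] show "j \<le> col_length \<nu> i" by (simp add: col_length_def)
next
  assume *: "j \<le> col_length \<nu> i"
  show "i \<le> part \<nu> j"
  proof (rule ccontr)
    assume n: "\<not> i \<le> part \<nu> j"
    have "{j. 1 \<le> j \<and> i \<le> part \<nu> j} \<subseteq> {1..<j}"
    proof clarify
      fix k assume k: "1 \<le> k" "i \<le> part \<nu> k"
      show "k \<in> {1..<j}" using n k part_antimono[OF \<nu> j, of k] by (cases "j \<le> k") auto
    qed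
    from card_mono[OF _ this] * j show False by (simp add: col_length_def)
  qed
qed

lemma col_length_1: "is_partition \<nu> \<Longrightarrow> col_length \<nu> 1 = length \<nu>"
proof -
  assume \<nu>: "is_partition \<nu>"
  have "{j. 1 \<le> j \<and> 1 \<le> part \<nu> j} = {1..length \<nu>}" using part_pos_iff[OF \<nu>] by auto
  then show ?thesis by (simp add: col_length_def)
qed

lemma part_add_hook:
  assumes "1 \<le> i"
  shows "part (add_hook s m \<nu>) i = (if i = 1 then m + s else if i \<le> Suc m then part \<nu> (i - 1) + 1 else 0)"
proof (cases "i = 1")
  case False
  define k where "k = i - 2"
  have "i = Suc (Suc k)" using False assms by (simp add: k_def)
  then show ?thesis by (simp add: add_hook_def part_def del: upt_Suc)
qed (simp add: add_hook_def part_def)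

text \<open>Column i + 1 of the new diagram is column \<open>i\<close> of \<mu> moved down by one
  row, together with a cell of the new first row, which reaches that far by
  \<open>Suc i \<le> m + s\<close>.\<close>

lemma col_length_add_hook:
  assumes i: "1 \<le> i" "Suc i \<le> m + s" and len: "length \<mu> \<le> m"
  shows "col_length (add_hook s m \<mu>) (Suc i) = Suc (col_length \<mu> i)"
proof -
  have "{j. 1 \<le> j \<and> Suc i \<le> part (add_hook s m \<mu>) j} = insert 1 (Suc ` {j. 1 \<le> j \<and> i \<le> part \<mu> j})"
  proof (rule Set.set_eqI)
    fix j
    show "j \<in> {j. 1 \<le> j \<and> Suc i \<le> part (add_hook s m \<mu>) j} \<longleftrightarrow> j \<in> insert 1 (Suc ` {j. 1 \<le> j \<and> i \<le> part \<mu> j})"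
    proof (cases "j \<le> 1")
      case True
      then show ?thesis using i part_add_hook[of j s m \<mu>] by (cases "j = 0") auto
    next
      case False
      then obtain k where k: "j = Suc k" "1 \<le> k" by (cases j) auto
      have "k \<le> m" if "i \<le> part \<mu> k" using that i(1) len by (auto simp: part_def split: if_splits)
      then show ?thesis using k part_add_hook[of j s m \<mu>] i(1) by (auto simp: image_iff)
    qed
  qed
  then show ?thesis unfolding col_length_def using finite_col[OF i(1), of \<mu>]
    by (subst card_insert_disjoint[symmetric, of "Suc ` {j. 1 \<le> j \<and> i \<le> part \<mu> j}" 1, unfolded card_image[OF inj_Suc[THEN inj_on_subset[OF _ subset_UNIV]]]]) auto
qed

lemma shifted_first_part:
  assumes \<nu>: "\<nu> \<in> shifted_partitions s m" and "\<nu> \<noteq> []"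
  shows "part \<nu> 1 + 1 = length \<nu> + s"
proof -
  have p: "is_partition \<nu>" using \<nu> by (simp add: shifted_partitions_def)
  have "1 \<le> part \<nu> 1" using part_pos_iff[OF p, of 1] assms(2) by (cases \<nu>) auto
  then have "col_length \<nu> 1 + s = part \<nu> 1 + 1" using \<nu> by (auto simp: shifted_partitions_def)
  then show ?thesis using col_length_1[OF p] by simp
qed

lemma add_hook_shifted:
  assumes \<mu>: "\<mu> \<in> shifted_partitions s m" and pos: "0 < m + s"
  shows "add_hook s m \<mu> \<in> shifted_partitions s (Suc m)"
proof -
  have p: "is_partition \<mu>" and len: "length \<mu> \<le> m"
    and sh: "\<And>i. 1 \<le> i \<Longrightarrow> i \<le> part \<mu> i \<Longrightarrow> col_length \<mu> i + s = part \<mu> i + 1"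
    using \<mu> by (auto simp: shifted_partitions_def)
  \<comment> \<open>By \<open>shifted_first_part\<close> the first part of a nonempty \<mu> is its
    length plus \<open>s\<close>, minus 1, so the new first row is long enough.\<close>
  have p1: "part \<mu> i + 1 \<le> m + s" if "1 \<le> i" "i \<le> m" for i
  proof (cases "\<mu> = []")
    case True
    then show ?thesis using that by (simp add: part_def)
  next
    case False
    then show ?thesis using shifted_first_part[OF \<mu> False] part_antimono[OF p, of 1 i] that len by simp
  qed
  have eq: "add_hook s m \<mu> = map (\<lambda>i. if i = 1 then m + s else part \<mu> (i - 1) + 1) [1..<Suc (Suc m)]"
    by (auto simp: add_hook_def list_eq_iff_nth_eq nth_Cons' simp del: upt_Suc)
  have part: "is_partition (add_hook s m \<mu>)" unfolding eq
  proof (rule is_partition_map)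
    fix i assume i: "1 \<le> i" "i < Suc m"
    show "(if Suc i = 1 then m + s else part \<mu> (Suc i - 1) + 1) \<le> (if i = 1 then m + s else part \<mu> (i - 1) + 1)"
      using i p1[of 1] part_antimono[OF p, of "i - 1" i] by auto
  qed (use pos in auto)
  have "col_length (add_hook s m \<mu>) i + s = part (add_hook s m \<mu>) i + 1"
    if i: "1 \<le> i" "i \<le> part (add_hook s m \<mu>) i" for i
  proof (cases "i = 1")
    case True
    then show ?thesis using col_length_1[OF part] part_add_hook[of 1 s m \<mu>] by (simp add: add_hook_def)
  next
    case False
    then obtain k where k: "i = Suc k" "1 \<le> k" using i by (cases i) auto
    have km: "k \<le> m" "k \<le> part \<mu> k" and pk: "part (add_hook s m \<mu>) i = part \<mu> k + 1"
      using i(2) part_add_hook[of i s m \<mu>] k by (auto split: if_splits)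
    have "Suc k \<le> m + s" using p1[OF k(2) km(1)] km(2) by simp
    from col_length_add_hook[OF k(2) this len] show ?thesis using sh[OF k(2) km(2)] pk k by simp
  qed
  then show ?thesis using part by (auto simp: shifted_partitions_def add_hook_def simp del: upt_Suc)
qed

text \<open>If there are exactly m + 1 parts, the condition at the first diagonal cell forces the
  first part to be \<open>m + s\<close>, so the outer hook is determined. Inside it the diagonal
  moves by one step and the condition is unchanged. Iterating, such a partition is the set of legs
  of its hooks.\<close>

lemma shifted_partitions_Suc:
  "shifted_partitions s (Suc m) = shifted_partitions s m \<union>
     (if 0 < m + s then add_hook s m ` shifted_partitions s m else {})" (is "_ = ?R")
proof
  show "?R \<subseteq> shifted_partitions s (Suc m)"
    using add_hook_shifted[of _ s m] by (auto simp: shifted_partitions_def)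
  show "shifted_partitions s (Suc m) \<subseteq> ?R"
  proof
    fix \<nu> assume \<nu>: "\<nu> \<in> shifted_partitions s (Suc m)"
    then have p: "is_partition \<nu>" and sh: "\<And>i. 1 \<le> i \<Longrightarrow> i \<le> part \<nu> i \<Longrightarrow> col_length \<nu> i + s = part \<nu> i + 1"
      by (auto simp: shifted_partitions_def)
    show "\<nu> \<in> ?R"
    proof (cases "length \<nu> \<le> m")
      case True
      then show ?thesis using \<nu> by (simp add: shifted_partitions_def)
    next
      case False
      then have len: "length \<nu> = Suc m" using \<nu> by (simp add: shifted_partitions_def)
      then have first: "part \<nu> 1 = m + s" using shifted_first_part[OF \<nu>] by fastforce
      have pos: "1 \<le> part \<nu> i \<longleftrightarrow> i \<le> Suc m" if "1 \<le> i" for i using part_pos_iff[OF p that] len by simp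
      \<comment> \<open>The candidate is \<nu> without its first row and column; truncated
        subtraction loses nothing in the nonempty rows.\<close>
      have "\<exists>\<mu>. is_partition \<mu> \<and> length \<mu> \<le> m \<and> (\<forall>i\<ge>1. part \<mu> i = part \<nu> (Suc i) - 1)"
      proof (rule partition_of_function)
        show "part \<nu> (Suc (Suc i)) - 1 \<le> part \<nu> (Suc i) - 1" if "1 \<le> i" for i
          by (rule diff_le_mono, rule part_antimono[OF p]) (use that in auto)
        show "part \<nu> (Suc i) - 1 = 0" if "m < i" for i using that by (simp add: part_def len)
      qed
      then obtain \<mu> where \<mu>: "is_partition \<mu>" "length \<mu> \<le> m" "\<And>i. 1 \<le> i \<Longrightarrow> part \<mu> i = part \<nu> (Suc i) - 1" by blast
      have parts: "part (add_hook s m \<mu>) i = part \<nu> i" if i: "1 \<le> i" for i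
      proof (cases "i = 1")
        case True
        then show ?thesis using first by (simp add: part_add_hook)
      next
        case False
        then have "part \<mu> (i - 1) = part \<nu> i - 1" using \<mu>(3)[of "i - 1"] i by simp
        then show ?thesis using part_add_hook[OF i, of s m \<mu>] pos[OF i] False by auto
      qed
      have eq: "\<nu> = add_hook s m \<mu>"
      proof (rule nth_equalityI)
        show len_eq: "length \<nu> = length (add_hook s m \<mu>)" by (simp add: len add_hook_def)
        show "\<nu> ! i = add_hook s m \<mu> ! i" if "i < length \<nu>" for i
          using parts[of "Suc i"] that len_eq by (simp add: part_def)
      qed
      have "col_length \<mu> i + s = part \<mu> i + 1" if i: "1 \<le> i" "i \<le> part \<mu> i" for i
      proof -
        have le: "Suc i \<le> part \<nu> (Suc i)" using i \<mu>(3)[OF i(1)] by simp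
        also have "\<dots> \<le> m + s" using part_antimono[OF p, of 1 "Suc i"] first by simp
        finally have "col_length \<nu> (Suc i) = Suc (col_length \<mu> i)"
          unfolding eq by (rule col_length_add_hook[OF i(1) _ \<mu>(2)])
        then show ?thesis using sh[OF _ le] \<mu>(3)[OF i(1)] i by simp
      qed
      then have "\<mu> \<in> shifted_partitions s m" using \<mu> by (simp add: shifted_partitions_def)
      moreover have "1 \<le> part \<nu> 1" using pos[of 1] by simp
      then have "0 < m + s" using first by linarith
      ultimately show ?thesis using eq by simp
    qed
  qed
qed

lemma add_hook_inj: "inj_on (add_hook s m) (shifted_partitions s m)"
proof (rule inj_onI)
  fix \<mu> \<nu> assume \<mu>: "\<mu> \<in> shifted_partitions s m" and \<nu>: "\<nu> \<in> shifted_partitions s m"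
    and eq: "add_hook s m \<mu> = add_hook s m \<nu>"
  have len: "length \<mu> \<le> m" "length \<nu> \<le> m" using \<mu> \<nu> by (auto simp: shifted_partitions_def)
  have "part \<mu> i = part \<nu> i" if i: "1 \<le> i" for i
  proof (cases "i \<le> m")
    case True
    then show ?thesis using arg_cong[OF eq, of "\<lambda>l. part l (Suc i)"] part_add_hook[of "Suc i" s m] i by simp
  next
    case False
    then show ?thesis using len by (simp add: part_def)
  qed
  then show "\<mu> = \<nu>" using \<mu> \<nu> by (intro partition_eqI) (auto simp: shifted_partitions_def)
qed

lemma add_hook_disjoint: "shifted_partitions s m \<inter> add_hook s m ` shifted_partitions s m = {}"
  by (auto simp: shifted_partitions_def add_hook_def)

lemma shifted_partitions_0: "shifted_partitions s 0 = {[]}"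
  by (auto simp: shifted_partitions_def is_partition_def part_def)

lemma finite_shifted_partitions: "finite (shifted_partitions s m)"
  by (induction m) (auto simp: shifted_partitions_0 shifted_partitions_Suc)

lemma sum_list_parts: "length \<nu> \<le> m \<Longrightarrow> sum_list \<nu> = (\<Sum>i=1..m. part \<nu> i)"
proof -
  assume len: "length \<nu> \<le> m"
  have "sum_list \<nu> = (\<Sum>i = 0..<length \<nu>. part \<nu> (Suc i))" by (simp add: sum_list_sum_nth part_def)
  also have "\<dots> = (\<Sum>i=1..length \<nu>. part \<nu> i)"
    by (simp add: sum.shift_bounds_Suc_ivl[symmetric] atLeastLessThanSuc_atLeastAtMost)
  also have "\<dots> = (\<Sum>i=1..m. part \<nu> i)"
    by (rule sum.mono_neutral_left) (use len in \<open>auto simp: part_def\<close>)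
  finally show ?thesis .
qed

lemma sum_list_add_hook:
  assumes "length \<nu> \<le> m"
  shows "sum_list (add_hook s m \<nu>) = 2 * m + s + sum_list \<nu>"
proof -
  have "sum_list (map (\<lambda>i. part \<nu> i + 1) [1..<Suc m]) = (\<Sum>i=1..m. part \<nu> i + 1)"
    unfolding interv_sum_list_conv_sum_set_nat set_upt by (simp add: atLeastLessThanSuc_atLeastAtMost)
  also have "\<dots> = sum_list \<nu> + m" unfolding sum.distrib sum_list_parts[OF assms] by simp
  finally show ?thesis by (simp add: add_hook_def del: upt_Suc)
qed

text \<open>Every hook has size \<open>2 * m + s\<close>.\<close>

lemma shifted_partitions_even:
  assumes "even s"
  shows "\<nu> \<in> shifted_partitions s m \<Longrightarrow> even (sum_list \<nu>)"
proof (induction m arbitrary: \<nu>)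
  case (Suc m)
  have "even (sum_list (add_hook s m \<mu>))" if "\<mu> \<in> shifted_partitions s m" for \<mu>
    using Suc.IH[OF that] that assms by (simp add: sum_list_add_hook shifted_partitions_def)
  then show ?case using Suc by (auto simp: shifted_partitions_Suc split: if_splits)
qed (simp add: shifted_partitions_0)

section \<open>The Littlewood identities\<close>

text \<open>Rows are arbitrary functions kept in a list, so that expanding, exchanging and moving
  one row are statements about concatenations.\<close>

definition row_alternant :: "(complex \<Rightarrow> complex) list \<Rightarrow> (nat \<Rightarrow> complex) \<Rightarrow> complex" where
  "row_alternant fs x = det (mat (length fs) (length fs) (\<lambda>(i, j). (fs ! i) (x (Suc j))))"

lemma row_alternant_linear:
  "row_alternant (A @ (\<lambda>z. a * f z + b * g z) # B) x =
     a * row_alternant (A @ f # B) x + b * row_alternant (A @ g # B) x"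
proof -
  define n where "n = length (A @ f # B)"
  define i where "i = length A"
  have i: "i < n" by (simp add: n_def i_def)
  have exp: "row_alternant (A @ h # B) x = (\<Sum>p | p permutes {0..<n}. signof p *
      (h (x (Suc (p i))) * (\<Prod>l\<in>{0..<n} - {i}. ((A @ f # B) ! l) (x (Suc (p l))))))" for h
  proof -
    have *: "(\<Prod>l = 0..<n. ((A @ h # B) ! l) (x (Suc (p l)))) =
        h (x (Suc (p i))) * (\<Prod>l\<in>{0..<n} - {i}. ((A @ f # B) ! l) (x (Suc (p l))))" for p
    proof -
      have "(\<Prod>l = 0..<n. ((A @ h # B) ! l) (x (Suc (p l)))) =
          ((A @ h # B) ! i) (x (Suc (p i))) * (\<Prod>l\<in>{0..<n} - {i}. ((A @ h # B) ! l) (x (Suc (p l))))"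
        using i by (intro prod.remove) auto
      moreover have "(\<Prod>l\<in>{0..<n} - {i}. ((A @ h # B) ! l) (x (Suc (p l)))) = (\<Prod>l\<in>{0..<n} - {i}. ((A @ f # B) ! l) (x (Suc (p l))))"
        by (intro prod.cong refl) (auto simp: i_def nth_append nth_Cons')
      ultimately show ?thesis by (simp add: i_def)
    qed
    have "row_alternant (A @ h # B) x = (\<Sum>p | p permutes {0..<n}. signof p * (\<Prod>l = 0..<n. ((A @ h # B) ! l) (x (Suc (p l)))))"
      unfolding row_alternant_def
      by (subst det_def'[of _ n]) (auto simp: n_def intro!: sum.cong prod.cong dest: permutes_in_image)
    then show ?thesis unfolding * .
  qed
  show ?thesis unfolding exp sum_distrib_left sum.distrib[symmetric]
    by (intro sum.cong refl) (simp add: algebra_simps)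
qed

lemma row_alternant_swap: "row_alternant (A @ f # g # B) x = - row_alternant (A @ g # f # B) x"
proof -
  define n where "n = length (A @ g # f # B)"
  define M where "M = mat n n (\<lambda>(i, j). ((A @ g # f # B) ! i) (x (Suc j)))"
  have "mat n n (\<lambda>(i, j). ((A @ f # g # B) ! i) (x (Suc j))) = swaprows (length A) (Suc (length A)) M"
    by (rule eq_matI) (auto simp: M_def n_def nth_append nth_Cons' mat_swaprows_def)
  moreover have "det (swaprows (length A) (Suc (length A)) M) = - det M"
    by (rule det_swaprows[of _ n]) (auto simp: M_def n_def)
  ultimately show ?thesis by (simp add: row_alternant_def M_def n_def)
qed

lemma row_alternant_rotate: "row_alternant (A @ f # B) x = (- 1) ^ length B * row_alternant (A @ B @ [f]) x"
proof (induction B arbitrary: A)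
  case (Cons g B)
  have "row_alternant (A @ f # g # B) x = - row_alternant ((A @ [g]) @ f # B) x"
    by (simp add: row_alternant_swap[of A f g B])
  then show ?case using Cons[of "A @ [g]"] by simp
qed simp

text \<open>With a = t z and b = - 1 / z this is z^(n-1) (a^m + b^m) for \<open>s = 0\<close> and
  z^n (a^(m+1) - b^(m+1)) for \<open>s = 2\<close>. For \<open>m = s = 0\<close> both monomials are
  z^(n-1), and the guard keeps one of them; it corresponds to the empty hook.\<close>

definition littlewood_row :: "nat \<Rightarrow> complex \<Rightarrow> nat \<Rightarrow> nat \<Rightarrow> complex \<Rightarrow> complex" where
  "littlewood_row s t n m = (\<lambda>z. (if 0 < m + s then t ^ (m + s div 2) else 0) * z ^ (m + s + n - 1) + (- 1) ^ m * z ^ (n - 1 - m))"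

definition shape_rows :: "nat \<Rightarrow> nat \<Rightarrow> nat list \<Rightarrow> (complex \<Rightarrow> complex) list" where
  "shape_rows n m \<nu> = map (\<lambda>i z. z ^ (part \<nu> i + n - i)) [1..<Suc m]"

lemma shape_rows_Suc:
  "length \<nu> \<le> m \<Longrightarrow> shape_rows n (Suc m) \<nu> = shape_rows n m \<nu> @ [\<lambda>z. z ^ (n - 1 - m)]"
  by (simp add: shape_rows_def part_def)

text \<open>A row of \<nu> moves down by one and grows by one, which leaves its exponent unchanged;
  only the exponent of the new first row is added.\<close>

lemma shape_rows_add_hook:
  assumes "m < n"
  shows "shape_rows n (Suc m) (add_hook s m \<nu>) = (\<lambda>z. z ^ (m + s + n - 1)) # shape_rows n m \<nu>"
proof (rule nth_equalityI)
  fix i assume "i < length (shape_rows n (Suc m) (add_hook s m \<nu>))"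
  then have i: "i < Suc m" by (simp add: shape_rows_def del: upt_Suc)
  show "shape_rows n (Suc m) (add_hook s m \<nu>) ! i = ((\<lambda>z. z ^ (m + s + n - 1)) # shape_rows n m \<nu>) ! i"
    using i assms part_add_hook[of "Suc i" s m \<nu>]
    by (cases i) (auto simp: shape_rows_def simp del: upt_Suc)
qed (simp add: shape_rows_def)

text \<open>Expanding the row \<open>m\<close> either adds a hook in front of the exponents found so far, or moves its
  second monomial to the end past \<open>m\<close> rows, at the cost of the sign that the row carries.\<close>

lemma littlewood_expansion:
  assumes s: "even s"
  shows "m \<le> n \<Longrightarrow> row_alternant (map (littlewood_row s t n) (rev [0..<n])) x =
    (\<Sum>\<nu>\<in>shifted_partitions s m. t ^ (sum_list \<nu> div 2) *
      row_alternant (map (littlewood_row s t n) (rev [m..<n]) @ shape_rows n m \<nu>) x)"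
proof (induction m)
  case 0
  then show ?case by (simp add: shifted_partitions_0 shape_rows_def)
next
  case (Suc m)
  define P where "P = map (littlewood_row s t n) (rev [Suc m..<n])"
  define F where "F k \<nu> = t ^ (sum_list \<nu> div 2) * row_alternant (P @ shape_rows n k \<nu>) x" for k \<nu>
  \<comment> \<open>The unexpanded rows are listed by decreasing index, so row \<open>m\<close>
    stands immediately before the rows already expanded.\<close>
  have P: "map (littlewood_row s t n) (rev [m..<n]) = P @ [littlewood_row s t n m]"
    using Suc.prems by (simp add: P_def upt_conv_Cons)
  have step: "t ^ (sum_list \<nu> div 2) * row_alternant (map (littlewood_row s t n) (rev [m..<n]) @ shape_rows n m \<nu>) x
      = (if 0 < m + s then F (Suc m) (add_hook s m \<nu>) else 0) + F (Suc m) \<nu>" if \<nu>: "\<nu> \<in> shifted_partitions s m" for \<nu>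
  proof -
    have len: "length \<nu> \<le> m" using \<nu> by (simp add: shifted_partitions_def)
    have "row_alternant (P @ (\<lambda>z. z ^ (n - 1 - m)) # shape_rows n m \<nu>) x = (- 1) ^ m * row_alternant (P @ shape_rows n (Suc m) \<nu>) x"
      unfolding row_alternant_rotate[of P _ "shape_rows n m \<nu>"] shape_rows_Suc[OF len]
      by (simp add: shape_rows_def del: upt_Suc)
    moreover have "row_alternant (P @ (\<lambda>z. z ^ (m + s + n - 1)) # shape_rows n m \<nu>) x = row_alternant (P @ shape_rows n (Suc m) (add_hook s m \<nu>)) x"
      using Suc.prems by (simp add: shape_rows_add_hook)
    moreover have "sum_list (add_hook s m \<nu>) div 2 = m + s div 2 + sum_list \<nu> div 2"
      using s by (auto simp: sum_list_add_hook[OF len] elim!: evenE)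
    moreover have "((- 1) ^ m * (- 1) ^ m :: complex) = 1" by (simp flip: power_add mult_2)
    moreover define c where "c = (if 0 < m + s then t ^ (m + s div 2) else 0)"
    moreover have "row_alternant (P @ littlewood_row s t n m # shape_rows n m \<nu>) x =
        c * row_alternant (P @ (\<lambda>z. z ^ (m + s + n - 1)) # shape_rows n m \<nu>) x +
        (- 1) ^ m * row_alternant (P @ (\<lambda>z. z ^ (n - 1 - m)) # shape_rows n m \<nu>) x"
      unfolding littlewood_row_def c_def by (rule row_alternant_linear)
    ultimately have "row_alternant (P @ littlewood_row s t n m # shape_rows n m \<nu>) x =
        c * row_alternant (P @ shape_rows n (Suc m) (add_hook s m \<nu>)) x + row_alternant (P @ shape_rows n (Suc m) \<nu>) x"
      and "sum_list (add_hook s m \<nu>) div 2 = m + s div 2 + sum_list \<nu> div 2"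
      by (simp_all add: mult.assoc[symmetric])
    then show ?thesis
      unfolding P F_def c_def by (simp add: power_add algebra_simps)
  qed
  have "row_alternant (map (littlewood_row s t n) (rev [0..<n])) x =
      (\<Sum>\<nu>\<in>shifted_partitions s m. if 0 < m + s then F (Suc m) (add_hook s m \<nu>) else 0) + (\<Sum>\<nu>\<in>shifted_partitions s m. F (Suc m) \<nu>)"
    using Suc step by (simp add: sum.distrib)
  also have "(\<Sum>\<nu>\<in>shifted_partitions s m. if 0 < m + s then F (Suc m) (add_hook s m \<nu>) else 0)
      = (\<Sum>\<nu>\<in>(if 0 < m + s then add_hook s m ` shifted_partitions s m else {}). F (Suc m) \<nu>)"
    by (simp add: sum.reindex[OF add_hook_inj])
  also have "\<dots> + (\<Sum>\<nu>\<in>shifted_partitions s m. F (Suc m) \<nu>) = (\<Sum>\<nu>\<in>shifted_partitions s (Suc m). F (Suc m) \<nu>)"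
    unfolding shifted_partitions_Suc
    by (subst sum.union_disjoint) (use add_hook_disjoint in \<open>auto simp: finite_shifted_partitions add.commute\<close>)
  finally show ?case by (simp add: F_def P_def)
qed

lemma littlewood_alternant:
  assumes "even s"
  shows "row_alternant (map (littlewood_row s t n) (rev [0..<n])) x =
    (\<Sum>\<nu>\<in>shifted_partitions s n. t ^ (sum_list \<nu> div 2) * tableau_sum n (part \<nu>) x) * vandermonde n x"
proof -
  have "row_alternant (shape_rows n n \<nu>) x = tableau_sum n (part \<nu>) x * vandermonde n x"
    if "\<nu> \<in> shifted_partitions s n" for \<nu>
  proof -
    have p: "is_partition \<nu>" using that by (simp add: shifted_partitions_def)
    have "row_alternant (shape_rows n n \<nu>) x = alternant n (\<lambda>i. part \<nu> i + n - i) x"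
      by (auto simp: row_alternant_def shape_rows_def alternant_def simp del: upt_Suc intro!: arg_cong[of _ _ det] eq_matI)
    also have "\<dots> = tableau_sum n (part \<nu>) x * vandermonde n x"
      by (rule alternant_eq_tableau_sum) (use part_antimono[OF p] in auto)
    finally show ?thesis .
  qed
  then show ?thesis using littlewood_expansion[OF assms le_refl, of t n x] by (simp add: sum_distrib_right mult.assoc)
qed

text \<open>Dickson polynomials of the first kind for \<open>c = 2\<close> and of the second kind
  for \<open>c = 1\<close>. In degree 0 the first kind would be 2; it is set to 1 to be monic, and
  the factor \<open>c\<close> at \<open>m = 0\<close> makes up for that in the recursion.\<close>

fun monic_poly :: "complex \<Rightarrow> complex \<Rightarrow> nat \<Rightarrow> complex poly" where
  "monic_poly c t 0 = 1"
| "monic_poly c t (Suc 0) = [:0, 1:]"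
| "monic_poly c t (Suc (Suc m)) = pCons 0 (monic_poly c t (Suc m)) + smult (if m = 0 then c * t else t) (monic_poly c t m)"

lemma coeff_monic_poly: "m \<le> k \<Longrightarrow> coeff (monic_poly c t m) k = (if k = m then 1 else 0)"
proof (induction c t m arbitrary: k rule: monic_poly.induct)
  case (3 c t m)
  then show ?case by (cases k) auto
qed (auto simp: coeff_pCons split: nat.split)

text \<open>With \<open>a b = - t\<close> the power sums \<open>a\<^sup>m + b\<^sup>m\<close> and the quotients \<open>(a\<^sup>m\<^sup>+\<^sup>1 - b\<^sup>m\<^sup>+\<^sup>1) / (a - b)\<close> are monic
  polynomials of degree \<open>m\<close> in \<open>a + b\<close>.\<close>

lemma poly_monic_power_sum:
  assumes "a * b = - t"
  shows "poly (monic_poly 2 t m) (a + b) = (if m = 0 then 1 else a ^ m + b ^ m)"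
  using assms
proof (induction "2 :: complex" t m rule: monic_poly.induct)
  case (3 t m)
  then have t: "t = - (a * b)" by simp
  have IH: "poly (monic_poly 2 t (Suc m)) (a + b) = a ^ Suc m + b ^ Suc m"
    "poly (monic_poly 2 t m) (a + b) = (if m = 0 then 1 else a ^ m + b ^ m)" using 3 by simp_all
  have "poly (monic_poly 2 t (Suc (Suc m))) (a + b) =
      (a + b) * (a ^ Suc m + b ^ Suc m) + (if m = 0 then 2 * t else t) * (if m = 0 then 1 else a ^ m + b ^ m)"
    unfolding IH[symmetric] by simp
  also have "\<dots> = a ^ Suc (Suc m) + b ^ Suc (Suc m)" unfolding t by (simp add: algebra_simps)
  finally show ?case by simp
qed auto

lemma poly_monic_quotient:
  assumes "a * b = - t"
  shows "(a - b) * poly (monic_poly 1 t m) (a + b) = a ^ Suc m - b ^ Suc m"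
  using assms
proof (induction "1 :: complex" t m rule: monic_poly.induct)
  case (3 t m)
  then have t: "t = - (a * b)" by simp
  have "(a - b) * poly (monic_poly 1 t (Suc (Suc m))) (a + b)
      = (a + b) * ((a - b) * poly (monic_poly 1 t (Suc m)) (a + b)) + t * ((a - b) * poly (monic_poly 1 t m) (a + b))"
    by (simp add: algebra_simps)
  also have "\<dots> = (a + b) * (a ^ Suc (Suc m) - b ^ Suc (Suc m)) + t * (a ^ Suc m - b ^ Suc m)"
    using 3 by simp
  finally show ?case unfolding t by (simp add: algebra_simps)
qed (auto simp: algebra_simps)

text \<open>The coefficients form a unitriangular matrix that turns the rows of powers, in
  decreasing degree, into the rows of monic polynomials.\<close>

lemma det_monic_poly:
  "det (mat n n (\<lambda>(i, j). poly (monic_poly c t (n - 1 - i)) (y (Suc j)))) = vandermonde n y"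
proof -
  define U where "U = mat n n (\<lambda>(i, k). coeff (monic_poly c t (n - 1 - i)) (n - 1 - k))"
  define V where "V = mat n n (\<lambda>(k, j). y (Suc j) ^ (n - 1 - k))"
  have UV: "U \<in> carrier_mat n n" "V \<in> carrier_mat n n" by (auto simp: U_def V_def)
  have "mat n n (\<lambda>(i, j). poly (monic_poly c t (n - 1 - i)) (y (Suc j))) = U * V"
  proof (rule eq_matI)
    fix i j assume "i < dim_row (U * V)" "j < dim_col (U * V)"
    then have i: "i < n" and j: "j < n" using UV by auto
    let ?p = "monic_poly c t (n - 1 - i)"
    have deg: "degree ?p \<le> n - 1" by (rule degree_le) (use coeff_monic_poly in auto)
    have "(U * V) $$ (i, j) = (\<Sum>k = 0..<n. coeff ?p (n - 1 - k) * y (Suc j) ^ (n - 1 - k))"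
      using i j UV by (auto simp: scalar_prod_def U_def V_def)
    also have "\<dots> = (\<Sum>k = 0..<n. coeff ?p k * y (Suc j) ^ k)"
      using sum.nat_diff_reindex[of "\<lambda>k. coeff ?p k * y (Suc j) ^ k" n] by (simp add: atLeast0LessThan)
    also have "\<dots> = (\<Sum>k\<le>degree ?p. coeff ?p k * y (Suc j) ^ k)"
      by (rule sum.mono_neutral_right) (use deg i in \<open>auto simp: coeff_eq_0\<close>)
    finally show "mat n n (\<lambda>(i, j). poly (monic_poly c t (n - 1 - i)) (y (Suc j))) $$ (i, j) = (U * V) $$ (i, j)"
      using i j by (simp add: poly_altdef)
  qed (use UV in auto)
  moreover have "upper_triangular U"
  proof (rule upper_triangularI)
    fix i j assume "j < i" "i < dim_row U"
    then have ij: "i < n" "j < n" "n - 1 - i < n - 1 - j" by (auto simp: U_def)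
    then show "U $$ (i, j) = 0" using coeff_monic_poly[of "n - 1 - i" "n - 1 - j" c t] by (simp add: U_def)
  qed
  then have "det U = 1"
    using det_upper_triangular[OF _ UV(1)] by (simp add: prod_list_diag_prod) (simp add: U_def coeff_monic_poly)
  moreover have "V = mat n n (\<lambda>(i, j). y (Suc j) ^ (0 + n - Suc i))"
    by (auto simp: V_def intro!: eq_matI)
  \<comment> \<open>The product formula for the Vandermonde determinant is the bialternant formula
    of the empty shape, which also settles its sign.\<close>
  then have "det V = tableau_sum n (\<lambda>_. 0) y * vandermonde n y"
    using alternant_eq_tableau_sum[of n "\<lambda>_. 0" y] by (simp add: alternant_def)
  moreover have "row_diagram n (\<lambda>_. 0) = {}" by (auto simp: row_diagram_def)
  then have "tableaux n (\<lambda>_. 0) = {\<lambda>_. undefined}" "tableau_sum n (\<lambda>_. 0) y = 1"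
    by (auto simp: tableaux_def tableau_sum_def)
  ultimately show ?thesis using det_mult[OF UV] by simp
qed

text \<open>Each variable occurs in \<open>n - 1\<close> pairs.\<close>

lemma prod_pairs_power: "(\<Prod>j=1..n. \<Prod>i=1..<j. x i * x j) = (\<Prod>j=1..n. (x j :: complex) ^ (n - 1))"
proof (induction n)
  case (Suc n)
  have "(\<Prod>j=1..Suc n. \<Prod>i=1..<j. x i * x j) = (\<Prod>j=1..n. x j ^ (n - 1)) * (\<Prod>i=1..n. x i * x (Suc n))"
    using Suc by (simp add: atLeastLessThanSuc_atLeastAtMost)
  also have "\<dots> = (\<Prod>j=1..n. x j ^ (n - 1) * x j) * x (Suc n) ^ n" by (simp add: prod.distrib)
  also have "(\<Prod>j=1..n. x j ^ (n - 1) * x j) = (\<Prod>j=1..n. x j ^ n)"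
    by (intro prod.cong refl) (auto simp: power_Suc2[symmetric] simp del: power_Suc)
  finally show ?case by simp
qed simp

text \<open>The product of 1 + t w over the torus weights w of the exterior (\<open>s = 0\<close>)
  or symmetric (\<open>s = 2\<close>) square; its coefficient at t^d is the character of the
  \<open>d\<close>-th exterior power of that square.\<close>

definition pair_product :: "nat \<Rightarrow> nat \<Rightarrow> complex \<Rightarrow> (nat \<Rightarrow> complex) \<Rightarrow> complex" where
  "pair_product s n t x = (\<Prod>j=1..n. (if s = 0 then 1 else 1 + t * x j * x j) * (\<Prod>i=1..<j. 1 + t * x i * x j))"

theorem littlewood_identity:
  assumes s: "s = 0 \<or> s = 2" and x: "\<And>j. 1 \<le> j \<Longrightarrow> j \<le> n \<Longrightarrow> x j \<noteq> 0"
  shows "(\<Sum>\<nu>\<in>shifted_partitions s n. t ^ (sum_list \<nu> div 2) * tableau_sum n (part \<nu>) x) * vandermonde n x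
    = pair_product s n t x * vandermonde n x"
proof -
  define y where "y j = t * x j - 1 / x j" for j
  \<comment> \<open>The diagonal factor of the symmetric case; it equals z (a - b), the denominator
    of the quotient multiplied by z.\<close>
  define u where "u z = (if s = 0 then 1 else 1 + t * z * z)" for z
  define c :: complex where "c = (if s = 0 then 2 else 1)"
  have row: "littlewood_row s t n m z = poly (monic_poly c t m) (t * z - 1 / z) * (z ^ (n - 1) * u z)"
    if z: "z \<noteq> 0" and m: "m < n" for m z
  proof -
    define a where "a = t * z"
    define b where "b = - (1 / z)"
    have ab: "a * b = - t" using z by (simp add: a_def b_def)
    have abz: "t * z - 1 / z = a + b" by (simp add: a_def b_def)
    have zb: "z ^ (n - 1) * b ^ k = (- 1) ^ k * z ^ (n - 1 - k)" if "k \<le> n - 1" for k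
    proof -
      have "z ^ (n - 1) = z ^ (n - 1 - k) * z ^ k" by (simp only: power_add[symmetric] le_add_diff_inverse2[OF that])
      then have "z ^ (n - 1) * b ^ k = z ^ (n - 1 - k) * (z * b) ^ k" by (simp add: power_mult_distrib mult.assoc)
      also have "z * b = - 1" using z by (simp add: b_def)
      finally show ?thesis by (simp add: mult.commute)
    qed
    have mn: "m \<le> n - 1" using m by simp
    show ?thesis
    proof (cases "s = 0")
      case True
      show ?thesis
      proof (cases "m = 0")
        case True
        with \<open>s = 0\<close> show ?thesis by (simp add: littlewood_row_def u_def)
      next
        case False
        have "poly (monic_poly 2 t m) (a + b) * z ^ (n - 1) = a ^ m * z ^ (n - 1) + z ^ (n - 1) * b ^ m"
          using poly_monic_power_sum[OF ab, of m] False by (simp add: algebra_simps)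
        also have "\<dots> = t ^ m * z ^ (m + n - 1) + (- 1) ^ m * z ^ (n - 1 - m)"
          unfolding zb[OF mn] using m by (simp add: a_def power_mult_distrib power_add[symmetric] mult.assoc)
        finally show ?thesis using \<open>s = 0\<close> False by (simp add: littlewood_row_def u_def c_def abz)
      qed
    next
      case False
      then have s2: "s = 2" using s by simp
      have zab: "z * (a - b) = u z" using z s2 by (simp add: a_def b_def u_def algebra_simps)
      have "poly (monic_poly 1 t m) (a + b) * (z ^ (n - 1) * u z) = z ^ (n - 1) * z * ((a - b) * poly (monic_poly 1 t m) (a + b))"
        unfolding zab[symmetric] by (simp add: algebra_simps)
      also have "\<dots> = a ^ Suc m * (z ^ (n - 1) * z) - z * b * (z ^ (n - 1) * b ^ m)"
        unfolding poly_monic_quotient[OF ab] by (simp add: algebra_simps)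
      also have "z * b = - 1" using z by (simp add: b_def)
      also have "z ^ (n - 1) * z = z ^ n" using m by (cases n) auto
      also have "z ^ (n - 1) * b ^ m = (- 1) ^ m * z ^ (n - 1 - m)" by (rule zb[OF mn])
      also have "a ^ Suc m * z ^ n = t ^ Suc m * z ^ (m + s + n - 1)"
        using s2 by (simp add: a_def power_mult_distrib power_add)
      finally show ?thesis using s2 by (simp add: littlewood_row_def c_def abz)
    qed
  qed
  define B where "B = mat n n (\<lambda>(i, j). poly (monic_poly c t (n - 1 - i)) (y (Suc j)))"
  define d where "d j = x (Suc j) ^ (n - 1) * u (x (Suc j))" for j
  have Bc: "B \<in> carrier_mat n n" by (simp add: B_def)
  have "row_alternant (map (littlewood_row s t n) (rev [0..<n])) x = det (B * mat_diag n d)"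
    unfolding row_alternant_def mat_diag_mult_right[OF Bc]
    by (intro arg_cong[of _ _ det] eq_matI)
      (use x row in \<open>auto simp: B_def d_def y_def rev_nth\<close>)
  also have "\<dots> = det B * (\<Prod>j = 0..<n. d j)"
  proof -
    have "upper_triangular (mat_diag n d)" by (auto simp: mat_diag_def)
    from det_upper_triangular[OF this mat_diag_dim] have "det (mat_diag n d) = (\<Prod>j = 0..<n. d j)"
      by (simp add: prod_list_diag_prod) (simp add: mat_diag_def)
    then show ?thesis using det_mult[OF Bc mat_diag_dim] by simp
  qed
  also have "det B = vandermonde n y" unfolding B_def by (rule det_monic_poly)
  also have "(\<Prod>j = 0..<n. d j) = (\<Prod>j=1..n. x j ^ (n - 1) * u (x j))"
    unfolding d_def by (rule prod_Suc_shift)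
  \<comment> \<open>The powers that clear the denominators of the \<open>y j\<close> supply exactly
    one factor \<open>x i * x j\<close> for each difference \<open>y i - y j\<close>.\<close>
  also have "\<dots> = (\<Prod>j=1..n. \<Prod>i=1..<j. x i * x j) * (\<Prod>j=1..n. u (x j))"
    by (simp only: prod.distrib[of "\<lambda>j. x j ^ (n - 1)"] prod_pairs_power)
  also have "vandermonde n y * \<dots> = (\<Prod>j=1..n. u (x j) * (\<Prod>i=1..<j. (y i - y j) * (x i * x j)))"
    by (simp add: vandermonde_def prod.distrib mult_ac)
  also have "\<dots> = (\<Prod>j=1..n. u (x j) * (\<Prod>i=1..<j. (1 + t * x i * x j) * (x i - x j)))"
  proof (rule prod.cong[OF refl])
    fix j assume j: "j \<in> {1..n}"
    have "(y i - y j) * (x i * x j) = (1 + t * x i * x j) * (x i - x j)" if "i \<in> {1..<j}" for i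
      using x[of i] x[of j] that j by (simp add: y_def field_simps)
    then show "u (x j) * (\<Prod>i=1..<j. (y i - y j) * (x i * x j)) = u (x j) * (\<Prod>i=1..<j. (1 + t * x i * x j) * (x i - x j))"
      by (metis (no_types, lifting) prod.cong)
  qed
  also have "\<dots> = pair_product s n t x * vandermonde n x"
    by (simp add: pair_product_def vandermonde_def prod.distrib u_def mult_ac)
  finally show ?thesis using littlewood_alternant[of s t n x] s by auto
qed

section \<open>Threshold partitions, conjugates and Schur polynomials as stated in the
  theorem\<close>

lemma durfee_rank_iff:
  assumes \<nu>: "is_partition \<nu>" and i: "1 \<le> i"
  shows "i \<le> durfee_rank \<nu> \<longleftrightarrow> i \<le> part \<nu> i"
proof -
  define A where "A = {r. r \<le> length \<nu> \<and> r \<le> part \<nu> r}"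
  have A: "finite A" "0 \<in> A" by (auto simp: A_def)
  have d: "durfee_rank \<nu> = Max A" by (simp add: durfee_rank_def A_def)
  show ?thesis
  proof
    assume "i \<le> durfee_rank \<nu>"
    moreover have "durfee_rank \<nu> \<le> part \<nu> (durfee_rank \<nu>)"
    proof -
      have "Max A \<in> A" using Max_in[OF A(1)] A(2) by blast
      then show ?thesis unfolding d by (simp add: A_def)
    qed
    ultimately show "i \<le> part \<nu> i" using part_antimono[OF \<nu> i] by (meson order_trans)
  next
    assume le: "i \<le> part \<nu> i"
    then have "i \<le> length \<nu>" using part_pos_iff[OF \<nu> i] i by simp
    then show "i \<le> durfee_rank \<nu>" unfolding d using le A(1) by (intro Max_ge) (auto simp: A_def)
  qed
qed

lemma part_conjugate:
  assumes \<nu>: "is_partition \<nu>" and i: "1 \<le> i"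
  shows "part (conjugate_partition \<nu>) i = col_length \<nu> i"
proof -
  have eq: "{j. 1 \<le> j \<and> j \<le> length \<nu> \<and> i \<le> part \<nu> j} = {j. 1 \<le> j \<and> i \<le> part \<nu> j}"
    using i by (auto simp: part_def)
  have "col_length \<nu> i = 0" if "part \<nu> 1 < i"
    using col_length_iff[OF \<nu> i, of 1] that by simp
  then show ?thesis
    using part_map[OF i, of _ "part \<nu> 1"] eq by (auto simp: conjugate_partition_def col_length_def simp del: upt_Suc)
qed

lemma is_partition_conjugate:
  assumes \<nu>: "is_partition \<nu>"
  shows "is_partition (conjugate_partition \<nu>)"
proof -
  have eq: "conjugate_partition \<nu> = map (col_length \<nu>) [1..<Suc (part \<nu> 1)]"
    unfolding conjugate_partition_def
  proof (rule map_cong[OF refl])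
    fix i assume "i \<in> set [1..<Suc (part \<nu> 1)]"
    then have "{j. 1 \<le> j \<and> j \<le> length \<nu> \<and> i \<le> part \<nu> j} = {j. 1 \<le> j \<and> i \<le> part \<nu> j}"
      by (auto simp: part_def)
    then show "card {j. 1 \<le> j \<and> j \<le> length \<nu> \<and> i \<le> part \<nu> j} = col_length \<nu> i" by (simp add: col_length_def)
  qed
  show ?thesis unfolding eq
  proof (rule is_partition_map)
    fix i :: nat assume i: "1 \<le> i"
    have "{j. 1 \<le> j \<and> Suc i \<le> part \<nu> j} \<subseteq> {j. 1 \<le> j \<and> i \<le> part \<nu> j}" by auto
    from card_mono[OF finite_col[OF i] this] show "col_length \<nu> (Suc i) \<le> col_length \<nu> i" by (simp add: col_length_def)
    assume "i \<le> part \<nu> 1"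
    then show "1 \<le> col_length \<nu> i" using col_length_iff[OF \<nu> i, of 1] by simp
  qed
qed

lemma col_length_conjugate:
  assumes \<nu>: "is_partition \<nu>" and i: "1 \<le> i"
  shows "col_length (conjugate_partition \<nu>) i = part \<nu> i"
proof -
  have "{j. 1 \<le> j \<and> i \<le> part (conjugate_partition \<nu>) j} = {1..part \<nu> i}"
    using part_conjugate[OF \<nu>] col_length_iff[OF \<nu> _ i] by auto
  then show ?thesis by (simp add: col_length_def)
qed

lemma sum_list_eq_card_cells:
  assumes \<nu>: "is_partition \<nu>"
  shows "sum_list \<nu> = card {(i, j). 1 \<le> i \<and> 1 \<le> j \<and> j \<le> part \<nu> i}"
proof -
  have "{(i, j). 1 \<le> i \<and> 1 \<le> j \<and> j \<le> part \<nu> i} = Sigma {1..length \<nu>} (\<lambda>i. {1..part \<nu> i})"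
    by (auto simp: part_def split: if_splits)
  then show ?thesis using sum_list_parts[of \<nu> "length \<nu>"] by simp
qed

lemma sum_list_conjugate:
  assumes \<nu>: "is_partition \<nu>"
  shows "sum_list (conjugate_partition \<nu>) = sum_list \<nu>"
proof -
  have "{(i, j). 1 \<le> i \<and> 1 \<le> j \<and> j \<le> part (conjugate_partition \<nu>) i}
      = (\<lambda>(i, j). (j, i)) ` {(i, j). 1 \<le> i \<and> 1 \<le> j \<and> j \<le> part \<nu> i}"
    using part_conjugate[OF \<nu>] col_length_iff[OF \<nu>] by (auto simp: image_iff)
  moreover have "inj_on (\<lambda>(i, j). (j, i)) {(i :: nat, j :: nat). 1 \<le> i \<and> 1 \<le> j \<and> j \<le> part \<nu> i}"
    by (auto simp: inj_on_def)
  ultimately show ?thesis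
    unfolding sum_list_eq_card_cells[OF \<nu>] sum_list_eq_card_cells[OF is_partition_conjugate[OF \<nu>]]
    by (simp only: card_image)
qed

lemma is_threshold_iff:
  assumes \<nu>: "is_partition \<nu>"
  shows "is_threshold \<nu> \<longleftrightarrow> (\<forall>i\<ge>1. i \<le> part \<nu> i \<longrightarrow> col_length \<nu> i = part \<nu> i + 1)"
  unfolding is_threshold_def frobenius_alpha_def frobenius_beta_def
  using durfee_rank_iff[OF \<nu>] part_conjugate[OF \<nu>] by force

lemma threshold_shifted:
  "{\<nu> \<in> TP (2 * d). length \<nu> \<le> n} = {\<nu> \<in> shifted_partitions 0 n. sum_list \<nu> div 2 = d}"
proof -
  \<comment> \<open>The power of \<open>t\<close> records only half of the size, rounded down; since
    sizes are even, nothing is lost.\<close>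
  have "sum_list \<nu> = 2 * d \<longleftrightarrow> sum_list \<nu> div 2 = d" if "\<nu> \<in> shifted_partitions 0 n" for \<nu>
    using shifted_partitions_even[OF _ that] by (auto elim!: evenE)
  then show ?thesis
    unfolding TP_def shifted_partitions_def using is_threshold_iff by (auto 0 4)
qed

text \<open>Conjugation exchanges \<alpha> and \<beta>, and \<alpha>_i = \<beta>_i + 1 is \<beta>_i
  + 2 = \<alpha>_i + 1. The range of \<open>i\<close> is unaffected, since a diagonal cell lies in
  \<nu> iff it lies in the conjugate.\<close>

lemma conjugate_threshold_shifted:
  "{\<nu>. is_partition \<nu> \<and> conjugate_partition \<nu> \<in> TP (2 * d) \<and> length \<nu> \<le> n}
    = {\<nu> \<in> shifted_partitions 2 n. sum_list \<nu> div 2 = d}"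
proof -
  have "sum_list \<nu> = 2 * d \<longleftrightarrow> sum_list \<nu> div 2 = d" if "\<nu> \<in> shifted_partitions 2 n" for \<nu>
    using shifted_partitions_even[OF _ that] by (auto elim!: evenE)
  moreover have "is_threshold (conjugate_partition \<nu>) \<longleftrightarrow>
      (\<forall>i\<ge>1. i \<le> part \<nu> i \<longrightarrow> col_length \<nu> i + 2 = part \<nu> i + 1)" if \<nu>: "is_partition \<nu>" for \<nu>
    unfolding is_threshold_iff[OF is_partition_conjugate[OF \<nu>]]
    using part_conjugate[OF \<nu>] col_length_conjugate[OF \<nu>] col_length_iff[OF \<nu>] by auto
  ultimately show ?thesis
    unfolding TP_def shifted_partitions_def using is_partition_conjugate sum_list_conjugate by (auto 0 4)
qed

lemma young_diagram_eq: "length \<nu> \<le> n \<Longrightarrow> young_diagram \<nu> = row_diagram n (part \<nu>)"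
  by (auto simp: young_diagram_def row_diagram_def part_def split: if_splits)

lemma SSYT_eq: "length \<nu> \<le> n \<Longrightarrow> SSYT n \<nu> = tableaux n (part \<nu>)"
  by (simp add: SSYT_def tableaux_def young_diagram_eq)

lemma schur_poly_eq:
  assumes "length \<nu> \<le> n"
  shows "schur_poly n \<nu> x = tableau_sum n (part \<nu>) x"
  unfolding schur_poly_def tableau_sum_def SSYT_eq[OF assms] young_diagram_eq[OF assms]
proof (rule sum.cong[OF refl])
  fix T assume T: "T \<in> tableaux n (part \<nu>)"
  define D where "D = row_diagram n (part \<nu>)"
  have "T ` D \<subseteq> {1..n}" using tableauxD(1)[OF T] by (force simp: D_def)
  then have "(\<Prod>i=1..n. \<Prod>c\<in>{c \<in> D. T c = i}. x (T c)) = (\<Prod>c\<in>D. x (T c))"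
    by (intro prod.group) (auto simp: D_def)
  then show "(\<Prod>i=1..n. x i ^ card {c \<in> row_diagram n (part \<nu>). T c = i}) = (\<Prod>c\<in>row_diagram n (part \<nu>). x (T c))"
    by (simp add: D_def)
qed

text \<open>Setting \<open>x\<^sub>1 = \<dots> = x\<^sub>k = t\<close> and the other variables to \<open>1\<close> gives a polynomial in \<open>t\<close> with
  nonnegative coefficients; its degree \<open>\<nu>\<^sub>1 + \<dots> + \<nu>\<^sub>k\<close> is attained by the tableau with all entries of
  row \<open>i\<close> equal to \<open>i\<close>.\<close>

lemma tableau_sum_specialize:
  assumes anti: "\<And>i. 1 \<le> i \<Longrightarrow> i < n \<Longrightarrow> \<nu> (Suc i) \<le> \<nu> i" and k: "k \<le> n"
  obtains p where "\<And>t. t \<noteq> 0 \<Longrightarrow> tableau_sum n \<nu> (\<lambda>i. if i \<le> k then t else 1) = poly p t" "p \<noteq> 0"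
    "degree p = (\<Sum>i=1..k. \<nu> i)"
proof -
  define D where "D = row_diagram n \<nu>"
  define m where "m T = card {c \<in> D. T c \<le> k}" for T
  define p where "p = (\<Sum>T\<in>tableaux n \<nu>. monom (1 :: complex) (m T))"
  define N where "N = (\<Sum>i=1..k. \<nu> i)"
  have val: "tableau_sum n \<nu> (\<lambda>i. if i \<le> k then t else 1) = poly p t" for t
  proof -
    have "(\<Prod>c\<in>D. if T c \<le> k then t else 1) = t ^ m T" for T
      unfolding m_def by (simp add: prod.If_cases D_def Int_def)
    then show ?thesis by (simp add: tableau_sum_def p_def poly_sum poly_monom flip: D_def)
  qed
  have le: "m T \<le> N" if T: "T \<in> tableaux n \<nu>" for T
  proof -
    have "{c \<in> D. T c \<le> k} \<subseteq> row_diagram k \<nu>"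
      using tableau_ge_row[OF T anti] by (fastforce simp: D_def row_diagram_def)
    from card_mono[OF _ this] show ?thesis by (simp add: m_def N_def card_row_diagram)
  qed
  define T0 where "T0 = restrict fst D"
  have T0: "T0 \<in> tableaux n \<nu>" by (auto simp: T0_def tableaux_def D_def row_diagram_def)
  have "{c \<in> D. T0 c \<le> k} = row_diagram k \<nu>" using k by (auto simp: T0_def D_def row_diagram_def)
  then have "m T0 = N" by (simp add: m_def N_def card_row_diagram)
  then have "{T \<in> tableaux n \<nu>. m T = N} \<noteq> {}" using T0 by auto
  moreover have "coeff p N = of_nat (card {T \<in> tableaux n \<nu>. m T = N})"
    by (simp add: p_def coeff_sum sum.If_cases Int_def)
  ultimately have c: "coeff p N \<noteq> 0" by simp
  have "degree p \<le> N"
    unfolding p_def by (rule degree_sum_le) (use le in \<open>auto simp: degree_monom_eq\<close>)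
  then have "degree p = N" using le_degree[OF c] by simp
  moreover have "p \<noteq> 0" using c by auto
  ultimately show ?thesis using that[of p] val by (simp add: N_def)
qed

text \<open>The degrees of the specialisations give the partial sums of the parts, whose differences
  are the parts. The specialised points avoid zero coordinates for \<open>t \<noteq> 0\<close>, and
  agreement at infinitely many \<open>t\<close> identifies the polynomials.\<close>

lemma schur_poly_inj:
  assumes \<mu>: "is_partition \<mu>" "length \<mu> \<le> n" and \<nu>: "is_partition \<nu>" "length \<nu> \<le> n"
    and eq: "\<And>x. (\<forall>i\<in>{1..n}. x i \<noteq> 0) \<Longrightarrow> schur_poly n \<mu> x = schur_poly n \<nu> x"
  shows "\<mu> = \<nu>"
proof -
  have sums: "(\<Sum>i=1..k. part \<mu> i) = (\<Sum>i=1..k. part \<nu> i)" if k: "k \<le> n" for k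
  proof -
    obtain p where p: "\<And>t. t \<noteq> 0 \<Longrightarrow> tableau_sum n (part \<mu>) (\<lambda>i. if i \<le> k then t else 1) = poly p t"
      "degree p = (\<Sum>i=1..k. part \<mu> i)"
      by (rule tableau_sum_specialize[of n "part \<mu>" k]) (use part_antimono[OF \<mu>(1)] k in auto)
    obtain q where q: "\<And>t. t \<noteq> 0 \<Longrightarrow> tableau_sum n (part \<nu>) (\<lambda>i. if i \<le> k then t else 1) = poly q t"
      "degree q = (\<Sum>i=1..k. part \<nu> i)"
      by (rule tableau_sum_specialize[of n "part \<nu>" k]) (use part_antimono[OF \<nu>(1)] k in auto)
    have "poly (p - q) t = 0" if "t \<noteq> 0" for t
      using eq[of "\<lambda>i. if i \<le> k then t else 1"] that p(1)[OF that] q(1)[OF that] \<mu>(2) \<nu>(2)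
      by (simp add: schur_poly_eq)
    then have "UNIV - {0} \<subseteq> {t. poly (p - q) t = 0}" by auto
    moreover have "infinite (UNIV - {0 :: complex})" by (simp add: infinite_UNIV_char_0)
    ultimately have "p - q = 0" using poly_roots_finite finite_subset by blast
    then show ?thesis using p(2) q(2) by simp
  qed
  have "part \<mu> i = part \<nu> i" if i: "1 \<le> i" for i
  proof (cases "i \<le> n")
    case True
    obtain j where j: "i = Suc j" using i by (cases i) auto
    show ?thesis using sums[of i] sums[of j] True j by simp
  next
    case False
    then show ?thesis using \<mu>(2) \<nu>(2) by (simp add: part_def)
  qed
  then show ?thesis by (rule partition_eqI[OF \<mu>(1) \<nu>(1)])
qed

lemma prod_one_plus: "finite A \<Longrightarrow> (\<Prod>a\<in>A. 1 + t * f a) = (\<Sum>S\<in>Pow A. t ^ card S * (\<Prod>a\<in>S. f a :: complex))"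
proof (induction A rule: finite_induct)
  case (insert a A)
  have inj: "inj_on (insert a) (Pow A)" using insert by (auto simp: inj_on_def)
  have "(\<Sum>S\<in>insert a ` Pow A. t ^ card S * (\<Prod>a\<in>S. f a)) = (\<Sum>S\<in>Pow A. t * f a * (t ^ card S * (\<Prod>a\<in>S. f a)))"
    unfolding sum.reindex[OF inj] comp_def
  proof (rule sum.cong[OF refl])
    fix S assume "S \<in> Pow A"
    then have "finite S" "a \<notin> S" using insert finite_subset by auto
    then show "t ^ card (insert a S) * prod f (insert a S) = t * f a * (t ^ card S * prod f S)" by simp
  qed
  moreover have "Pow A \<inter> insert a ` Pow A = {}" using insert by auto
  ultimately show ?case using insert
    by (simp add: Pow_insert sum.union_disjoint sum_distrib_left distrib_right)
qed simp

text \<open>Both sides of the Littlewood identity are polynomials in \<open>t\<close>; compare the coefficients of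
  \<open>t\<^sup>d\<close>. The coincidences \<open>x\<^sub>i = x\<^sub>j\<close>, where nothing can be cancelled, are reached by continuity.\<close>

lemma elementary_eq_schur_sum:
  assumes s: "s = 0 \<or> s = 2" and x: "\<And>j. 1 \<le> j \<Longrightarrow> j \<le> n \<Longrightarrow> x j \<noteq> 0" and P: "finite P"
    and pair: "\<And>t x. pair_product s n t x = (\<Prod>(i, j)\<in>P. 1 + t * (x i * x j))"
  shows "(\<Sum>S | S \<subseteq> P \<and> card S = d. \<Prod>(i, j)\<in>S. x i * x j)
    = (\<Sum>\<nu>\<in>{\<nu> \<in> shifted_partitions s n. sum_list \<nu> div 2 = d}. tableau_sum n (part \<nu>) x)" (is "?L x = ?R x")
proof -
  have generic: "?L x = ?R x" if x: "\<And>j. 1 \<le> j \<Longrightarrow> j \<le> n \<Longrightarrow> x j \<noteq> 0" and v: "vandermonde n x \<noteq> 0" for x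
  proof -
    define p where "p = (\<Sum>S\<in>Pow P. monom (\<Prod>(i, j)\<in>S. x i * x j) (card S))"
    define q where "q = (\<Sum>\<nu>\<in>shifted_partitions s n. monom (tableau_sum n (part \<nu>) x) (sum_list \<nu> div 2))"
    have "poly p t = poly q t" for t
    proof -
      have "poly p t = pair_product s n t x"
        unfolding pair using prod_one_plus[OF P, of t "\<lambda>(i, j). x i * x j"]
        by (simp add: p_def poly_sum poly_monom case_prod_beta mult.commute)
      also have "\<dots> = (\<Sum>\<nu>\<in>shifted_partitions s n. t ^ (sum_list \<nu> div 2) * tableau_sum n (part \<nu>) x)"
      proof -
        have "(\<Sum>\<nu>\<in>shifted_partitions s n. t ^ (sum_list \<nu> div 2) * tableau_sum n (part \<nu>) x) * vandermonde n x
            = pair_product s n t x * vandermonde n x"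
          by (rule littlewood_identity[OF s x])
        then show ?thesis using v by simp
      qed
      also have "\<dots> = poly q t" by (simp add: q_def poly_sum poly_monom mult.commute)
      finally show ?thesis .
    qed
    then have "p = q" by (intro poly_eqI_degree_lead_coeff poly_ext) auto
    then have "coeff p d = coeff q d" by simp
    then show ?thesis using P finite_shifted_partitions[of s n]
      by (simp add: p_def q_def coeff_sum sum.If_cases Int_def Pow_def)
  qed
  \<comment> \<open>The direction of the perturbation has pairwise distinct coordinates, so small
    nonzero \<open>e\<close> separates coinciding variables.\<close>
  define y where "y e j = x j + e * of_nat j" for e :: complex and j
  have cont: "isCont (\<lambda>e. ?L (y e)) 0" "isCont (\<lambda>e. ?R (y e)) 0"
    unfolding y_def tableau_sum_def case_prod_beta by (intro continuous_intros)+
  have ev_eq: "eventually (\<lambda>e. ?L (y e) = ?R (y e)) (at 0)"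
  proof -
    \<comment> \<open>An affine function of \<open>e\<close> that is not identically zero has at
      most one root.\<close>
    have ev: "eventually (\<lambda>e :: complex. a + e * b \<noteq> 0) (at 0)" if "a \<noteq> 0 \<or> b \<noteq> 0" for a b
    proof (cases "b = 0")
      case False
      have "eventually (\<lambda>e. e \<noteq> - a / b) (at (0 :: complex))"
      proof (cases "a = 0")
        case True
        then show ?thesis by (simp add: eventually_at_filter)
      next
        case False
        then have "- a / b \<noteq> 0" using \<open>b \<noteq> 0\<close> by simp
        then show ?thesis using t1_space_nhds[of 0 "- a / b"] by (auto simp: eventually_at_filter elim: eventually_mono)
      qed
      then show ?thesis by (rule eventually_mono) (use False in \<open>auto simp: field_simps add_eq_0_iff\<close>)
    qed (use that in simp)
    have 1: "eventually (\<lambda>e. \<forall>j\<in>{1..n}. y e j \<noteq> 0) (at 0)"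
      by (intro eventually_ball_finite ballI) (use x in \<open>auto simp: y_def intro!: ev\<close>)
    have "eventually (\<lambda>e. \<forall>j\<in>{1..n}. \<forall>i\<in>{1..<j}. (x i - x j) + e * (of_nat i - of_nat j) \<noteq> 0) (at 0)"
      by (intro eventually_ball_finite ballI ev) auto
    then have 2: "eventually (\<lambda>e. vandermonde n (y e) \<noteq> 0) (at 0)"
      by (rule eventually_mono) (auto simp: vandermonde_def y_def algebra_simps)
    from 1 2 show ?thesis by (rule eventually_elim2) (use generic in auto)
  qed
  have "((\<lambda>e. ?R (y e)) \<longlongrightarrow> ?R (y 0)) (at 0)" using cont(2) by (simp only: isCont_def)
  then have R: "((\<lambda>e. ?L (y e)) \<longlongrightarrow> ?R (y 0)) (at 0)" using tendsto_cong[OF ev_eq] by blast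
  have L: "((\<lambda>e. ?L (y e)) \<longlongrightarrow> ?L (y 0)) (at 0)" using cont(1) by (simp only: isCont_def)
  have "?L (y 0) = ?R (y 0)" by (rule tendsto_unique[OF at_neq_bot L R])
  then show ?thesis by (simp add: y_def)
qed

section \<open>The decomposition\<close>

text \<open>Common to both halves of the theorem: \<open>R\<close> is the exterior or the symmetric
  square, and \<open>P\<close> labels its weights by pairs of variables. Its \<open>d\<close>-th
  exterior power has as character the \<open>d\<close>-th elementary symmetric polynomial of these
  weights.\<close>

lemma rep_iso_exterior_power:
  fixes R :: "'a rep" and W :: "nat list \<Rightarrow> 'w rep"
  assumes u: "unitary_basis n R P e \<kappa> w"
    and w: "\<And>p x. p \<in> P \<Longrightarrow> w p (\<lambda>i. x (Suc i)) = x (fst p) * x (snd p)"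
    and s: "s = 0 \<or> s = 2"
    and pair: "\<And>t x. pair_product s n t x = (\<Prod>(i, j)\<in>P. 1 + t * (x i * x j))"
    and W: "\<And>\<nu>. is_partition \<nu> \<Longrightarrow> is_schur_rep n \<nu> (W \<nu>)"
    and I: "\<And>\<nu>. \<nu> \<in> I \<Longrightarrow> is_partition \<nu>"
    and X: "{\<nu> \<in> I. length \<nu> \<le> n} = {\<nu> \<in> shifted_partitions s n. sum_list \<nu> div 2 = d}"
  shows "rep_iso n (exterior_power d R) (direct_sum_rep I W)"
proof -
  define X where "X = {\<nu> \<in> I. length \<nu> \<le> n}"
  have P: "finite P" by (rule dual_basisD(1)[OF unitary_basisD(2)[OF u]])
  \<comment> \<open>The basis of an exterior power is indexed by sets of numbers, so the labels in
    \<open>P\<close> are enumerated.\<close>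
  obtain h where h: "bij_betw h {..<card P} P"
    using ex_bij_betw_nat_finite[OF P] by (auto simp: atLeast0LessThan)
  define V where "V = exterior_power d R"
  define J where "J = {S. S \<subseteq> {..<card P} \<and> card S = d}"
  note uV = unitary_basis_exterior_power[OF unitary_basis_reindex[OF u h], of d, folded V_def J_def]
  have schur: "is_polynomial_rep n (W \<nu>)" "is_irreducible n (W \<nu>)" "is_rep n (W \<nu>)"
    "\<And>x. (\<forall>i\<in>{1..n}. x i \<noteq> 0) \<Longrightarrow> character n (W \<nu>) x = schur_poly n \<nu> x" if "\<nu> \<in> X" for \<nu>
    using W[OF I, of \<nu>] that by (auto simp: is_schur_rep_def X_def is_polynomial_rep_def)
  have big: "rep_space (W \<nu>) = {0}" "is_rep n (W \<nu>)" if "\<nu> \<in> I - X" for \<nu>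
    using W[OF I, of \<nu>] that by (auto simp: is_schur_rep_def X_def)
  have trV: "trace_on (rep_space V) (rep_act V (mat_diag n (\<lambda>i. x (Suc i)))) = (\<Sum>\<nu>\<in>X. schur_poly n \<nu> x)"
    if x: "\<And>i. 1 \<le> i \<Longrightarrow> i \<le> n \<Longrightarrow> x i \<noteq> 0" for x
  proof -
    have hP: "h i \<in> P" if "i < card P" for i using h that by (auto simp: bij_betw_def)
    have "trace_on (rep_space V) (rep_act V (mat_diag n (\<lambda>i. x (Suc i)))) =
        (\<Sum>S\<in>J. \<Prod>i\<in>S. (w \<circ> h) i (\<lambda>i. x (Suc i)))"
      by (rule unitary_basis_trace[OF uV]) (use x in auto)
    also have "\<dots> = (\<Sum>S\<in>J. \<Prod>p\<in>h ` S. x (fst p) * x (snd p))"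
    proof (rule sum.cong[OF refl])
      fix S assume S: "S \<in> J"
      have inj: "inj_on h S"
        by (rule inj_on_subset[OF bij_betw_imp_inj_on[OF h]]) (use S in \<open>auto simp: J_def\<close>)
      show "(\<Prod>i\<in>S. (w \<circ> h) i (\<lambda>i. x (Suc i))) = (\<Prod>p\<in>h ` S. x (fst p) * x (snd p))"
        unfolding prod.reindex[OF inj] comp_def
        by (rule prod.cong[OF refl], rule w, rule hP) (use S in \<open>auto simp: J_def\<close>)
    qed
    also have "\<dots> = (\<Sum>S | S \<subseteq> P \<and> card S = d. \<Prod>p\<in>S. x (fst p) * x (snd p))"
    proof (rule sum.reindex_bij_betw)
      have Pow: "bij_betw (\<lambda>S. h ` S) (Pow {..<card P}) (Pow P)" by (rule bij_betw_Pow[OF h])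
      have card: "card (h ` S) = card S" if "S \<subseteq> {..<card P}" for S
        by (rule card_image[OF inj_on_subset[OF bij_betw_imp_inj_on[OF h] that]])
      show "bij_betw (\<lambda>S. h ` S) J {S. S \<subseteq> P \<and> card S = d}"
        unfolding bij_betw_def
      proof
        show "inj_on (\<lambda>S. h ` S) J"
          by (rule inj_on_subset[OF bij_betw_imp_inj_on[OF Pow]]) (auto simp: J_def)
        show "(\<lambda>S. h ` S) ` J = {S. S \<subseteq> P \<and> card S = d}"
        proof
          show "(\<lambda>S. h ` S) ` J \<subseteq> {S. S \<subseteq> P \<and> card S = d}" using card hP by (auto simp: J_def)
          show "{S. S \<subseteq> P \<and> card S = d} \<subseteq> (\<lambda>S. h ` S) ` J"
          proof
            fix S assume S: "S \<in> {S. S \<subseteq> P \<and> card S = d}"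
            then have "S \<in> (`) h ` Pow {..<card P}" by (simp add: bij_betw_imp_surj_on[OF Pow])
            then obtain S' where "S' \<subseteq> {..<card P}" "S = h ` S'" by blast
            then show "S \<in> (`) h ` J" using S card by (auto simp: J_def)
          qed
        qed
      qed
    qed
    also have "\<dots> = (\<Sum>\<nu>\<in>X. tableau_sum n (part \<nu>) x)"
    proof -
      have "(\<Sum>S | S \<subseteq> P \<and> card S = d. \<Prod>(i, j)\<in>S. x i * x j)
          = (\<Sum>\<nu>\<in>{\<nu> \<in> shifted_partitions s n. sum_list \<nu> div 2 = d}. tableau_sum n (part \<nu>) x)"
        by (rule elementary_eq_schur_sum[OF s x P pair])
      then show ?thesis unfolding X_def X by (simp add: case_prod_beta)
    qed
    also have "\<dots> = (\<Sum>\<nu>\<in>X. schur_poly n \<nu> x)" by (simp add: schur_poly_eq X_def)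
    finally show ?thesis .
  qed
  have trW: "trace_on (rep_space (W \<nu>)) (rep_act (W \<nu>) (mat_diag n (\<lambda>i. x (Suc i)))) = schur_poly n \<nu> x"
    if "\<nu> \<in> X" "\<And>i. 1 \<le> i \<Longrightarrow> i \<le> n \<Longrightarrow> x i \<noteq> 0" for \<nu> x
    using schur(4)[OF that(1), of x] that(2) by (simp add: character_def)
  show ?thesis unfolding V_def[symmetric]
  proof (rule rep_iso_direct_sum_of_traces[where X = X])
    show "is_rep n V" by (rule unitary_basisD(1)[OF uV])
    show "semisimple n V" by (rule unitary_basis_semisimple[OF uV])
    show "finite X" unfolding X_def X by (simp add: finite_shifted_partitions)
    show "X \<subseteq> I" by (auto simp: X_def)
  next
    fix \<mu> \<nu> assume \<mu>: "\<mu> \<in> X" and \<nu>: "\<nu> \<in> X" and ne: "\<mu> \<noteq> \<nu>"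
    show "\<not> rep_iso n (W \<mu>) (W \<nu>)"
    proof
      assume iso: "rep_iso n (W \<mu>) (W \<nu>)"
      have "schur_poly n \<mu> x = schur_poly n \<nu> x" if x: "\<forall>i\<in>{1..n}. x i \<noteq> 0" for x
      proof -
        have g: "mat_diag n (\<lambda>i. x (Suc i)) \<in> GL n" by (rule mat_diag_GL) (use x in auto)
        from equal_traces_of_rep_iso[OF schur(3)[OF \<mu>] schur(3)[OF \<nu>] iso g] show ?thesis
          using trW[OF \<mu>, of x] trW[OF \<nu>, of x] x by auto
      qed
      then have "\<mu> = \<nu>" by (intro schur_poly_inj[of \<mu> n \<nu>]) (use \<mu> \<nu> I in \<open>auto simp: X_def\<close>)
      with ne show False by simp
    qed
  next
    fix g assume g: "g \<in> GL n"
    obtain B P Q where tri: "B \<in> GL n" "upper_triangular B" "P \<in> GL n" "Q \<in> GL n" "Q * P = 1\<^sub>m n" "g = P * B * Q"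
      by (rule GL_triangular_form[OF g])
    define y where "y i = B $$ (i, i)" for i
    have y: "y i \<noteq> 0" if "i < n" for i
      using upper_triangular_GL[OF GL_carrier[OF tri(1)] tri(2)] tri(1) that by (simp add: y_def)
    \<comment> \<open>The same triangular form of \<open>g\<close> serves for \<open>V\<close> and
      for every summand, so all traces are compared at one diagonal matrix.\<close>
    note torus = trace_triangular_form[OF _ tri, folded y_def]
    \<comment> \<open>Variables are numbered from 1, matrix indices from 0.\<close>
    define x where "x i = y (i - 1)" for i
    have x: "x i \<noteq> 0" if "1 \<le> i" "i \<le> n" for i using y[of "i - 1"] that by (simp add: x_def)
    have y_eq: "y = (\<lambda>i. x (Suc i))" by (simp add: x_def)
    have "trace_on (rep_space V) (rep_act V g) = (\<Sum>\<nu>\<in>X. schur_poly n \<nu> x)"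
      using torus[OF unitary_basis_polynomial_trace[OF uV]] trV[of x] x by (simp add: y_eq)
    also have "\<dots> = (\<Sum>\<nu>\<in>X. trace_on (rep_space (W \<nu>)) (rep_act (W \<nu>) g))"
      using torus[OF polynomial_rep_trace[OF schur(1)]] trW[of _ x] x by (intro sum.cong) (auto simp: y_eq)
    finally show "trace_on (rep_space V) (rep_act V g) = (\<Sum>\<nu>\<in>X. trace_on (rep_space (W \<nu>)) (rep_act (W \<nu>) g))" .
  next
    show "is_rep n (W \<nu>)" "is_irreducible n (W \<nu>)" if "\<nu> \<in> X" for \<nu> using schur(2,3)[OF that] by auto
    show "rep_space (W \<nu>) = {0}" "is_rep n (W \<nu>)" if "\<nu> \<in> I - X" for \<nu> using big[OF that] by auto
  qed
qed

lemma pair_product_exterior: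
  "pair_product 0 n t x = (\<Prod>(i, j)\<in>Sigma {1..n} (\<lambda>j. {1..<j}). 1 + t * (x i * x j))"
  unfolding pair_product_def by (simp add: prod.Sigma mult_ac)

lemma pair_product_symmetric:
  "pair_product 2 n t x = (\<Prod>(i, j)\<in>Sigma {1..n} (\<lambda>j. {1..j}). 1 + t * (x i * x j))"
proof -
  have "(1 + t * x j * x j) * (\<Prod>i=1..<j. 1 + t * x i * x j) = (\<Prod>i=1..j. 1 + t * (x j * x i))" if "1 \<le> j" for j
  proof -
    have "{1..j} = insert j {1..<j}" using that by auto
    then show ?thesis by (simp add: mult_ac)
  qed
  then have "pair_product 2 n t x = (\<Prod>j=1..n. \<Prod>i=1..j. 1 + t * (x j * x i))"
    unfolding pair_product_def by (intro prod.cong) auto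
  then show ?thesis by (simp add: prod.Sigma)
qed

text \<open>Pairs have the larger index first, as in the nested product of
  \<open>pair_product\<close>; the predecessors translate variables into basis indices.\<close>

lemma bij_pairs_subsets:
  fixes n :: nat
  shows
  "bij_betw (\<lambda>(j, i). {i - 1, j - 1}) (Sigma {1..n} (\<lambda>j. {1..<j})) {S. S \<subseteq> {..<n} \<and> card S = 2}"
  unfolding bij_betw_def
proof
  show "inj_on (\<lambda>(j, i). {i - 1, j - 1}) (Sigma {1..n} (\<lambda>j. {1..<j}))"
  proof (rule inj_onI, clarify)
    fix i j i' j' assume "{i - 1, j - 1} = {i' - 1, j' - 1}" "j \<in> {1..n}" "i \<in> {1..<j}" "j' \<in> {1..n}" "i' \<in> {1..<j'}"
    then show "j = j' \<and> i = i'" unfolding doubleton_eq_iff by auto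
  qed
  show "(\<lambda>(j, i). {i - 1, j - 1}) ` (Sigma {1..n} (\<lambda>j. {1..<j})) = {S. S \<subseteq> {..<n} \<and> card S = 2}"
  proof (intro equalityI subsetI)
    fix S assume "S \<in> {S. S \<subseteq> {..<n} \<and> card S = 2}"
    then obtain a b where "S = {a, b}" "a \<noteq> b" "a < n" "b < n" by (auto simp: card_2_iff)
    then obtain a b where ab: "S = {a, b}" "a < b" "b < n" by (metis insert_commute linorder_neqE_nat)
    then show "S \<in> (\<lambda>(j, i). {i - 1, j - 1}) ` (Sigma {1..n} (\<lambda>j. {1..<j}))"
      by (intro image_eqI[of _ _ "(Suc b, Suc a)"]) auto
  qed (auto simp: card_insert_if)
qed

lemma bij_pairs_pairs:
  fixes n :: nat
  shows
  "bij_betw (\<lambda>(j, i). (i - 1, j - 1)) (Sigma {1..n} (\<lambda>j. {1..j})) {(i :: nat, j). i \<le> j \<and> j < n}"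
  by (rule bij_betwI[where g = "\<lambda>(i, j). (Suc j, Suc i)"]) auto

theorem theorem35:
  fixes n d :: nat and W :: "nat list \<Rightarrow> 'w rep"
  assumes "n \<ge> 1"
    and "\<And>\<nu>. is_partition \<nu> \<Longrightarrow> is_schur_rep n \<nu> (W \<nu>)"
  shows "rep_iso n (exterior_power d (exterior_power 2 (defining_rep n)))
           (direct_sum_rep (TP (2 * d)) W)
       \<and> rep_iso n (exterior_power d (symmetric_power 2 (defining_rep n)))
           (direct_sum_rep {\<nu>. is_partition \<nu> \<and> conjugate_partition \<nu> \<in> TP (2 * d)} W)"
proof
  note base = unitary_basis_defining_rep[of n]
  show "rep_iso n (exterior_power d (exterior_power 2 (defining_rep n))) (direct_sum_rep (TP (2 * d)) W)"
  proof (rule rep_iso_exterior_power[OF unitary_basis_reindex[OF unitary_basis_exterior_power[OF base] bij_pairs_subsets]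
        _ _ pair_product_exterior assms(2)])
    show "{\<nu> \<in> TP (2 * d). length \<nu> \<le> n} = {\<nu> \<in> shifted_partitions 0 n. sum_list \<nu> div 2 = d}"
      by (rule threshold_shifted)
    fix p and x :: "nat \<Rightarrow> complex" assume "p \<in> Sigma {1..n} (\<lambda>j. {1..<j})"
    then show "((\<lambda>S y. \<Prod>s\<in>S. y s) \<circ> (\<lambda>(j, i). {i - 1, j - 1})) p (\<lambda>i. x (Suc i)) = x (fst p) * x (snd p)"
      by auto
  qed (auto simp: TP_def)
  show "rep_iso n (exterior_power d (symmetric_power 2 (defining_rep n)))
      (direct_sum_rep {\<nu>. is_partition \<nu> \<and> conjugate_partition \<nu> \<in> TP (2 * d)} W)"
  proof (rule rep_iso_exterior_power[OF unitary_basis_reindex[OF unitary_basis_symmetric_square[OF base] bij_pairs_pairs]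
        _ _ pair_product_symmetric assms(2)])
    show "{\<nu> \<in> {\<nu>. is_partition \<nu> \<and> conjugate_partition \<nu> \<in> TP (2 * d)}. length \<nu> \<le> n}
        = {\<nu> \<in> shifted_partitions 2 n. sum_list \<nu> div 2 = d}"
      using conjugate_threshold_shifted[of d n] by auto
    fix p and x :: "nat \<Rightarrow> complex" assume "p \<in> Sigma {1..n} (\<lambda>j. {1..j})"
    then show "((\<lambda>(i, j) y. y i * y j) \<circ> (\<lambda>(j, i). (i - 1, j - 1))) p (\<lambda>i. x (Suc i)) = x (fst p) * x (snd p)"
      by auto
  qed auto
qed

end
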